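(* Let $M$ be an $n$-dimensional closed manifold ($n>1$) with a smooth family of Riemannian metrics $g(t)$, $t\in[0,T]$, satisfying $\partial_t g_{ij}=-2h_{ij}$, where $h=h(t)$ is a smooth time-dependent symmetric $(0,2)$-tensor. Let $p\in[1,\infty)$ and let $\lambda_{p,1}(t)$ be the first nonzero eigenvalue of the $p$-Laplacian on $(M,g(t))$, with corresponding eigenfunction $u(t)=u(t,x)$ at time $t\in[0,T]$, normalized by $\int_M|u|^p\,d\mu=1$. Suppose that $$h_{ij}-\alpha\mathcal{H}g_{ij}\ge0,\qquad\alpha\in[1/p,1/n),$$ along the flow, and that $\mathcal{H}$ is nonnegative. Then for $t_1<t_2$ in $[0,T]$ $$\lambda_{p,1}(t_2)\ \ge\ \lambda_{p,1}(t_1)+\int_{t_1}^{t_2}\Theta(g(t),u(t))\,dt,$$ where $$\Theta(g(t),u(t))=\lambda_{p,1}(t)\int_M\mathcal{H}|u|^p\,d\mu+(\alpha p-1)\int_M\mathcal{H}|\nabla u|^p\,d\mu .$$ Furthermore, if $\mathcal{H}\ge\mathcal{H}_{\min}>0$ and $\mathcal{H}$ satisfies $$\frac{\partial}{\partial t}\mathcal{H}\ \ge\ \Delta\mathcal{H}+\frac2n\mathcal{H}^2,$$ then for all times $t_1<t_2$ $$\lambda_{p,1}(t_2)\ \ge\ \lambda_{p,1}(t_1)\exp\Big\{\alpha p\int_{t_1}^{t_2}\psi(t)\,dt\Big\},\qquad\psi(t)=\frac{\mathcal{H}_{\min}(0)}{1-\frac2n\mathcal{H}_{\min}(0)\,t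}.$$
   Context: Closed means compact without boundary. The $p$-Laplacian is $\Delta_{p,g}f=\operatorname{div}(|\nabla f|^{p-2}\nabla f)$, with eigenvalue problem $\Delta_{p,g}f=-\lambda|f|^{p-2}f$, $f\ne0$. The first nonzero eigenvalue is $$\lambda_{p,1}=\inf\Big\{\frac{\int_M|\nabla f|^p\,d\mu_g}{\int_M|f|^p\,d\mu_g}\ :\ 0\ne f\in W^{1,p}(M),\ \int_M|f|^{p-2}f\,d\mu_g=0\Big\}.$$ $\mathcal{H}=g^{ij}h_{ij}$ is the metric trace of $h$, $\mathcal{H}_{\min}$ is its minimum over $M$ at the given time (so $\mathcal{H}_{\min}(0)=\min_{x\in M}\mathcal{H}(x,0)$), $\Delta=\Delta_{g(t)}$ is the Laplace–Beltrami operator, $d\mu=d\mu_{g(t)}$, and norms and gradients are with respect to $g(t)$. For a symmetric $(0,2)$-tensor, $\omega_{ij}\ge0$ means $\omega_{ij}V^iV^j\ge0$ for all vectors $V$. *)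

theory Defs
  imports "HOL-Analysis.Analysis"
begin

section \<open>Smooth functions\<close>

text \<open>Derivatives are taken within the set, so that one-sided time derivatives are used at the
  ends of a closed time interval.  The sets occurring below are open sets and products
  \<open>{0..T} \<times> V\<close> with \<open>V\<close> open and \<open>0 < T\<close>; on these the derivative within the set is unique.\<close>

primrec Ck_on ::
  "nat \<Rightarrow> 'a::euclidean_space set \<Rightarrow> ('a \<Rightarrow> 'b::real_normed_vector) \<Rightarrow> bool" where
  "Ck_on 0 S f = continuous_on S f"
| "Ck_on (Suc k) S f =
     (f differentiable_on S \<and> (\<forall>v. Ck_on k S (\<lambda>x. frechet_derivative f (at x within S) v)))"

definition smooth_on :: "'a::euclidean_space set \<Rightarrow> ('a \<Rightarrow> 'b::real_normed_vector) \<Rightarrow> bool" where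
  "smooth_on S f \<longleftrightarrow> (\<forall>k. Ck_on k S f)"

definition partial_deriv :: "'n \<Rightarrow> (real ^ 'n \<Rightarrow> real) \<Rightarrow> real ^ 'n::finite \<Rightarrow> real" where
  "partial_deriv i F y = frechet_derivative F (at y) (axis i 1)"


section \<open>Closed manifolds\<close>

text \<open>A manifold is a Hausdorff second countable type \<open>'m\<close> with a smooth atlas of charts into
  \<open>real ^ 'n\<close>; its dimension is \<open>CARD('n)\<close>, and all charts having open images, it has no boundary.
  A chart is its open domain together with the coordinate map.  The order on \<open>'n\<close> is not used in
  any definition; the class \<open>wellorder\<close> is there because the library's change of variables
  theorems require it, and every finite cardinality \<open>\<ge> 1\<close> is attained by such a type.\<close>

type_synonym ('m, 'n) chart = "'m set \<times> ('m \<Rightarrow> real ^ 'n)"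

definition chart_inv :: "('m, 'n::finite) chart \<Rightarrow> real ^ 'n \<Rightarrow> 'm" where
  "chart_inv c = inv_into (fst c) (snd c)"

definition chart_image :: "('m, 'n::finite) chart \<Rightarrow> (real ^ 'n) set" where
  "chart_image c = snd c ` fst c"

definition is_chart :: "('m::topological_space, 'n::finite) chart \<Rightarrow> bool" where
  "is_chart c \<longleftrightarrow> open (fst c) \<and> open (chart_image c) \<and>
     homeomorphism (fst c) (chart_image c) (snd c) (chart_inv c)"

definition smooth_atlas :: "('m::topological_space, 'n::finite) chart set \<Rightarrow> bool" where
  "smooth_atlas A \<longleftrightarrow>
     (\<forall>c\<in>A. is_chart c) \<and> (\<Union>c\<in>A. fst c) = UNIV \<and>
     (\<forall>c\<in>A. \<forall>d\<in>A. smooth_on (snd c ` (fst c \<inter> fst d)) (snd d \<circ> chart_inv c))"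

definition closed_manifold ::
  "('m::{t2_space, second_countable_topology}, 'n::finite) chart set \<Rightarrow> bool" where
  "closed_manifold A \<longleftrightarrow> compact (UNIV :: 'm set) \<and> smooth_atlas A"

text \<open>Scalars built from tensors by contraction do not depend on the chart, so they are evaluated
  in an arbitrary chart around the point.\<close>

definition chart_at :: "('m, 'n::finite) chart set \<Rightarrow> 'm \<Rightarrow> ('m, 'n) chart" where
  "chart_at A x = (SOME c. c \<in> A \<and> x \<in> fst c)"

text \<open>Entry \<open>$ k $ i\<close> is the \<open>i\<close>-th partial derivative of the \<open>k\<close>-th coordinate of \<open>d\<close>
  with respect to the coordinates of \<open>c\<close>.\<close>

definition transition_jacobian ::
  "('m, 'n::finite) chart \<Rightarrow> ('m, 'n) chart \<Rightarrow> 'm \<Rightarrow> real ^ 'n ^ 'n" where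
  "transition_jacobian c d x = matrix (frechet_derivative (snd d \<circ> chart_inv c) (at (snd c x)))"


section \<open>Tensor fields and Riemannian metrics\<close>

text \<open>Tensor fields are given by their components: \<open>\<omega> c x $ i $ j\<close> is the component
  \<open>\<omega>\<^sub>i\<^sub>j\<close> at the point \<open>x\<close> in the chart \<open>c\<close>.  Components in different charts are related by the
  usual transformation law at every point of the overlap.\<close>

type_synonym ('m, 'n) tensor2 = "('m, 'n) chart \<Rightarrow> 'm \<Rightarrow> real ^ 'n ^ 'n"
type_synonym ('m, 'n) vec_field = "('m, 'n) chart \<Rightarrow> 'm \<Rightarrow> real ^ 'n"

definition covariant_tensor2 :: "('m, 'n::finite) chart set \<Rightarrow> ('m, 'n) tensor2 \<Rightarrow> bool" where
  "covariant_tensor2 A \<omega> \<longleftrightarrow>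
     (\<forall>c\<in>A. \<forall>d\<in>A. \<forall>x\<in>fst c \<inter> fst d.
        \<omega> c x = transpose (transition_jacobian c d x) ** \<omega> d x ** transition_jacobian c d x)"

definition covector_field :: "('m, 'n::finite) chart set \<Rightarrow> ('m, 'n) vec_field \<Rightarrow> bool" where
  "covector_field A \<xi> \<longleftrightarrow>
     (\<forall>c\<in>A. \<forall>d\<in>A. \<forall>x\<in>fst c \<inter> fst d.
        \<xi> c x = transpose (transition_jacobian c d x) *v \<xi> d x)"

definition symmetric_tensor2 :: "('m, 'n::finite) chart set \<Rightarrow> ('m, 'n) tensor2 \<Rightarrow> bool" where
  "symmetric_tensor2 A \<omega> \<longleftrightarrow>
     covariant_tensor2 A \<omega> \<and> (\<forall>c\<in>A. \<forall>x\<in>fst c. transpose (\<omega> c x) = \<omega> c x)"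

definition tensor2_nonneg :: "('m, 'n::finite) chart set \<Rightarrow> ('m, 'n) tensor2 \<Rightarrow> bool" where
  "tensor2_nonneg A \<omega> \<longleftrightarrow> (\<forall>c\<in>A. \<forall>x\<in>fst c. \<forall>V. 0 \<le> (\<Sum>i\<in>UNIV. \<Sum>j\<in>UNIV. \<omega> c x $ i $ j * V $ i * V $ j))"

definition riemannian_metric :: "('m, 'n::finite) chart set \<Rightarrow> ('m, 'n) tensor2 \<Rightarrow> bool" where
  "riemannian_metric A g \<longleftrightarrow>
     symmetric_tensor2 A g \<and>
     (\<forall>c\<in>A. \<forall>x\<in>fst c. \<forall>V. V \<noteq> 0 \<longrightarrow>
        0 < (\<Sum>i\<in>UNIV. \<Sum>j\<in>UNIV. g c x $ i $ j * V $ i * V $ j))"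

text \<open>Joint smoothness in time and space of a time-dependent tensor field on \<open>[0, T]\<close>.\<close>

definition smooth_tensor2_family ::
  "('m, 'n::finite) chart set \<Rightarrow> real \<Rightarrow> (real \<Rightarrow> ('m, 'n) tensor2) \<Rightarrow> bool" where
  "smooth_tensor2_family A T \<omega> \<longleftrightarrow>
     (\<forall>c\<in>A. smooth_on ({0..T} \<times> chart_image c) (\<lambda>(t, y). \<omega> t c (chart_inv c y)))"

definition metric_trace ::
  "('m, 'n::finite) chart set \<Rightarrow> ('m, 'n) tensor2 \<Rightarrow> ('m, 'n) tensor2 \<Rightarrow> 'm \<Rightarrow> real" where
  "metric_trace A g \<omega> x =
     (let c = chart_at A x
      in \<Sum>i\<in>UNIV. \<Sum>j\<in>UNIV. matrix_inv (g c x) $ i $ j * \<omega> c x $ i $ j)"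

definition metric_inner ::
  "('m, 'n::finite) chart set \<Rightarrow> ('m, 'n) tensor2 \<Rightarrow> ('m, 'n) vec_field \<Rightarrow> ('m, 'n) vec_field
     \<Rightarrow> 'm \<Rightarrow> real" where
  "metric_inner A g V W x =
     (let c = chart_at A x
      in \<Sum>i\<in>UNIV. \<Sum>j\<in>UNIV. g c x $ i $ j * V c x $ i * W c x $ j)"

definition metric_norm ::
  "('m, 'n::finite) chart set \<Rightarrow> ('m, 'n) tensor2 \<Rightarrow> ('m, 'n) vec_field \<Rightarrow> 'm \<Rightarrow> real" where
  "metric_norm A g V x = sqrt (metric_inner A g V V x)"

text \<open>The Riemannian measure is the Borel measure whose density in each chart is
  \<open>sqrt (det g\<^sub>i\<^sub>j)\<close>.\<close>

definition riemannian_measure ::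
  "('m::topological_space, 'n::finite) chart set \<Rightarrow> ('m, 'n) tensor2 \<Rightarrow> 'm measure" where
  "riemannian_measure A g =
     (THE \<mu>. sets \<mu> = sets borel \<and>
        (\<forall>c\<in>A. \<forall>B\<in>sets borel. B \<subseteq> fst c \<longrightarrow>
           emeasure \<mu> B =
             (\<integral>\<^sup>+y\<in>snd c ` B. ennreal (sqrt (det (g c (chart_inv c y)))) \<partial>lborel)))"

text \<open>Laplace--Beltrami operator on smooth functions:
  \<open>(det g)\<^sup>-\<^sup>1\<^sup>/\<^sup>2 \<partial>\<^sub>i ((det g)\<^sup>1\<^sup>/\<^sup>2 g\<^sup>i\<^sup>j \<partial>\<^sub>j f)\<close>.\<close>

definition laplace_beltrami ::
  "('m, 'n::finite) chart set \<Rightarrow> ('m, 'n) tensor2 \<Rightarrow> ('m \<Rightarrow> real) \<Rightarrow> 'm \<Rightarrow> real" where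
  "laplace_beltrami A g f x =
     (let c = chart_at A x;
          G = (\<lambda>y. g c (chart_inv c y));
          F = (\<lambda>y. f (chart_inv c y))
      in (\<Sum>i\<in>UNIV. partial_deriv i
            (\<lambda>y. sqrt (det (G y)) * (\<Sum>j\<in>UNIV. matrix_inv (G y) $ i $ j * partial_deriv j F y))
            (snd c x))
         / sqrt (det (G (snd c x))))"


section \<open>Sobolev functions\<close>

definition locally_integrable_on :: "(real ^ 'n::finite) set \<Rightarrow> (real ^ 'n \<Rightarrow> real) \<Rightarrow> bool" where
  "locally_integrable_on S F \<longleftrightarrow> (\<forall>K. compact K \<and> K \<subseteq> S \<longrightarrow> set_integrable lborel K F)"

definition test_function_on :: "(real ^ 'n::finite) set \<Rightarrow> (real ^ 'n \<Rightarrow> real) \<Rightarrow> bool" where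
  "test_function_on S \<eta> \<longleftrightarrow>
     smooth_on UNIV \<eta> \<and> compact (closure {y. \<eta> y \<noteq> 0}) \<and> closure {y. \<eta> y \<noteq> 0} \<subseteq> S"

text \<open>\<open>\<xi>\<close> is a weak differential of \<open>f\<close>: a covector field whose components are the weak partial
  derivatives of \<open>f\<close> in every chart.  The transformation law is required at every point (not just
  almost everywhere), so that \<open>\<xi>\<close> can be evaluated pointwise in an arbitrary chart.\<close>

definition weak_differential ::
  "('m, 'n::finite) chart set \<Rightarrow> ('m \<Rightarrow> real) \<Rightarrow> ('m, 'n) vec_field \<Rightarrow> bool" where
  "weak_differential A f \<xi> \<longleftrightarrow>
     covector_field A \<xi> \<and>
     (\<forall>c\<in>A.
        locally_integrable_on (chart_image c) (\<lambda>y. f (chart_inv c y)) \<and>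
        (\<forall>i. locally_integrable_on (chart_image c) (\<lambda>y. \<xi> c (chart_inv c y) $ i) \<and>
             (\<forall>\<eta>. test_function_on (chart_image c) \<eta> \<longrightarrow>
                (LINT y:chart_image c|lborel. f (chart_inv c y) * partial_deriv i \<eta> y) =
                - (LINT y:chart_image c|lborel. \<xi> c (chart_inv c y) $ i * \<eta> y))))"

text \<open>The weak differential, hence the gradient, is unique up to a null set.\<close>

definition gradient ::
  "('m, 'n::finite) chart set \<Rightarrow> ('m, 'n) tensor2 \<Rightarrow> ('m \<Rightarrow> real) \<Rightarrow> ('m, 'n) vec_field" where
  "gradient A g f c x = matrix_inv (g c x) *v (SOME \<xi>. weak_differential A f \<xi>) c x"

definition sobolev ::
  "('m::topological_space, 'n::finite) chart set \<Rightarrow> ('m, 'n) tensor2 \<Rightarrow> real \<Rightarrow> ('m \<Rightarrow> real) set" where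
  "sobolev A g p =
     {f. f \<in> borel_measurable borel \<and> (\<exists>\<xi>. weak_differential A f \<xi>) \<and>
         integrable (riemannian_measure A g) (\<lambda>x. \<bar>f x\<bar> powr p) \<and>
         integrable (riemannian_measure A g) (\<lambda>x. metric_norm A g (gradient A g f) x powr p)}"


section \<open>The \<open>p\<close>-Laplacian\<close>

text \<open>\<open>\<psi> = div (|\<nabla>f|\<^sup>p\<^sup>-\<^sup>2 \<nabla>f)\<close> in the weak sense.\<close>

definition has_p_laplacian ::
  "('m::topological_space, 'n::finite) chart set \<Rightarrow> ('m, 'n) tensor2 \<Rightarrow> real \<Rightarrow> ('m \<Rightarrow> real) \<Rightarrow>
     ('m \<Rightarrow> real) \<Rightarrow> bool" where
  "has_p_laplacian A g p f \<psi> \<longleftrightarrow>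
     (\<forall>\<phi>\<in>sobolev A g p.
        (LINT x|riemannian_measure A g.
           metric_norm A g (gradient A g f) x powr (p - 2) *
           metric_inner A g (gradient A g f) (gradient A g \<phi>) x) =
        - (LINT x|riemannian_measure A g. \<psi> x * \<phi> x))"

definition p_eigenfunction ::
  "('m::topological_space, 'n::finite) chart set \<Rightarrow> ('m, 'n) tensor2 \<Rightarrow> real \<Rightarrow> real \<Rightarrow>
     ('m \<Rightarrow> real) \<Rightarrow> bool" where
  "p_eigenfunction A g p l f \<longleftrightarrow>
     f \<in> sobolev A g p \<and> \<not> (AE x in riemannian_measure A g. f x = 0) \<and>
     has_p_laplacian A g p f (\<lambda>x. - l * \<bar>f x\<bar> powr (p - 2) * f x)"

definition first_p_eigenvalue ::
  "('m::topological_space, 'n::finite) chart set \<Rightarrow> ('m, 'n) tensor2 \<Rightarrow> real \<Rightarrow> real" where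
  "first_p_eigenvalue A g p =
     Inf {(LINT x|riemannian_measure A g. metric_norm A g (gradient A g f) x powr p) /
            (LINT x|riemannian_measure A g. \<bar>f x\<bar> powr p) | f.
          f \<in> sobolev A g p \<and> \<not> (AE x in riemannian_measure A g. f x = 0) \<and>
          (LINT x|riemannian_measure A g. \<bar>f x\<bar> powr (p - 2) * f x) = 0}"


section \<open>The flow\<close>

definition geometric_flow ::
  "('m, 'n::finite) chart set \<Rightarrow> real \<Rightarrow> (real \<Rightarrow> ('m, 'n) tensor2) \<Rightarrow>
     (real \<Rightarrow> ('m, 'n) tensor2) \<Rightarrow> bool" where
  "geometric_flow A T g h \<longleftrightarrow>
     smooth_tensor2_family A T g \<and> smooth_tensor2_family A T h \<and>
     (\<forall>t\<in>{0..T}. riemannian_metric A (g t) \<and> symmetric_tensor2 A (h t)) \<and>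
     (\<forall>c\<in>A. \<forall>x\<in>fst c. \<forall>i j. \<forall>t\<in>{0..T}.
        ((\<lambda>s. g s c x $ i $ j) has_real_derivative - 2 * h t c x $ i $ j) (at t within {0..T}))"

text \<open>On a closed manifold the infimum is a minimum, as the trace is continuous.\<close>

definition trace_min ::
  "('m, 'n::finite) chart set \<Rightarrow> ('m, 'n) tensor2 \<Rightarrow> ('m, 'n) tensor2 \<Rightarrow> real" where
  "trace_min A g \<omega> = (INF x. metric_trace A g \<omega> x)"

text \<open>The functional \<open>\<Theta>(g, u)\<close>, at a fixed time, with \<open>\<omega>\<close> in the role of \<open>h\<close>.\<close>

definition Theta ::
  "('m::topological_space, 'n::finite) chart set \<Rightarrow> real \<Rightarrow> real \<Rightarrow> ('m, 'n) tensor2 \<Rightarrow>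
     ('m, 'n) tensor2 \<Rightarrow> ('m \<Rightarrow> real) \<Rightarrow> real" where
  "Theta A p \<alpha> g \<omega> u =
     first_p_eigenvalue A g p *
       (LINT x|riemannian_measure A g. metric_trace A g \<omega> x * \<bar>u x\<bar> powr p) +
     (\<alpha> * p - 1) *
       (LINT x|riemannian_measure A g.
          metric_trace A g \<omega> x * metric_norm A g (gradient A g u) x powr p)"

end

theory Submission
  imports Defs
begin

text \<open>Along the flow, for a fixed weak differential and at a fixed point, the Riemannian density \<open>v\<close>
  satisfies \<open>v' = - H v\<close>, and the pinching condition gives \<open>(|\<nabla>f|\<^sup>2)' = 2 h(\<nabla>f, \<nabla>f) \<ge> 2 \<alpha> H |\<nabla>f|\<^sup>2\<close>.
  Hence \<open>|\<nabla>f|\<^sup>p v\<close> grows at least at the rate \<open>(\<alpha> p - 1) H\<close> while \<open>|f|\<^sup>p v\<close> decays at the rate \<open>H\<close>.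
  Since \<open>1 / p \<le> \<alpha> < 1 / n\<close> forces \<open>p > 2\<close>, the constraint of the Rayleigh quotient can be restored by
  subtracting the constant \<open>c\<close> that minimises \<open>\<integral>|f - c|\<^sup>p\<close>.

  Testing the quotient at an earlier time \<open>t\<close> with the eigenfunction of time \<open>t\<^sub>0\<close> bounds the backward
  difference quotient of \<open>\<lambda>\<close> from below by \<open>\<Theta>\<close>, uniformly in \<open>t\<^sub>0\<close>: the optimal constant \<open>c\<close> contributes only
  to higher order, by strong convexity of \<open>|x|\<^sup>p\<close>.  Averaging these quotients over time yields the
  integral inequality, as \<open>\<lambda>\<close> is nondecreasing.

  For the second part, the maximum principle applied to \<open>1 / H + 2 t / n\<close> gives \<open>H \<ge> \<psi>\<close> (and excludes the
  blow-up of \<open>\<psi>\<close> before \<open>T\<close>), so the Rayleigh quotient of every function grows at least at the rate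
  \<open>\<alpha> p \<psi>\<close>.\<close>

section \<open>Positive definite matrices\<close>

text \<open>The eigenvalue is an infimum over a class that changes with time: both the Sobolev space
  and the constraint depend on \<open>g t\<close>. Functions stay comparable because a weak
  differential does not mention the metric, so one covector field serves all times and only
  \<open>g t\<close>, its inverse and its determinant move. Integrability then passes from later to
  earlier times, as the gradient energy is monotone and the density has a bounded logarithmic
  derivative; hence later functions are tested at earlier times. Neither the eigenvalue nor
  \<open>u\<close> is known to be differentiable in time, so the eigenvalue equation is never
  differentiated. The delicate point is the constant c that recentres \<open>u\<close> at the
  earlier time t. The constraint at t0 annihilates the term linear in c there, so at t this term is
  only of size (t0 - t) |c|. Strong convexity yields a gain of order |c|^p that absorbs it unless
  |c| is small, and then the term is negligible against t0 - t. The range p > 2 enters through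
  Clarkson's inequality, which supplies the gain, and through the continuity of the constraint
  integrand.\<close>

lemma quadratic_form_eq_inner:
  "(\<Sum>i\<in>UNIV. \<Sum>j\<in>UNIV. P $ i $ j * V $ i * V $ j) = V \<bullet> (P *v V)"
  for P :: "real ^ 'n ^ 'n::finite"
  by (simp add: inner_vec_def matrix_vector_mult_def sum_distrib_left mult_ac)

text \<open>A nonzero entry \<open>P $ a $ j\<close> makes the form affine in s along e_j + s e_a,
  because the coefficient of s^2 is the vanishing diagonal entry; \<open>s\<close> is the value at
  which the form equals -1.\<close>

lemma psd_zero_diagonal:
  fixes P :: "real ^ 'n ^ 'n::finite"
  assumes sym: "\<And>i j. P $ i $ j = P $ j $ i" and psd: "\<And>v. 0 \<le> v \<bullet> (P *v v)"
    and "P $ a $ a = 0"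
  shows "P $ a $ j = 0"
proof (rule ccontr)
  assume nz: "P $ a $ j \<noteq> 0"
  then have "j \<noteq> a" using assms(3) by auto
  define s where "s = - (P $ j $ j + 1) / (2 * P $ a $ j)"
  define v :: "real ^ 'n" where "v = axis j 1 + s *\<^sub>R axis a 1"
  have e: "axis i 1 \<bullet> (P *v axis k 1) = P $ i $ k" for i k
    by (simp add: inner_axis' matrix_vector_mult_basis column_def)
  have "v \<bullet> (P *v v) = P $ j $ j + s * P $ j $ a + s * P $ a $ j + s * s * P $ a $ a"
    by (simp add: v_def matrix_vector_right_distrib inner_add_left inner_add_right e
        matrix_vector_mult_scaleR algebra_simps)
  also have "\<dots> = P $ j $ j + 2 * s * P $ a $ j" using assms(3) sym[of j a] by simp
  also have "\<dots> = - 1" using nz by (simp add: s_def field_simps)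
  finally show False using psd[of v] by simp
qed

text \<open>One Cholesky step per index of \<open>I\<close>, the set of rows still allowed to be
  nonzero: subtracting \<open>b\<close> times its transpose clears row \<open>a\<close> and keeps
  the form nonnegative. If the pivot vanishes, so does its whole row, and \<open>b\<close> is
  0.\<close>

lemma psd_gram_decomposition_aux:
  fixes P :: "real ^ 'n ^ 'n::finite"
  assumes "finite I" "\<And>i j. P $ i $ j = P $ j $ i" "\<And>v. 0 \<le> v \<bullet> (P *v v)"
    "\<And>i j. i \<notin> I \<Longrightarrow> P $ i $ j = 0"
  shows "\<exists>B :: 'n \<Rightarrow> real ^ 'n. \<forall>i j. P $ i $ j = (\<Sum>k\<in>I. B k $ i * B k $ j)"
  using assms
proof (induction I arbitrary: P rule: finite_induct)
  case empty
  then show ?case by simp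
next
  case (insert a I)
  define b where "b = (if P $ a $ a = 0 then 0 else (1 / sqrt (P $ a $ a)) *\<^sub>R (P $ a))"
  define Q :: "real ^ 'n ^ 'n" where "Q = (\<chi> i j. P $ i $ j - b $ i * b $ j)"
  have e: "axis i 1 \<bullet> (P *v axis k 1) = P $ i $ k" for i k
    by (simp add: inner_axis' matrix_vector_mult_basis column_def)
  have diag: "0 \<le> P $ a $ a" using insert.prems(2)[of "axis a 1"] e by simp
  have bb: "P $ a $ a \<noteq> 0 \<Longrightarrow> b $ i * b $ j = P $ a $ i * P $ a $ j / P $ a $ a" for i j
    using diag by (simp add: b_def)
  have Qv: "v \<bullet> (Q *v v) = v \<bullet> (P *v v) - (b \<bullet> v)\<^sup>2" for v
    unfolding quadratic_form_eq_inner[symmetric] Q_def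
    by (simp add: algebra_simps sum_subtractf inner_vec_def power2_eq_square sum_product)
  have Qpsd: "0 \<le> v \<bullet> (Q *v v)" for v
  proof (cases "P $ a $ a = 0")
    case True
    then show ?thesis using insert.prems(2)[of v] by (simp add: Qv) (simp add: b_def)
  next
    case False
    \<comment> \<open>\<open>s\<close> minimises the form along v - s e_a; the minimum, a Schur
      complement, is exactly the form of \<open>Q\<close> at \<open>v\<close>.\<close>
    define s where "s = ((P $ a) \<bullet> v) / P $ a $ a"
    define w where "w = v - s *\<^sub>R axis a 1"
    have Pa: "axis a 1 \<bullet> (P *v v) = P $ a \<bullet> v"
      by (simp add: inner_axis' matrix_vector_mul_component)
    have Pa': "v \<bullet> (P *v axis a 1) = P $ a \<bullet> v"
      using insert.prems(1)
      by (simp add: matrix_vector_mult_basis column_def inner_vec_def mult.commute)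
    have "w \<bullet> (P *v w) = v \<bullet> (P *v v) - 2 * s * (P $ a \<bullet> v) + s * s * P $ a $ a"
      by (simp add: w_def matrix_vector_mult_diff_distrib inner_diff_left inner_diff_right e Pa Pa'
          matrix_vector_mult_scaleR algebra_simps)
    also have "\<dots> = v \<bullet> (P *v v) - (P $ a \<bullet> v)\<^sup>2 / P $ a $ a"
      using False by (simp add: s_def field_simps power2_eq_square)
    also have "(P $ a \<bullet> v)\<^sup>2 / P $ a $ a = (b \<bullet> v)\<^sup>2"
      using False diag by (simp add: b_def power_mult_distrib power_divide)
    finally show ?thesis using insert.prems(2)[of w] by (simp add: Qv)
  qed
  have Qsupp: "Q $ i $ j = 0" if "i \<notin> I" for i j
  proof (cases "i = a")
    case True
    show ?thesis
    proof (cases "P $ a $ a = 0")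
      case True
      with psd_zero_diagonal[OF insert.prems(1,2) True] \<open>i = a\<close> show ?thesis by (simp add: Q_def b_def)
    next
      case False
      with \<open>i = a\<close> show ?thesis by (simp add: Q_def bb)
    qed
  next
    case False
    then have z: "\<And>k. P $ i $ k = 0" using insert.prems(3) that by simp
    then have "b $ i = 0" using insert.prems(1)[of a i] by (simp add: b_def)
    with z show ?thesis by (simp add: Q_def)
  qed
  have "\<And>i j. Q $ i $ j = Q $ j $ i" using insert.prems(1) by (simp add: Q_def mult.commute)
  from insert.IH[OF this Qpsd Qsupp] obtain B :: "'n \<Rightarrow> real ^ 'n"
    where B: "\<And>i j. Q $ i $ j = (\<Sum>k\<in>I. B k $ i * B k $ j)" by blast
  have "P $ i $ j = (\<Sum>k\<in>insert a I. (B(a := b)) k $ i * (B(a := b)) k $ j)" for i j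
  proof -
    have "(\<Sum>k\<in>I. (B(a := b)) k $ i * (B(a := b)) k $ j) = (\<Sum>k\<in>I. B k $ i * B k $ j)"
      using insert.hyps by (intro sum.cong) auto
    with B[of i j] insert.hyps show ?thesis by (simp add: Q_def)
  qed
  then show ?case by blast
qed

lemma psd_gram_decomposition:
  fixes P :: "real ^ 'n ^ 'n::finite"
  assumes "transpose P = P" "\<And>v. 0 \<le> v \<bullet> (P *v v)"
  obtains B :: "'n \<Rightarrow> real ^ 'n" where "\<And>i j. P $ i $ j = (\<Sum>k\<in>UNIV. B k $ i * B k $ j)"
proof -
  have "P $ i $ j = P $ j $ i" for i j
    using arg_cong[OF assms(1), of "\<lambda>Q. Q $ i $ j"] by (simp add: transpose_def)
  with psd_gram_decomposition_aux[of UNIV P] assms(2) that show ?thesis by auto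
qed

text \<open>A Gram decomposition of \<open>P\<close> turns the contraction into a sum of values of
  the form of \<open>Q\<close>. Since \<open>Q\<close> enters only through its form, a matrix of
  second derivatives can be inserted later without an appeal to Schwarz's theorem.\<close>

lemma psd_contraction_nonneg:
  fixes P Q :: "real ^ 'n ^ 'n::finite"
  assumes "transpose P = P" "\<And>v. 0 \<le> v \<bullet> (P *v v)" "\<And>v. 0 \<le> v \<bullet> (Q *v v)"
  shows "0 \<le> (\<Sum>i\<in>UNIV. \<Sum>j\<in>UNIV. P $ i $ j * Q $ i $ j)"
proof -
  obtain B :: "'n \<Rightarrow> real ^ 'n" where B: "\<And>i j. P $ i $ j = (\<Sum>k\<in>UNIV. B k $ i * B k $ j)"
    using psd_gram_decomposition[OF assms(1,2)] by blast
  have "(\<Sum>i\<in>UNIV. \<Sum>j\<in>UNIV. P $ i $ j * Q $ i $ j)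
    = (\<Sum>i\<in>UNIV. \<Sum>j\<in>UNIV. \<Sum>k\<in>UNIV. Q $ i $ j * B k $ i * B k $ j)"
    by (simp add: B sum_distrib_left mult_ac)
  also have "\<dots> = (\<Sum>i\<in>UNIV. \<Sum>k\<in>UNIV. \<Sum>j\<in>UNIV. Q $ i $ j * B k $ i * B k $ j)"
    by (intro sum.cong refl sum.swap)
  also have "\<dots> = (\<Sum>k\<in>UNIV. \<Sum>i\<in>UNIV. \<Sum>j\<in>UNIV. Q $ i $ j * B k $ i * B k $ j)"
    by (rule sum.swap)
  also have "\<dots> = (\<Sum>k\<in>UNIV. B k \<bullet> (Q *v B k))" by (simp add: quadratic_form_eq_inner)
  finally show ?thesis using assms(3) by (simp add: sum_nonneg)
qed

definition posdef :: "real ^ 'n ^ 'n::finite \<Rightarrow> bool" where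
  "posdef P \<longleftrightarrow> transpose P = P \<and> (\<forall>v. v \<noteq> 0 \<longrightarrow> 0 < v \<bullet> (P *v v))"

lemma posdef_nonneg: "posdef P \<Longrightarrow> 0 \<le> v \<bullet> (P *v v)"
  unfolding posdef_def by (cases "v = 0") (auto intro: less_imp_le)

lemma posdef_invertible:
  assumes "posdef P" shows "invertible P"
proof -
  have "\<forall>x. P *v x = 0 \<longrightarrow> x = 0"
    using assms unfolding posdef_def by fastforce
  then show ?thesis
    using matrix_left_invertible_ker invertible_left_inverse by blast
qed

section \<open>Determinant and inverse as functions of the matrix\<close>

lemma continuous_on_det:
  fixes M :: "'a::topological_space \<Rightarrow> real ^ 'n ^ 'n::finite"
  assumes "continuous_on S M" shows "continuous_on S (\<lambda>x. det (M x))"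
  unfolding det_def by (intro continuous_intros assms)

text \<open>The segment from the identity to \<open>P\<close> consists of positive definite, hence
  invertible, matrices, so the determinant starts at 1 and cannot cross 0.\<close>

lemma posdef_det_pos:
  fixes P :: "real ^ 'n ^ 'n::finite"
  assumes "posdef P" shows "0 < det P"
proof (rule ccontr)
  assume "\<not> 0 < det P"
  define M where "M = (\<lambda>s::real. (1 - s) *\<^sub>R mat 1 + s *\<^sub>R P)"
  have pd: "posdef (M s)" if "0 \<le> s" "s \<le> 1" for s
    unfolding posdef_def
  proof (intro conjI allI impI)
    have tP: "transpose P = P" using assms by (simp add: posdef_def)
    then show "transpose (M s) = M s"
      by (simp add: M_def transpose_def vec_eq_iff mat_def)
    fix v :: "real ^ 'n" assume v: "v \<noteq> 0"
    have "v \<bullet> (M s *v v) = (1 - s) * (v \<bullet> v) + s * (v \<bullet> (P *v v))"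
      by (simp add: M_def matrix_vector_mult_add_rdistrib scaleR_matrix_vector_assoc[symmetric]
          inner_add_right)
    moreover have "0 < v \<bullet> v" "0 < v \<bullet> (P *v v)" using v assms by (auto simp: posdef_def)
    ultimately show "0 < v \<bullet> (M s *v v)" using that
      by (cases "s = 0") (auto intro!: add_nonneg_pos)
  qed
  have "continuous_on {0..1} (\<lambda>s. det (M s))"
    unfolding M_def by (intro continuous_on_det continuous_intros)
  moreover have "det (M 1) \<le> 0" "0 \<le> det (M 0)"
    using \<open>\<not> 0 < det P\<close> by (simp_all add: M_def)
  ultimately obtain s where "0 \<le> s" "s \<le> 1" "det (M s) = 0"
    using IVT2'[of "\<lambda>s. det (M s)" 1 0 0] by auto
  with pd posdef_invertible show False by (auto simp: invertible_det_nz)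
qed

lemma matrix_inv_works:
  fixes P :: "real ^ 'n ^ 'n::finite"
  assumes "invertible P"
  shows "P ** matrix_inv P = mat 1" "matrix_inv P ** P = mat 1"
  using assms by (auto simp: matrix_inv_def invertible_def intro: someI2_ex)

lemma matrix_inv_unique:
  fixes P Q :: "real ^ 'n ^ 'n::finite"
  assumes "P ** Q = mat 1" shows "matrix_inv P = Q"
proof -
  have "invertible P" using assms invertible_right_inverse by blast
  then have "matrix_inv P = matrix_inv P ** (P ** Q)" by (simp add: assms)
  also have "\<dots> = Q" using matrix_inv_works[OF \<open>invertible P\<close>] by (simp add: matrix_mul_assoc)
  finally show ?thesis .
qed

lemma posdef_matrix_inv:
  assumes "posdef P" shows "posdef (matrix_inv P)"
proof -
  have inv: "invertible P" using posdef_invertible[OF assms] .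
  have tP: "transpose P = P" using assms by (simp add: posdef_def)
  have "P ** transpose (matrix_inv P) = transpose (matrix_inv P ** P)"
    by (simp add: matrix_transpose_mul tP)
  then have sym: "transpose (matrix_inv P) = matrix_inv P"
    using matrix_inv_unique matrix_inv_works(2)[OF inv] by (metis transpose_mat)
  show ?thesis unfolding posdef_def
  proof (intro conjI allI impI sym)
    fix v :: "real ^ 'a" assume "v \<noteq> 0"
    define w where "w = matrix_inv P *v v"
    have v: "P *v w = v" unfolding w_def
      by (simp add: matrix_vector_mul_assoc matrix_inv_works[OF inv])
    then have "w \<noteq> 0" using \<open>v \<noteq> 0\<close> by auto
    then have "0 < w \<bullet> (P *v w)" using assms by (simp add: posdef_def)
    then show "0 < v \<bullet> (matrix_inv P *v v)"
      unfolding w_def[symmetric] v by (simp add: inner_commute)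
  qed
qed

text \<open>Cramer's rule for column \<open>j\<close> of the inverse. It exhibits the entries as
  quotients of polynomials in the entries of \<open>P\<close>, from which continuity and smoothness
  of the inverse follow.\<close>

lemma matrix_inv_component:
  fixes P :: "real ^ 'n ^ 'n::finite"
  assumes "invertible P"
  shows "matrix_inv P $ i $ j
    = det (\<chi> k l. if l = i then axis j 1 $ k else P $ k $ l) / det P"
proof -
  have "P *v (matrix_inv P *v axis j 1) = axis j 1"
    by (simp add: matrix_vector_mul_assoc matrix_inv_works[OF assms])
  moreover have "det P \<noteq> 0" using assms by (simp add: invertible_det_nz)
  ultimately have "matrix_inv P *v axis j 1
    = (\<chi> i. det (\<chi> k l. if l = i then axis j 1 $ k else P $ k $ l) / det P)"
    using cramer by blast
  then have "(matrix_inv P *v axis j 1) $ i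
    = det (\<chi> k l. if l = i then axis j 1 $ k else P $ k $ l) / det P" by simp
  then show ?thesis by (simp add: matrix_vector_mult_basis column_def)
qed

lemma continuous_on_matrix_inv:
  fixes M :: "'a::topological_space \<Rightarrow> real ^ 'n ^ 'n::finite"
  assumes "continuous_on S M" "\<And>x. x \<in> S \<Longrightarrow> invertible (M x)"
  shows "continuous_on S (\<lambda>x. matrix_inv (M x))"
proof -
  have "continuous_on S (\<lambda>x. \<chi> i j.
      det (\<chi> k l. if l = i then axis j 1 $ k else M x $ k $ l) / det (M x))"
  proof (intro continuous_intros continuous_on_det)
    fix i j k l
    show "continuous_on S (\<lambda>x. if l = i then (axis j 1 :: real ^ 'n) $ k else M x $ k $ l)"
      by (cases "l = i") (auto intro!: continuous_intros assms)
  qed (use assms invertible_det_nz in auto)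
  then show ?thesis
    by (rule continuous_on_eq) (simp add: vec_eq_iff matrix_inv_component assms(2))
qed

text \<open>In the Leibniz expansion at the identity, a permutation other than \<open>id\<close>
  moves at least two points, so each of its terms keeps a zero factor even after one factor has been
  differentiated.\<close>

lemma has_real_derivative_det_mat1:
  fixes N :: "real \<Rightarrow> real ^ 'n ^ 'n::finite"
  assumes "\<And>i j. ((\<lambda>s. N s $ i $ j) has_real_derivative N' $ i $ j) (at t within S)"
    and "N t = mat 1"
  shows "((\<lambda>s. det (N s)) has_real_derivative (\<Sum>i\<in>UNIV. N' $ i $ i)) (at t within S)"
proof -
  let ?U = "UNIV :: 'n set"
  let ?D = "\<lambda>q. of_int (sign q) * (\<Sum>i\<in>?U. N' $ i $ q i * (\<Prod>j\<in>?U - {i}. N t $ j $ q j))"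
  have "((\<lambda>s. \<Sum>q\<in>{q. q permutes ?U}. of_int (sign q) * (\<Prod>i\<in>?U. N s $ i $ q i))
      has_real_derivative (\<Sum>q\<in>{q. q permutes ?U}. ?D q)) (at t within S)"
  proof (intro DERIV_sum DERIV_cmult)
    fix q
    show "((\<lambda>s. \<Prod>i\<in>?U. N s $ i $ q i) has_real_derivative
        (\<Sum>i\<in>?U. N' $ i $ q i * (\<Prod>j\<in>?U - {i}. N t $ j $ q j))) (at t within S)"
    proof -
      have "((\<lambda>s. N s $ i $ q i) has_derivative (\<lambda>y. N' $ i $ q i * y)) (at t within S)" for i
        using assms(1) by (simp add: has_field_derivative_def)
      from has_derivative_prod[of ?U "\<lambda>i s. N s $ i $ q i" "\<lambda>i y. N' $ i $ q i * y" t S, OF this]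
      show ?thesis unfolding has_field_derivative_def
        by (rule has_derivative_eq_rhs) (simp add: fun_eq_iff sum_distrib_left mult_ac)
    qed
  qed
  moreover have "?D q = 0" if q: "q permutes ?U" "q \<noteq> id" for q
  proof -
    have "(\<Prod>j\<in>?U - {i}. N t $ j $ q j) = 0" for i
    proof -
      obtain a where a: "q a \<noteq> a" using q(2) by (auto simp: fun_eq_iff)
      have "q (q a) \<noteq> q a" using a inj_eq[OF permutes_inj[OF q(1)]] by simp
      \<comment> \<open>If the differentiated factor sits in row \<open>a\<close>, the second moved
        point \<open>q a\<close> still supplies the zero.\<close>
      define b where "b = (if i = a then q a else a)"
      have "b \<noteq> i" "q b \<noteq> b" using a \<open>q (q a) \<noteq> q a\<close> by (auto simp: b_def)
      then show ?thesis using assms(2) by (intro prod_zero bexI[of _ b]) (auto simp: mat_def)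
    qed
    then show ?thesis by (simp only: mult_zero_right sum.neutral_const)
  qed
  then have "(\<Sum>q\<in>{q. q permutes ?U}. ?D q) = (\<Sum>q\<in>{id}. ?D q)"
    by (intro sum.mono_neutral_right) (auto simp: permutes_id finite_permutations)
  moreover have "?D id = (\<Sum>i\<in>?U. N' $ i $ i)"
    by (simp add: assms(2) mat_def)
  ultimately show ?thesis by (simp add: det_def)
qed

text \<open>Jacobi's formula. Multiplication by the constant inverse of \<open>N t\<close> moves the
  base point to the identity.\<close>

lemma has_real_derivative_det:
  fixes N :: "real \<Rightarrow> real ^ 'n ^ 'n::finite"
  assumes "\<And>i j. ((\<lambda>s. N s $ i $ j) has_real_derivative N' $ i $ j) (at t within S)"
    and inv: "invertible (N t)"
  shows "((\<lambda>s. det (N s)) has_real_derivative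
    det (N t) * (\<Sum>i\<in>UNIV. \<Sum>j\<in>UNIV. matrix_inv (N t) $ i $ j * N' $ j $ i)) (at t within S)"
proof -
  let ?P = "matrix_inv (N t)"
  have "((\<lambda>s. det (?P ** N s)) has_real_derivative (\<Sum>i\<in>UNIV. (?P ** N') $ i $ i)) (at t within S)"
  proof (rule has_real_derivative_det_mat1)
    fix i j
    show "((\<lambda>s. (?P ** N s) $ i $ j) has_real_derivative (?P ** N') $ i $ j) (at t within S)"
      unfolding matrix_matrix_mult_def by simp (intro DERIV_sum DERIV_cmult assms)
  qed (rule matrix_inv_works[OF inv])
  then have "((\<lambda>s. det (N t) * det (?P ** N s)) has_real_derivative
      det (N t) * (\<Sum>i\<in>UNIV. (?P ** N') $ i $ i)) (at t within S)" by (rule DERIV_cmult)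
  moreover have "det (N t) * det (?P ** N s) = det (N s)" for s
  proof -
    have "det (N t) * det ?P = 1" by (simp add: det_mul[symmetric] matrix_inv_works[OF inv])
    then show ?thesis by (simp add: det_mul mult.assoc[symmetric])
  qed
  ultimately show ?thesis by (simp add: matrix_matrix_mult_def)
qed

lemma matrix_diff_left: "(A - B) ** C = A ** C - B ** C"
  and matrix_diff_right: "C ** (A - B) = C ** A - C ** B"
  for A B C :: "real ^ 'n ^ 'n::finite"
  by (simp_all add: matrix_matrix_mult_def vec_eq_iff algebra_simps sum_subtractf)

text \<open>The resolvent identity, inverse of A minus inverse of B = - A^(-1) (A - B) B^(-1),
  rewrites the difference quotient exactly; the limit then needs only continuity of the
  inverse.\<close>

lemma has_real_derivative_matrix_inv:
  fixes N :: "real \<Rightarrow> real ^ 'n ^ 'n::finite"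
  assumes der: "\<And>i j. ((\<lambda>s. N s $ i $ j) has_real_derivative N' $ i $ j) (at t within S)"
    and inv: "\<And>s. s \<in> S \<Longrightarrow> invertible (N s)" and t: "t \<in> S" and cont: "continuous_on S N"
  shows "((\<lambda>s. matrix_inv (N s) $ i $ j) has_real_derivative
    - (matrix_inv (N t) ** N' ** matrix_inv (N t)) $ i $ j) (at t within S)"
proof -
  have "continuous_on S (\<lambda>s. matrix_inv (N s))" by (rule continuous_on_matrix_inv[OF cont inv])
  then have lim: "((\<lambda>s. matrix_inv (N s)) \<longlongrightarrow> matrix_inv (N t)) (at t within S)"
    using t by (simp add: continuous_on_def)
  have "((\<lambda>s. - (\<Sum>k\<in>UNIV. (\<Sum>l\<in>UNIV. matrix_inv (N s) $ i $ l *
        ((N s $ l $ k - N t $ l $ k) / (s - t))) * matrix_inv (N t) $ k $ j))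
      \<longlongrightarrow> - (\<Sum>k\<in>UNIV. (\<Sum>l\<in>UNIV. matrix_inv (N t) $ i $ l * N' $ l $ k) *
        matrix_inv (N t) $ k $ j)) (at t within S)"
    using der by (intro tendsto_intros lim) (simp add: has_field_derivative_iff)
  moreover have "(matrix_inv (N s) $ i $ j - matrix_inv (N t) $ i $ j) / (s - t)
    = - (\<Sum>k\<in>UNIV. (\<Sum>l\<in>UNIV. matrix_inv (N s) $ i $ l *
        ((N s $ l $ k - N t $ l $ k) / (s - t))) * matrix_inv (N t) $ k $ j)" if "s \<in> S" for s
  proof -
    have "matrix_inv (N s) ** (N s - N t) ** matrix_inv (N t) = matrix_inv (N t) - matrix_inv (N s)"
      using matrix_inv_works[OF inv[OF that]] matrix_inv_works[OF inv[OF t]]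
      by (simp add: matrix_diff_left matrix_diff_right matrix_mul_assoc[symmetric])
    then have "matrix_inv (N s) $ i $ j - matrix_inv (N t) $ i $ j
      = - (matrix_inv (N s) ** (N s - N t) ** matrix_inv (N t)) $ i $ j" by simp
    then show ?thesis
      by (simp add: matrix_matrix_mult_def sum_divide_distrib sum_distrib_right)
  qed
  ultimately show ?thesis
    unfolding has_field_derivative_iff matrix_matrix_mult_def
    by (simp cong: Lim_cong_within)
qed

section \<open>Calculus of smooth functions\<close>

lemma Ck_on_continuous: "Ck_on k S f \<Longrightarrow> continuous_on S f"
  by (cases k) (auto intro: differentiable_imp_continuous_on)

lemma Ck_on_SucD: "Ck_on (Suc k) S f \<Longrightarrow> Ck_on k S f"
proof (induction k arbitrary: f)
  case 0
  then show ?case by (auto intro: differentiable_imp_continuous_on)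
next
  case (Suc k)
  note D = iffD1[OF Ck_on.simps(2) Suc.prems]
  show ?case
    by (rule iffD2[OF Ck_on.simps(2)], intro conjI allI, rule conjunct1[OF D])
       (rule Suc.IH, rule spec[OF conjunct2[OF D]])
qed

lemma frechet_derivative_within_open:
  "open S \<Longrightarrow> x \<in> S \<Longrightarrow> frechet_derivative f (at x within S) = frechet_derivative f (at x)"
  by (simp add: frechet_derivative_def at_within_open[of x S])

text \<open>\<open>frechet_derivative\<close> is a choice. Functions agreeing on \<open>S\<close>
  have the same derivatives within \<open>S\<close> as a predicate, so the chosen derivatives
  coincide and the induction goes through.\<close>

lemma Ck_on_cong:
  assumes "open S" "\<And>x. x \<in> S \<Longrightarrow> f x = g x"
  shows "Ck_on k S f \<longleftrightarrow> Ck_on k S g"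
  using assms(2)
proof (induction k arbitrary: f g)
  case 0
  then show ?case by (simp cong: continuous_on_cong)
next
  case (Suc k)
  have eq: "(f has_derivative D) (at x within S) \<longleftrightarrow> (g has_derivative D) (at x within S)"
    if "x \<in> S" for x D
    using has_derivative_transform[OF that, of g f D] has_derivative_transform[OF that, of f g D]
      Suc.prems by auto
  then have "f differentiable_on S \<longleftrightarrow> g differentiable_on S"
    by (simp add: differentiable_on_def differentiable_def)
  moreover have "frechet_derivative f (at x within S) = frechet_derivative g (at x within S)"
    if "x \<in> S" for x
    using eq[OF that] by (simp add: frechet_derivative_def)
  then have "Ck_on k S (\<lambda>x. frechet_derivative f (at x within S) v) \<longleftrightarrow>
      Ck_on k S (\<lambda>x. frechet_derivative g (at x within S) v)" for v
    by (intro Suc.IH) simp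
  ultimately show ?case by simp
qed

text \<open>Replaces the chosen \<open>frechet_derivative\<close> by any derivative family
  \<open>D\<close>. Together with the matching elimination rule it reduces each closure property
  below to an ordinary differentiation rule and an induction on the order.\<close>

lemma Ck_on_SucI:
  assumes "open S" "\<And>x. x \<in> S \<Longrightarrow> (f has_derivative D x) (at x)"
    "\<And>v. Ck_on k S (\<lambda>x. D x v)"
  shows "Ck_on (Suc k) S f"
proof -
  have "f differentiable_on S"
    unfolding differentiable_on_def differentiable_def
    using assms(2) has_derivative_at_withinI by blast
  moreover have "Ck_on k S (\<lambda>x. frechet_derivative f (at x within S) v)" for v
  proof -
    have "frechet_derivative f (at x within S) v = D x v" if "x \<in> S" for x
      using frechet_derivative_at[OF assms(2)[OF that]]
        frechet_derivative_within_open[OF assms(1) that, of f] by simp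
    then have "Ck_on k S (\<lambda>x. frechet_derivative f (at x within S) v) = Ck_on k S (\<lambda>x. D x v)"
      by (intro Ck_on_cong[OF assms(1)])
    then show ?thesis using assms(3) by blast
  qed
  ultimately show ?thesis by simp
qed

lemma Ck_on_SucE:
  assumes "Ck_on (Suc k) S f" "open S"
  obtains D where "\<And>x. x \<in> S \<Longrightarrow> (f has_derivative D x) (at x)" "\<And>v. Ck_on k S (\<lambda>x. D x v)"
proof
  show "(f has_derivative frechet_derivative f (at x within S)) (at x)" if "x \<in> S" for x
    using assms that frechet_derivative_works[of f "at x within S"] at_within_open[of x S]
    by (auto simp: differentiable_on_def)
  show "Ck_on k S (\<lambda>x. frechet_derivative f (at x within S) v)" for v
    using assms by simp
qed

lemma Ck_on_const: "open S \<Longrightarrow> Ck_on k S (\<lambda>x. c)"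
proof (induction k arbitrary: c)
  case (Suc k)
  show ?case by (rule Ck_on_SucI[OF Suc.prems has_derivative_const Suc.IH[OF Suc.prems]])
qed simp

lemma Ck_on_add:
  assumes "open S" "Ck_on k S f" "Ck_on k S g" shows "Ck_on k S (\<lambda>x. f x + g x)"
  using assms(2,3)
proof (induction k arbitrary: f g)
  case 0
  then show ?case by (simp add: continuous_on_add)
next
  case (Suc k)
  obtain D where D: "\<And>x. x \<in> S \<Longrightarrow> (f has_derivative D x) (at x)" "\<And>v. Ck_on k S (\<lambda>x. D x v)"
    using Ck_on_SucE[OF Suc.prems(1) assms(1)] by blast
  obtain E where E: "\<And>x. x \<in> S \<Longrightarrow> (g has_derivative E x) (at x)" "\<And>v. Ck_on k S (\<lambda>x. E x v)"
    using Ck_on_SucE[OF Suc.prems(2) assms(1)] by blast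
  show ?case
    by (rule Ck_on_SucI[OF assms(1) has_derivative_add[OF D(1) E(1)] Suc.IH[OF D(2) E(2)]])
qed

lemma Ck_on_sum:
  assumes "open S" "\<And>i. i \<in> I \<Longrightarrow> Ck_on k S (f i)" shows "Ck_on k S (\<lambda>x. \<Sum>i\<in>I. f i x)"
  using assms(2) by (induction I rule: infinite_finite_induct) (auto intro: assms Ck_on_const Ck_on_add)

lemma Ck_on_bounded_linear:
  assumes "open S" "bounded_linear L" "Ck_on k S f" shows "Ck_on k S (\<lambda>x. L (f x))"
  using assms(3)
proof (induction k arbitrary: f)
  case 0
  then show ?case using assms(2) by (simp add: bounded_linear.continuous_on)
next
  case (Suc k)
  obtain D where D: "\<And>x. x \<in> S \<Longrightarrow> (f has_derivative D x) (at x)" "\<And>v. Ck_on k S (\<lambda>x. D x v)"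
    using Ck_on_SucE[OF Suc.prems(1) assms(1)] by blast
  show ?case
    by (rule Ck_on_SucI[OF assms(1) bounded_linear.has_derivative[OF assms(2) D(1)] Suc.IH[OF D(2)]])
qed

lemma Ck_on_mult:
  fixes f g :: "'a::euclidean_space \<Rightarrow> real"
  assumes "open S" "Ck_on k S f" "Ck_on k S g" shows "Ck_on k S (\<lambda>x. f x * g x)"
  using assms(2,3)
proof (induction k arbitrary: f g)
  case 0
  then show ?case by (simp add: continuous_on_mult)
next
  case (Suc k)
  obtain D where D: "\<And>x. x \<in> S \<Longrightarrow> (f has_derivative D x) (at x)" "\<And>v. Ck_on k S (\<lambda>x. D x v)"
    using Ck_on_SucE[OF Suc.prems(1) assms(1)] by blast
  obtain E where E: "\<And>x. x \<in> S \<Longrightarrow> (g has_derivative E x) (at x)" "\<And>v. Ck_on k S (\<lambda>x. E x v)"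
    using Ck_on_SucE[OF Suc.prems(2) assms(1)] by blast
  show ?case
    by (rule Ck_on_SucI[OF assms(1) has_derivative_mult[OF D(1) E(1)]])
       (intro Ck_on_add assms Suc.IH D(2) E(2) Suc.prems Ck_on_SucD | assumption)+
qed

lemma Ck_on_prod:
  fixes f :: "'i \<Rightarrow> 'a::euclidean_space \<Rightarrow> real"
  assumes "open S" "\<And>i. i \<in> I \<Longrightarrow> Ck_on k S (f i)" shows "Ck_on k S (\<lambda>x. \<Prod>i\<in>I. f i x)"
  using assms(2) by (induction I rule: infinite_finite_induct) (auto intro: assms Ck_on_const Ck_on_mult)

lemma Ck_on_inverse:
  fixes f :: "'a::euclidean_space \<Rightarrow> real"
  assumes "open S" "Ck_on k S f" "\<And>x. x \<in> S \<Longrightarrow> f x \<noteq> 0" shows "Ck_on k S (\<lambda>x. inverse (f x))"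
  using assms(2)
proof (induction k)
  case 0
  then show ?case using assms(3) by (simp add: continuous_on_inverse)
next
  case (Suc k)
  obtain D where D: "\<And>x. x \<in> S \<Longrightarrow> (f has_derivative D x) (at x)" "\<And>v. Ck_on k S (\<lambda>x. D x v)"
    using Ck_on_SucE[OF Suc.prems(1) assms(1)] by blast
  have IH: "Ck_on k S (\<lambda>x. inverse (f x))" using Suc.IH Ck_on_SucD[OF Suc.prems] by blast
  have "((\<lambda>x. inverse (f x)) has_derivative (\<lambda>v. (-1) * (inverse (f x) * D x v * inverse (f x)))) (at x)"
    if "x \<in> S" for x
    using Deriv.has_derivative_inverse[OF assms(3)[OF that] D(1)[OF that]] by simp
  then show ?case
    by (rule Ck_on_SucI[OF assms(1)]) (assumption, intro Ck_on_mult assms(1) D(2) IH Ck_on_const)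
qed

lemma Ck_on_sqrt:
  fixes f :: "'a::euclidean_space \<Rightarrow> real"
  assumes "open S" "Ck_on k S f" "\<And>x. x \<in> S \<Longrightarrow> 0 < f x" shows "Ck_on k S (\<lambda>x. sqrt (f x))"
  using assms(2)
proof (induction k)
  case 0
  then show ?case by (simp add: continuous_on_real_sqrt)
next
  case (Suc k)
  obtain D where D: "\<And>x. x \<in> S \<Longrightarrow> (f has_derivative D x) (at x)" "\<And>v. Ck_on k S (\<lambda>x. D x v)"
    using Ck_on_SucE[OF Suc.prems(1) assms(1)] by blast
  have IH: "Ck_on k S (\<lambda>x. sqrt (f x))" using Suc.IH Ck_on_SucD[OF Suc.prems] by blast
  have IH': "Ck_on k S (\<lambda>x. inverse (sqrt (f x)))"
    using assms(3) by (intro Ck_on_inverse assms(1) IH) fastforce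
  have "((\<lambda>x. sqrt (f x)) has_derivative (\<lambda>v. D x v * (1/2 * inverse (sqrt (f x))))) (at x)"
    if "x \<in> S" for x
    using has_derivative_real_sqrt[OF assms(3)[OF that] D(1)[OF that]] by (simp add: mult_ac)
  then show ?case
    by (rule Ck_on_SucI[OF assms(1)]) (assumption, intro Ck_on_mult assms(1) D(2) IH' Ck_on_const)
qed

lemma Ck_on_det:
  fixes M :: "'a::euclidean_space \<Rightarrow> real ^ 'n ^ 'n::finite"
  assumes "open S" "\<And>i j. Ck_on k S (\<lambda>x. M x $ i $ j)" shows "Ck_on k S (\<lambda>x. det (M x))"
  unfolding det_def by (intro Ck_on_sum Ck_on_mult Ck_on_prod Ck_on_const assms)

lemma Ck_on_matrix_inv:
  fixes M :: "'a::euclidean_space \<Rightarrow> real ^ 'n ^ 'n::finite"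
  assumes "open S" "\<And>i j. Ck_on k S (\<lambda>x. M x $ i $ j)" "\<And>x. x \<in> S \<Longrightarrow> invertible (M x)"
  shows "Ck_on k S (\<lambda>x. matrix_inv (M x) $ i $ j)"
proof -
  have "Ck_on k S (\<lambda>x. (\<chi> k l. if l = i then axis j 1 $ k else M x $ k $ l) $ a $ b)" for a b
    using assms(1,2) by (cases "b = i") (auto intro: Ck_on_const)
  then have "Ck_on k S (\<lambda>x. det (\<chi> k l. if l = i then axis j 1 $ k else M x $ k $ l)
      * inverse (det (M x)))"
    using assms by (intro Ck_on_mult Ck_on_det Ck_on_inverse) (auto simp: invertible_det_nz)
  then show ?thesis
    by (rule iffD1[OF Ck_on_cong[OF assms(1)], rotated])
       (simp add: matrix_inv_component assms(3) divide_inverse)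
qed

text \<open>Derivatives on the product are one-sided at the end times. Freezing the time uses them
  only in directions (0, v), and there the derivative is a full one because \<open>V\<close> is
  open.\<close>

lemma Ck_on_slice:
  fixes f :: "real \<times> 'a::euclidean_space \<Rightarrow> 'b::real_normed_vector"
  assumes "open V" "t \<in> I" "Ck_on k (I \<times> V) f"
  shows "Ck_on k V (\<lambda>y. f (t, y))"
  using assms(3)
proof (induction k arbitrary: f)
  case 0
  then show ?case
    using assms(2) by (auto intro!: continuous_on_compose2[of "I \<times> V" f] continuous_intros)
next
  case (Suc k)
  let ?D = "\<lambda>z. frechet_derivative f (at z within I \<times> V)"
  have D: "(f has_derivative ?D (t, y)) (at (t, y) within I \<times> V)" if "y \<in> V" for y
    using Suc.prems assms(2) that frechet_derivative_works by (auto simp: differentiable_on_def)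
  have "((\<lambda>y. f (t, y)) has_derivative (\<lambda>v. ?D (t, y) (0, v))) (at y)" if y: "y \<in> V" for y
  proof -
    have "((\<lambda>y. f (t, y)) has_derivative (\<lambda>v. ?D (t, y) (0, v))) (at y within V)"
    proof (rule has_derivative_in_compose[where f = "\<lambda>y. (t, y)" and f' = "\<lambda>v. (0, v)" and g = f])
      show "((\<lambda>y. (t, y)) has_derivative (\<lambda>v. (0, v))) (at y within V)"
        by (auto intro!: derivative_eq_intros)
      show "(f has_derivative ?D (t, y)) (at (t, y) within (\<lambda>y. (t, y)) ` V)"
        using assms(2) by (intro has_derivative_subset[OF D[OF y]]) auto
    qed
    then show ?thesis using assms(1) y by (simp add: at_within_open[of y V])
  qed
  then show ?case
    by (rule Ck_on_SucI[OF assms(1)]) (use Suc.prems in \<open>auto intro!: Suc.IH\<close>)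
qed

lemma Ck_on_time_derivative:
  fixes f :: "real \<times> 'a::euclidean_space \<Rightarrow> 'b::real_normed_vector"
  assumes "Ck_on (Suc k) (I \<times> V) f" "t \<in> I" "y \<in> V"
  obtains d where "((\<lambda>s. f (s, y)) has_vector_derivative d) (at t within I)"
proof -
  have "f differentiable (at (t, y) within I \<times> V)"
    using assms by (auto simp: differentiable_on_def)
  then have "(f \<circ> (\<lambda>s. (s, y))) differentiable (at t within I)"
    using assms(2,3)
    by (intro differentiable_chain_within)
       (auto intro!: derivative_intros differentiable_subset[of f "(t, y)" "I \<times> V"]
         simp: differentiable_def intro: has_derivative_Pair has_derivative_subset)
  then show ?thesis using that by (auto simp: o_def vector_derivative_works)
qed

section \<open>Test functions and the fundamental lemma of the calculus of variations\<close>

text \<open>The derivatives of \<open>exp (- 1 / s)\<close> are linear combinations of the functions \<open>flat m\<close>.\<close>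

definition flat :: "nat \<Rightarrow> real \<Rightarrow> real" where
  "flat m s = (if 0 < s then inverse s ^ m * exp (- inverse s) else 0)"

lemma flat_nonneg: "0 \<le> flat m s" by (simp add: flat_def)

lemma flat_0_le_1: "flat 0 s \<le> 1" by (simp add: flat_def)

text \<open>Only the origin is delicate. From the right the difference quotient is
  \<open>z ^ (m + 1) / exp z\<close> at \<open>z = inverse h\<close>, which tends to 0; from the
  left it is identically 0.\<close>

lemma flat_has_derivative:
  "(flat m has_real_derivative flat (m + 2) s - real m * flat (m + 1) s) (at s)"
proof -
  consider "s < 0" | "s = 0" | "0 < s" by linarith
  then show ?thesis
  proof cases
    case 1
    have "((\<lambda>_. 0) has_real_derivative 0) (at s)" by simp
    then have "(flat m has_real_derivative 0) (at s)"
      by (rule has_field_derivative_transform_within_open[of _ _ _ "{..<0}"])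
         (use 1 in \<open>auto simp: flat_def\<close>)
    then show ?thesis using 1 by (simp add: flat_def)
  next
    case 2
    have "((\<lambda>z. z ^ (m + 1) / exp z) \<longlongrightarrow> 0) (at_top :: real filter)"
      by (rule tendsto_power_div_exp_0)
    then have "((\<lambda>h. inverse h ^ (m + 1) / exp (inverse h)) \<longlongrightarrow> 0) (at_right (0::real))"
      by (rule filterlim_compose) (rule filterlim_inverse_at_top_right)
    then have "((\<lambda>h. flat m h / h) \<longlongrightarrow> 0) (at_right 0)"
      by (rule Lim_transform_eventually)
         (auto simp: eventually_at_right_less flat_def exp_minus field_simps
           intro: eventually_mono[OF eventually_at_right_less])
    moreover have "((\<lambda>h. flat m h / h) \<longlongrightarrow> 0) (at_left 0)"
      by (rule Lim_transform_eventually[OF tendsto_const])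
         (auto simp: flat_def eventually_at_filter)
    ultimately have "((\<lambda>h. flat m h / h) \<longlongrightarrow> 0) (at 0)" by (simp add: filterlim_at_split)
    then show ?thesis using 2 by (simp add: has_field_derivative_iff flat_def)
  next
    case 3
    have "((\<lambda>s. inverse s ^ m * exp (- inverse s)) has_real_derivative
        flat (m + 2) s - real m * flat (m + 1) s) (at s)"
    proof -
      have "real m * inverse s ^ (m - 1) * (- (inverse s * inverse s))
          = - (real m * inverse s ^ (m + 1))"
        by (cases m) (simp_all add: power2_eq_square mult_ac)
      then show ?thesis using 3
        by (auto intro!: derivative_eq_intros simp: flat_def power2_eq_square algebra_simps)
    qed
    then show ?thesis
      by (rule has_field_derivative_transform_within_open[of _ _ _ "{0<..}"])
         (use 3 in \<open>auto simp: flat_def\<close>)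
  qed
qed

lemma Ck_on_flat:
  fixes f :: "'a::euclidean_space \<Rightarrow> real"
  assumes "open S" "Ck_on k S f"
  shows "Ck_on k S (\<lambda>x. flat m (f x))"
  using assms(2)
proof (induction k arbitrary: m)
  case 0
  have "continuous_on UNIV (flat m)"
    by (meson DERIV_isCont continuous_at_imp_continuous_on flat_has_derivative)
  then show ?case using 0 by (auto intro: continuous_on_compose2[of UNIV "flat m"])
next
  case (Suc k)
  obtain D where D: "\<And>x. x \<in> S \<Longrightarrow> (f has_derivative D x) (at x)" "\<And>v. Ck_on k S (\<lambda>x. D x v)"
    using Ck_on_SucE[OF Suc.prems(1) assms(1)] by blast
  have "((\<lambda>x. flat m (f x)) has_derivative
      (\<lambda>v. (flat (m + 2) (f x) + (- real m) * flat (m + 1) (f x)) * D x v)) (at x)" if "x \<in> S" for x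
    using has_derivative_compose[OF D(1)[OF that]] flat_has_derivative[of m "f x"]
    by (simp add: has_field_derivative_def)
  moreover have "Ck_on k S (\<lambda>x. flat j (f x))" for j using Suc.IH Ck_on_SucD[OF Suc.prems] by blast
  ultimately show ?case
    by (intro Ck_on_SucI[OF assms(1)]) (assumption, intro Ck_on_mult Ck_on_add Ck_on_const assms(1) D(2))
qed

section \<open>Smooth bumps on boxes\<close>

lemma Ck_on_component: "open S \<Longrightarrow> Ck_on k S (\<lambda>x. x $ i)" for S :: "(real ^ 'n::finite) set"
proof (cases k)
  case (Suc l)
  assume "open S"
  then show ?thesis unfolding Suc
    by (rule Ck_on_SucI[where D = "\<lambda>x v. v $ i"])
       (auto intro: Ck_on_const bounded_linear_imp_has_derivative bounded_linear_vec_nth \<open>open S\<close>)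
qed (auto intro: continuous_intros)

text \<open>For every \<open>k\<close> this is positive exactly on the open box; increasing
  \<open>k\<close> steepens the flanks, so that the bumps converge pointwise to the indicator of the
  open box while staying below 1.\<close>

definition box_bump :: "nat \<Rightarrow> real ^ 'n \<Rightarrow> real ^ 'n \<Rightarrow> real ^ 'n::finite \<Rightarrow> real" where
  "box_bump k a b y =
    (\<Prod>i\<in>UNIV. flat 0 (real (Suc k) * (y $ i - a $ i)) * flat 0 (real (Suc k) * (b $ i - y $ i)))"

lemma box_bump_nonneg: "0 \<le> box_bump k a b y"
  unfolding box_bump_def by (intro prod_nonneg ballI mult_nonneg_nonneg flat_nonneg)

lemma box_bump_le_1: "box_bump k a b y \<le> 1"
  unfolding box_bump_def by (intro prod_le_1 conjI mult_nonneg_nonneg flat_nonneg mult_le_one flat_0_le_1)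

lemma box_bump_pos_iff: "0 < box_bump k a b y \<longleftrightarrow> y \<in> box a b"
proof
  assume y: "0 < box_bump k a b y"
  have "0 < y $ i - a $ i \<and> 0 < b $ i - y $ i" for i
  proof (rule ccontr)
    assume "\<not> ?thesis"
    then have "flat 0 (real (Suc k) * (y $ i - a $ i)) * flat 0 (real (Suc k) * (b $ i - y $ i)) = 0"
      by (auto simp: flat_def zero_less_mult_iff)
    then have "box_bump k a b y = 0" unfolding box_bump_def by (intro prod_zero) auto
    with y show False by simp
  qed
  then show "y \<in> box a b" by (simp add: mem_box_cart)
next
  assume "y \<in> box a b"
  then show "0 < box_bump k a b y" unfolding box_bump_def
    by (intro prod_pos) (auto simp: mem_box_cart flat_def)
qed

lemma smooth_on_box_bump: "smooth_on UNIV (box_bump k a b)"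
  unfolding smooth_on_def
proof
  fix m
  have "Ck_on m UNIV (\<lambda>y. y $ i - c)" "Ck_on m UNIV (\<lambda>y. c - y $ i)" for i :: 'a and c :: real
    using Ck_on_add[OF open_UNIV Ck_on_component Ck_on_const, of m i "- c"]
      Ck_on_add[OF open_UNIV Ck_on_const Ck_on_mult[OF open_UNIV Ck_on_const Ck_on_component], of m c "- 1" i]
    by simp_all
  then show "Ck_on m UNIV (box_bump k a b)"
    unfolding box_bump_def[abs_def]
    by (intro Ck_on_prod Ck_on_mult Ck_on_flat open_UNIV Ck_on_const)
qed

lemma test_function_box_bump:
  assumes "cbox a b \<subseteq> U" shows "test_function_on U (box_bump k a b)"
proof -
  have eq: "{y. box_bump k a b y \<noteq> 0} = box a b"
    using box_bump_pos_iff[of k a b] box_bump_nonneg[of k a b] by (auto simp: less_le)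
  have "closure (box a b) \<subseteq> cbox a b"
    by (rule closure_minimal[OF box_subset_cbox closed_cbox])
  then show ?thesis unfolding test_function_on_def eq
    using smooth_on_box_bump assms by (auto simp: compact_closure bounded_box)
qed

lemma box_bump_tendsto: "(\<lambda>k. box_bump k a b y) \<longlonglongrightarrow> indicator (box a b) y"
proof (cases "y \<in> box a b")
  case True
  have *: "(\<lambda>k. flat 0 (real (Suc k) * d)) \<longlonglongrightarrow> 1" if "0 < d" for d :: real
  proof -
    have "(\<lambda>k. exp (- (inverse (real (Suc k)) * inverse d))) \<longlonglongrightarrow> exp (- (0 * inverse d))"
      by (intro tendsto_intros LIMSEQ_inverse_real_of_nat)
    then show ?thesis using that by (simp add: flat_def del: of_nat_Suc)
  qed
  have "(\<lambda>k. box_bump k a b y) \<longlonglongrightarrow> (\<Prod>i\<in>(UNIV::'a set). 1 * 1)"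
    unfolding box_bump_def using True by (intro tendsto_prod tendsto_mult *) (auto simp: mem_box_cart)
  then show ?thesis using True by simp
next
  case False
  then have "box_bump k a b y = 0" for k
    using box_bump_pos_iff[of k a b y] box_bump_nonneg[of k a b y] by (simp add: less_le)
  then show ?thesis using False by simp
qed

lemma continuous_on_box_bump: "continuous_on S (box_bump k a b)"
proof -
  have "Ck_on 0 UNIV (box_bump k a b)" using smooth_on_box_bump unfolding smooth_on_def by blast
  then show ?thesis by (auto intro: continuous_on_subset)
qed

text \<open>The bumps are admissible test functions bounded by 1 and supported in the closed box, on
  which \<zeta> is integrable, so dominated convergence replaces them by the indicator.\<close>

lemma box_integral_zero:
  fixes \<zeta> :: "real ^ 'n::finite \<Rightarrow> real"
  assumes \<zeta>: "locally_integrable_on U \<zeta>" and ab: "cbox a b \<subseteq> U"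
    and zero: "\<And>\<eta>. test_function_on U \<eta> \<Longrightarrow> (LINT y:U|lborel. \<zeta> y * \<eta> y) = 0"
  shows "(LINT y:box a b|lborel. \<zeta> y) = 0"
proof -
  have int: "integrable lborel (\<lambda>y. indicator (cbox a b) y * \<zeta> y)"
    using \<zeta> ab compact_cbox unfolding locally_integrable_on_def set_integrable_def by auto
  have bm: "box_bump k a b \<in> borel_measurable borel" for k
    by (intro borel_measurable_continuous_onI continuous_on_box_bump)
  have eq: "indicator (cbox a b) y * \<zeta> y * box_bump k a b y
      = indicator U y *\<^sub>R (\<zeta> y * box_bump k a b y)" for k y
    using ab box_bump_pos_iff[of k a b y] box_bump_nonneg[of k a b y] box_subset_cbox[of a b]
    by (cases "y \<in> box a b") (auto simp: indicator_def less_le)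
  have "(\<lambda>k. LINT y|lborel. indicator (cbox a b) y * \<zeta> y * box_bump k a b y)
    \<longlonglongrightarrow> (LINT y|lborel. indicator (cbox a b) y * \<zeta> y * indicator (box a b) y)"
  proof (rule integral_dominated_convergence[where w = "\<lambda>y. \<bar>indicator (cbox a b) y * \<zeta> y\<bar>"])
    show "integrable lborel (\<lambda>y. \<bar>indicator (cbox a b) y * \<zeta> y\<bar>)"
      using int by (rule integrable_abs)
    show "(\<lambda>y. indicator (cbox a b) y * \<zeta> y * indicator (box a b) y) \<in> borel_measurable lborel"
      using borel_measurable_integrable[OF int] by measurable
    show "(\<lambda>y. indicator (cbox a b) y * \<zeta> y * box_bump k a b y) \<in> borel_measurable lborel" for k
      using borel_measurable_integrable[OF int] bm[of k] by measurable
    show "AE y in lborel. (\<lambda>k. indicator (cbox a b) y * \<zeta> y * box_bump k a b y)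
        \<longlonglongrightarrow> indicator (cbox a b) y * \<zeta> y * indicator (box a b) y"
      by (intro AE_I2 tendsto_intros box_bump_tendsto)
    show "AE y in lborel. norm (indicator (cbox a b) y * \<zeta> y * box_bump k a b y)
        \<le> \<bar>indicator (cbox a b) y * \<zeta> y\<bar>" for k
      using box_bump_le_1[of k a b] box_bump_nonneg[of k a b]
      by (intro AE_I2) (auto simp: abs_mult intro!: mult_left_le)
  qed
  moreover have "(LINT y|lborel. indicator (cbox a b) y * \<zeta> y * box_bump k a b y) = 0" for k
    using zero[OF test_function_box_bump[OF ab, of k]] by (simp add: eq set_lebesgue_integral_def)
  moreover have "indicator (cbox a b) y * \<zeta> y * indicator (box a b) y
      = indicator (box a b) y *\<^sub>R \<zeta> y" for y
    using box_subset_cbox[of a b] by (auto simp: indicator_def)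
  ultimately show ?thesis
    by (simp add: LIMSEQ_const_iff set_lebesgue_integral_def)
qed

text \<open>Open boxes form an intersection-stable generator of the Borel sets. Inside one fixed box
  the vanishing integrals therefore spread from boxes to all Borel sets, which forces the density to
  vanish almost everywhere; countably many closed boxes exhaust \<open>U\<close>.\<close>

lemma fundamental_lemma_calculus_of_variations:
  fixes \<zeta> :: "real ^ 'n::finite \<Rightarrow> real"
  assumes "open U" and \<zeta>: "locally_integrable_on U \<zeta>"
    and zero: "\<And>\<eta>. test_function_on U \<eta> \<Longrightarrow> (LINT y:U|lborel. \<zeta> y * \<eta> y) = 0"
  shows "AE y in lborel. y \<in> U \<longrightarrow> \<zeta> y = 0"
proof -
  have box: "AE y in lborel. y \<in> cbox a b \<longrightarrow> \<zeta> y = 0" if ab: "cbox a b \<subseteq> U" for a b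
  proof -
    define f where "f = (\<lambda>y. indicator (box a b) y * \<zeta> y)"
    have "set_integrable lborel (cbox a b) \<zeta>"
      using \<zeta> ab compact_cbox unfolding locally_integrable_on_def by auto
    then have "set_integrable lborel (box a b) \<zeta>"
      by (rule set_integrable_subset) (auto simp: box_subset_cbox)
    then have int: "integrable lborel f" by (simp add: f_def set_integrable_def)
    have "(LINT y:A|lborel. f y) = 0" if "A \<in> sigma_sets UNIV (range (\<lambda>(a, b). box a b))" for A
    proof (rule sigma_sets_induct_disjoint[OF _ _ that])
      show "Int_stable (range (\<lambda>(a, b). box a b :: (real ^ 'n) set))"
        by (auto simp: Int_stable_def box_Int_box)
    next
      fix A :: "(real ^ 'n) set" assume "A \<in> range (\<lambda>(a, b). box a b)"
      then obtain c d where A: "A = box c d" by auto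
      define e where "e = (\<Sum>i\<in>Basis. max (c \<bullet> i) (a \<bullet> i) *\<^sub>R i)"
      define e' where "e' = (\<Sum>i\<in>Basis. min (d \<bullet> i) (b \<bullet> i) *\<^sub>R i)"
      have Ae: "A \<inter> box a b = box e e'" unfolding A e_def e'_def by (rule box_Int_box)
      have "(LINT y:A|lborel. f y) = (LINT y:box e e'|lborel. \<zeta> y)"
        unfolding set_lebesgue_integral_def f_def Ae[symmetric]
        by (intro Bochner_Integration.integral_cong) (auto simp: indicator_def)
      also have "\<dots> = 0"
      proof (cases "box e e' = {}")
        case False
        have "cbox e e' \<subseteq> cbox a b"
          unfolding e_def e'_def by (auto simp: mem_box)
        then show ?thesis using ab by (intro box_integral_zero[OF \<zeta> _ zero]) auto
      qed (simp add: set_lebesgue_integral_def)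
      finally show "(LINT y:A|lborel. f y) = 0" .
    next
      fix A :: "(real ^ 'n) set" assume A: "A \<in> sigma_sets UNIV (range (\<lambda>(a, b). box a b))"
        and IH: "(LINT y:A|lborel. f y) = 0"
      have mA: "A \<in> sets lborel" using A by (simp add: borel_eq_box sets_measure_of_conv)
      have "(LINT y:UNIV|lborel. f y) = (LINT y:box a b|lborel. \<zeta> y)"
        unfolding set_lebesgue_integral_def f_def by simp
      also have "\<dots> = 0" by (rule box_integral_zero[OF \<zeta> ab zero])
      finally have "(LINT y|lborel. f y) = 0" by (simp add: set_lebesgue_integral_def)
      moreover have "(LINT y:UNIV - A|lborel. f y) = (LINT y|lborel. f y - indicator A y *\<^sub>R f y)"
        unfolding set_lebesgue_integral_def
        by (intro Bochner_Integration.integral_cong) (auto simp: indicator_def)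
      moreover have "integrable lborel (\<lambda>y. indicator A y *\<^sub>R f y)"
        using mA int by (rule integrable_mult_indicator)
      ultimately show "(LINT y:UNIV - A|lborel. f y) = 0"
        using IH int by (simp add: set_lebesgue_integral_def)
    next
      fix A :: "nat \<Rightarrow> (real ^ 'n) set"
      assume dis: "disjoint_family A" and A: "range A \<subseteq> sigma_sets UNIV (range (\<lambda>(a, b). box a b))"
        and IH: "\<And>i. (LINT y:A i|lborel. f y) = 0"
      have mA: "A i \<in> sets lborel" for i
        using A by (auto simp: borel_eq_box sets_measure_of_conv)
      have "(LINT y:(\<Union>i. A i)|lborel. f y) = (\<Sum>i. (LINT y:A i|lborel. f y))"
        using dis mA int
        by (intro lebesgue_integral_countable_add)
           (auto simp: disjoint_family_on_def set_integrable_def intro!: integrable_mult_indicator[where 'b=real, simplified])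
      then show "(LINT y:(\<Union>i. A i)|lborel. f y) = 0" by (simp add: IH)
    qed (auto simp: set_lebesgue_integral_def)
    then have "AE y in lborel. f y = 0"
      using density_unique_real[OF int, of "\<lambda>_. 0"]
      by (simp add: borel_eq_box sets_measure_of_conv)
    \<comment> \<open>\<open>f\<close> is cut off to the open box, so the faces of the closed box
      have to be discarded as a null set.\<close>
    moreover have "AE y in lborel. y \<notin> cbox a b - box a b"
    proof (rule AE_not_in)
      show "cbox a b - box a b \<in> null_sets lborel"
        using negligible_frontier_interval[of a b]
        by (simp add: negligible_iff_null_sets null_sets_completion_iff)
    qed
    ultimately show ?thesis by eventually_elim (auto simp: f_def indicator_def)
  qed
  obtain \<D> where \<D>: "countable \<D>" "\<And>X. X \<in> \<D> \<Longrightarrow> X \<subseteq> U" "\<And>X. X \<in> \<D> \<Longrightarrow> \<exists>a b. X = cbox a b" "\<Union>\<D> = U"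
    by (rule open_countable_Union_open_cbox[OF \<open>open U\<close>]) blast
  have "AE y in lborel. \<forall>X\<in>\<D>. y \<in> X \<longrightarrow> \<zeta> y = 0"
  proof (rule AE_ball_countable'[OF _ \<D>(1)])
    fix X assume "X \<in> \<D>"
    then show "AE y in lborel. y \<in> X \<longrightarrow> \<zeta> y = 0" using \<D>(2,3) box by blast
  qed
  then show ?thesis using \<D>(4) by (auto elim: eventually_mono)
qed

section \<open>Integration by parts and change of variables\<close>

text \<open>Difference quotients along \<open>v\<close> integrate to 0 by translation invariance.
  The mean value theorem bounds them by \<open>B\<close>, so dominated convergence carries the 0
  over to the derivative, whose measurability also comes from this limit.\<close>

lemma integral_derivative_compact_support:
  fixes G :: "'a::euclidean_space \<Rightarrow> real"
  assumes der: "\<And>x. (G has_derivative D x) (at x)" and bnd: "\<And>x. \<bar>D x v\<bar> \<le> B"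
    and K: "compact K" "\<And>x. x \<notin> K \<Longrightarrow> G x = 0"
  shows "(LINT x|lborel. D x v) = 0"
proof -
  define h where "h = (\<lambda>k::nat. inverse (real (Suc k)))"
  define Q where "Q = (\<lambda>k x. (G (x + h k *\<^sub>R v) - G x) / h k)"
  have h: "0 < h k" "h k \<le> 1" for k by (simp_all add: h_def field_simps)
  have "continuous_on UNIV G" 
    by (meson continuous_at_imp_continuous_on der has_derivative_continuous)
  then have mG [measurable]: "G \<in> borel_measurable borel" by (rule borel_measurable_continuous_onI)
  obtain R where R: "\<And>x. x \<in> K \<Longrightarrow> norm x \<le> R"
    using compact_imp_bounded[OF K(1)] by (auto simp: bounded_iff)
  \<comment> \<open>Since the steps \<open>h k\<close> are at most 1, all quotients vanish outside
    this one ball.\<close>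
  let ?C = "cball (0::'a) (R + norm v)"
  have scale: "(\<lambda>r. D y (r *\<^sub>R v)) = (*) (D y v)" for y
    using linear_scale[OF has_derivative_linear[OF der[of y]]]
    by (auto simp: fun_eq_iff mult.commute[of _ "D y v"])
  have Q_le: "\<bar>Q k x\<bar> \<le> B * indicator ?C x" for k x
  proof (cases "x \<in> ?C")
    case True
    have d: "((\<lambda>s. G (x + s *\<^sub>R v)) has_real_derivative D (x + s *\<^sub>R v) v) (at s)" for s
    proof -
      have "((\<lambda>s. x + s *\<^sub>R v) has_derivative (\<lambda>r. r *\<^sub>R v)) (at s)"
        by (auto intro!: derivative_eq_intros)
      from has_derivative_compose[OF this der]
      have "((\<lambda>s. G (x + s *\<^sub>R v)) has_derivative (\<lambda>r. D (x + s *\<^sub>R v) (r *\<^sub>R v))) (at s)" .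
      moreover have "(\<lambda>r. D (x + s *\<^sub>R v) (r *\<^sub>R v)) = (*) (D (x + s *\<^sub>R v) v)" by (rule scale)
      ultimately show ?thesis by (simp add: has_field_derivative_def)
    qed
    obtain s where "G (x + h k *\<^sub>R v) - G (x + 0 *\<^sub>R v) = (h k - 0) * D (x + s *\<^sub>R v) v"
      using MVT2[OF h(1)[of k] d] by blast
    then have "Q k x = D (x + s *\<^sub>R v) v" using h(1)[of k] by (simp add: Q_def)
    then show ?thesis using bnd True by simp
  next
    case False
    then have "R + norm v < norm x" by simp
    then have "x \<notin> K" using R[of x] norm_ge_zero[of v] by fastforce
    moreover have "x + h k *\<^sub>R v \<notin> K"
    proof
      assume "x + h k *\<^sub>R v \<in> K"
      then have "norm (x + h k *\<^sub>R v) \<le> R" by (rule R)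
      moreover have "norm (h k *\<^sub>R v) \<le> norm v" using h[of k] by (simp add: mult_left_le_one_le)
      moreover have "norm x \<le> norm (x + h k *\<^sub>R v) + norm (h k *\<^sub>R v)"
        using norm_triangle_sub[of x "x + h k *\<^sub>R v"] by simp
      ultimately show False using \<open>R + norm v < norm x\<close> by linarith
    qed
    ultimately show ?thesis using K(2) False by (simp add: Q_def)
  qed
  have [measurable]: "Q k \<in> borel_measurable lborel" for k unfolding Q_def by measurable
  have intC: "integrable lborel (\<lambda>x. B * indicator ?C x)"
    using emeasure_lborel_cball_finite[of 0 "R + norm v"] by (intro integrable_mult_right integrable_real_indicator) simp_all
  have lim: "(\<lambda>k. Q k x) \<longlonglongrightarrow> D x v" for x
  proof -
    have "((\<lambda>s. x + s *\<^sub>R v) has_derivative (\<lambda>r. r *\<^sub>R v)) (at 0)"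
      by (auto intro!: derivative_eq_intros)
    from has_derivative_compose[OF this, of G "D x"] der[of x]
    have "((\<lambda>s. G (x + s *\<^sub>R v)) has_real_derivative D x v) (at 0)"
      by (simp add: has_field_derivative_def scale)
    then have "((\<lambda>s. (G (x + s *\<^sub>R v) - G x) / s) \<longlongrightarrow> D x v) (at 0)"
      by (simp add: has_field_derivative_iff)
    moreover have "filterlim h (at 0) sequentially"
      unfolding filterlim_at h_def using LIMSEQ_inverse_real_of_nat by auto
    ultimately show ?thesis unfolding Q_def by (rule filterlim_compose)
  qed
  have mD: "(\<lambda>x. D x v) \<in> borel_measurable lborel"
    by (rule borel_measurable_LIMSEQ_real[of _ Q]) (use lim in auto)
  have "(\<lambda>k. LINT x|lborel. Q k x) \<longlonglongrightarrow> (LINT x|lborel. D x v)"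
    by (rule integral_dominated_convergence[OF mD _ intC]) (use lim Q_le in auto)
  moreover have "(LINT x|lborel. Q k x) = 0" for k
  proof -
    have "integrable lborel G"
    proof -
      have "integrable lborel (\<lambda>x. indicator K x *\<^sub>R G x)"
        using \<open>continuous_on UNIV G\<close> K(1) by (intro borel_integrable_compact) (auto intro: continuous_on_subset)
      moreover have "(\<lambda>x. indicator K x *\<^sub>R G x) = G" using K(2) by (auto simp: fun_eq_iff indicator_def)
      ultimately show ?thesis by simp
    qed
    moreover have "integrable (distr lborel borel ((+) (h k *\<^sub>R v))) G"
      using \<open>integrable lborel G\<close> by (simp add: lborel_distr_plus)
    then have "integrable lborel (\<lambda>x. G (h k *\<^sub>R v + x))" by (simp add: integrable_distr_eq)
    moreover have "(LINT x|lborel. G (h k *\<^sub>R v + x)) = (LINT x|lborel. G x)"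
      using integral_distr[of "(+) (h k *\<^sub>R v)" lborel borel G] by (simp add: lborel_distr_plus)
    ultimately show ?thesis by (simp add: Q_def add.commute)
  qed
  ultimately show ?thesis by (simp add: LIMSEQ_const_iff)
qed

text \<open>Bridge to the gauge integral, in which the change of variables theorem is stated; the
  value \<infinity> corresponds to failure of absolute integrability.\<close>

lemma nn_integral_eq_henstock:
  fixes u :: "'a::euclidean_space \<Rightarrow> real"
  assumes "\<And>x. x \<in> S \<Longrightarrow> 0 \<le> u x" and m: "(\<lambda>x. indicator S x * u x) \<in> borel_measurable borel"
  shows "(\<integral>\<^sup>+x\<in>S. ennreal (u x) \<partial>lborel)
    = (if u absolutely_integrable_on S then ennreal (integral S u) else \<infinity>)"
proof -
  have eq: "(\<integral>\<^sup>+x\<in>S. ennreal (u x) \<partial>lborel) = (\<integral>\<^sup>+x. ennreal (indicator S x * u x) \<partial>lborel)"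
    by (intro nn_integral_cong) (simp add: indicator_def)
  have nn: "0 \<le> indicator S x * u x" for x using assms(1) by (auto simp: indicator_def)
  have iff: "u absolutely_integrable_on S \<longleftrightarrow> integrable lborel (\<lambda>x. indicator S x * u x)"
    using m by (simp add: set_integrable_def integrable_completion)
  show ?thesis
  proof (cases "u absolutely_integrable_on S")
    case True
    then have "(LINT x|lebesgue. indicator S x * u x) = integral S u"
      using set_lebesgue_integral_eq_integral(2)[OF True] by (simp add: set_lebesgue_integral_def)
    then have "(LINT x|lborel. indicator S x * u x) = integral S u"
      using m by (simp add: integral_completion)
    then show ?thesis using True iff nn_integral_eq_integral[of lborel "\<lambda>x. indicator S x * u x"] nn
      by (simp add: eq)
  next
    case False
    have "\<not> (\<integral>\<^sup>+x. ennreal (indicator S x * u x) \<partial>lborel) < \<infinity>"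
    proof
      assume "(\<integral>\<^sup>+x. ennreal (indicator S x * u x) \<partial>lborel) < \<infinity>"
      then have "integrable lborel (\<lambda>x. indicator S x * u x)"
        using m nn by (intro integrableI_nonneg AE_I2) simp_all
      with False iff show False by blast
    qed
    then have "(\<integral>\<^sup>+x. ennreal (indicator S x * u x) \<partial>lborel) = \<infinity>"
      using less_top[of "\<integral>\<^sup>+x. ennreal (indicator S x * u x) \<partial>lborel"]
      unfolding infinity_ennreal_def by blast
    then show ?thesis unfolding eq using False by (simp only: if_False)
  qed
qed

text \<open>The underlying theorem concerns vector-valued integrands, so the scalar \<open>F\<close>
  passes through \<open>real ^ 1\<close>. It transfers integrability together with the value, which
  covers the infinite case as well.\<close>

lemma nn_integral_change_of_variables:
  fixes F :: "real ^ 'n::{finite,wellorder} \<Rightarrow> real" and g :: "real ^ 'n::_ \<Rightarrow> real ^ 'n::_"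
  assumes S: "S \<in> sets borel"
    and der: "\<And>x. x \<in> S \<Longrightarrow> (g has_derivative g' x) (at x within S)" and inj: "inj_on g S"
    and nn: "\<And>y. y \<in> g ` S \<Longrightarrow> 0 \<le> F y"
    and m: "(\<lambda>y. indicator (g ` S) y * F y) \<in> borel_measurable borel"
      "(\<lambda>x. indicator S x * (\<bar>det (matrix (g' x))\<bar> * F (g x))) \<in> borel_measurable borel"
  shows "(\<integral>\<^sup>+y\<in>g ` S. ennreal (F y) \<partial>lborel)
    = (\<integral>\<^sup>+x\<in>S. ennreal (\<bar>det (matrix (g' x))\<bar> * F (g x)) \<partial>lborel)"
proof -
  let ?D = "\<lambda>x. \<bar>det (matrix (g' x))\<bar> * F (g x)"
  have "?D absolutely_integrable_on S \<and> integral S ?D = b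
      \<longleftrightarrow> F absolutely_integrable_on (g ` S) \<and> integral (g ` S) F = b" for b
  proof -
    have "(\<lambda>x. \<bar>det (matrix (g' x))\<bar> *\<^sub>R (vec (F (g x)) :: real ^ 1)) absolutely_integrable_on S
        \<and> integral S (\<lambda>x. \<bar>det (matrix (g' x))\<bar> *\<^sub>R (vec (F (g x)) :: real ^ 1)) = vec b
      \<longleftrightarrow> (\<lambda>y. vec (F y) :: real ^ 1) absolutely_integrable_on (g ` S)
        \<and> integral (g ` S) (\<lambda>y. vec (F y) :: real ^ 1) = vec b"
      by (rule has_absolute_integral_change_of_variables[OF _ der inj]) (use S in auto)
    then show ?thesis
      by (simp add: absolutely_integrable_on_1_iff integral_on_1_eq vec_eq_iff)
  qed
  then have "?D absolutely_integrable_on S \<longleftrightarrow> F absolutely_integrable_on (g ` S)"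
    "?D absolutely_integrable_on S \<Longrightarrow> integral S ?D = integral (g ` S) F" by blast+
  moreover have "(\<integral>\<^sup>+y\<in>g ` S. ennreal (F y) \<partial>lborel)
    = (if F absolutely_integrable_on (g ` S) then ennreal (integral (g ` S) F) else \<infinity>)"
    by (rule nn_integral_eq_henstock[OF nn m(1)])
  moreover have "(\<integral>\<^sup>+x\<in>S. ennreal (?D x) \<partial>lborel)
    = (if ?D absolutely_integrable_on S then ennreal (integral S ?D) else \<infinity>)"
    by (rule nn_integral_eq_henstock[OF _ m(2)]) (use nn in auto)
  ultimately show ?thesis by simp
qed

section \<open>Charts and contractions of tensors\<close>

lemma is_chartD:
  assumes "is_chart c"
  shows "open (fst c)" "open (chart_image c)" "continuous_on (fst c) (snd c)"
    "continuous_on (chart_image c) (chart_inv c)"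
    "x \<in> fst c \<Longrightarrow> chart_inv c (snd c x) = x" "x \<in> fst c \<Longrightarrow> snd c x \<in> chart_image c"
    "y \<in> chart_image c \<Longrightarrow> snd c (chart_inv c y) = y"
    "y \<in> chart_image c \<Longrightarrow> chart_inv c y \<in> fst c"
  using assms unfolding is_chart_def homeomorphism_def by auto

lemma symmetric_component: "transpose P = P \<Longrightarrow> P $ j $ i = P $ i $ j" for P :: "real ^ 'n ^ 'n"
  by (drule arg_cong[of _ _ "\<lambda>Q. Q $ i $ j"]) (simp add: transpose_def)

locale closed_mfd =
  fixes A :: "('m::{t2_space, second_countable_topology}, 'n::{finite, wellorder}) chart set"
  assumes closed_manifold: "closed_manifold A"
begin

lemma compact_UNIV: "compact (UNIV :: 'm set)"
  and smooth_atlas: "smooth_atlas A"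
  using closed_manifold by (auto simp: closed_manifold_def)

lemma is_chart: "c \<in> A \<Longrightarrow> is_chart c"
  using smooth_atlas by (auto simp: smooth_atlas_def)

lemmas chart = is_chartD[OF is_chart]

lemma chart_at: "chart_at A x \<in> A" "x \<in> fst (chart_at A x)"
proof -
  have "\<exists>c. c \<in> A \<and> x \<in> fst c" using smooth_atlas unfolding smooth_atlas_def by blast
  from someI_ex[OF this] show "chart_at A x \<in> A" "x \<in> fst (chart_at A x)"
    unfolding chart_at_def by auto
qed

lemma open_chart_preimage: "c \<in> A \<Longrightarrow> open U \<Longrightarrow> open (snd c ` (fst c \<inter> U))"
proof -
  assume c: "c \<in> A" and U: "open U"
  have "snd c ` (fst c \<inter> U) = chart_image c \<inter> chart_inv c -` U"
    using chart[OF c] by (force simp: chart_image_def)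
  then show ?thesis
    using continuous_open_preimage[OF chart(4)[OF c] chart(2)[OF c] U] by simp
qed

abbreviation overlap :: "('m, 'n) chart \<Rightarrow> ('m, 'n) chart \<Rightarrow> (real ^ 'n::_) set" where
  "overlap c d \<equiv> snd c ` (fst c \<inter> fst d)"

lemma open_overlap: "c \<in> A \<Longrightarrow> d \<in> A \<Longrightarrow> open (overlap c d)"
  using open_chart_preimage chart(1) by blast

lemma Ck_on_transition: "c \<in> A \<Longrightarrow> d \<in> A \<Longrightarrow> Ck_on k (overlap c d) (snd d \<circ> chart_inv c)"
  using smooth_atlas by (auto simp: smooth_atlas_def smooth_on_def)

lemma transition_has_derivative:
  assumes "c \<in> A" "d \<in> A" "x \<in> fst c" "x \<in> fst d"
  shows "((snd d \<circ> chart_inv c) has_derivative (\<lambda>v. transition_jacobian c d x *v v)) (at (snd c x))"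
proof -
  have "snd c x \<in> overlap c d" using assms by blast
  then have "(snd d \<circ> chart_inv c) differentiable (at (snd c x))"
    using Ck_on_SucE[OF Ck_on_transition[OF assms(1,2), of "Suc 0"] open_overlap[OF assms(1,2)]]
    unfolding differentiable_def by blast
  then have D: "((snd d \<circ> chart_inv c) has_derivative frechet_derivative (snd d \<circ> chart_inv c) (at (snd c x)))
      (at (snd c x))"
    by (simp add: frechet_derivative_works)
  have "linear (frechet_derivative (snd d \<circ> chart_inv c) (at (snd c x)))"
    using D has_derivative_linear by blast
  with D show ?thesis unfolding transition_jacobian_def by (simp add: matrix_works)
qed

lemma continuous_on_transition_jacobian:
  assumes "c \<in> A" "d \<in> A"
  shows "continuous_on (overlap c d) (\<lambda>y. transition_jacobian c d (chart_inv c y))"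
proof -
  let ?\<tau> = "snd d \<circ> chart_inv c"
  obtain D where D: "\<And>y. y \<in> overlap c d \<Longrightarrow> (?\<tau> has_derivative D y) (at y)"
    "\<And>v. Ck_on 0 (overlap c d) (\<lambda>y. D y v)"
    using Ck_on_SucE[OF Ck_on_transition[OF assms, of "Suc 0"] open_overlap[OF assms]] by blast
  have "continuous_on (overlap c d) (\<lambda>y. \<chi> i j. D y (axis j 1) $ i)"
    using D(2) by (intro continuous_intros) simp
  then show ?thesis
  proof (rule continuous_on_eq)
    fix y assume y: "y \<in> overlap c d"
    then have "snd c (chart_inv c y) = y" using chart[OF assms(1)] by auto
    moreover have "D y = frechet_derivative ?\<tau> (at y)" using D(1)[OF y] by (rule frechet_derivative_at)
    ultimately show "(\<chi> i j. D y (axis j 1) $ i) = transition_jacobian c d (chart_inv c y)"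
      by (simp add: transition_jacobian_def matrix_def)
  qed
qed

lemma transition_jacobian_comp:
  assumes "c \<in> A" "d \<in> A" "e \<in> A" "x \<in> fst c" "x \<in> fst d" "x \<in> fst e"
  shows "transition_jacobian c e x = transition_jacobian d e x ** transition_jacobian c d x"
proof -
  let ?J = "\<lambda>c d. transition_jacobian c d x"
  have eq: "(snd d \<circ> chart_inv c) (snd c x) = snd d x" using chart(5)[OF assms(1,4)] by simp
  have "((snd e \<circ> chart_inv d \<circ> (snd d \<circ> chart_inv c)) has_derivative
      ((*v) (?J d e) \<circ> (*v) (?J c d))) (at (snd c x))"
    by (intro diff_chain_at transition_has_derivative assms)
       (simp only: eq transition_has_derivative assms)
  then have "((snd e \<circ> chart_inv c) has_derivative ((*v) (?J d e) \<circ> (*v) (?J c d))) (at (snd c x))"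
  proof (rule has_derivative_transform_within_open[OF _ open_overlap[OF assms(1,2)]])
    show "snd c x \<in> overlap c d" using assms by blast
    show "(snd e \<circ> chart_inv d \<circ> (snd d \<circ> chart_inv c)) y = (snd e \<circ> chart_inv c) y"
      if "y \<in> overlap c d" for y
      using that chart[OF assms(1)] chart[OF assms(2)] by auto
  qed
  from has_derivative_unique[OF this transition_has_derivative[OF assms(1,3,4,6)]]
  have "\<And>v. ?J c e *v v = ?J d e *v (?J c d *v v)" by (simp add: fun_eq_iff)
  then show ?thesis by (simp add: matrix_eq matrix_vector_mul_assoc)
qed

lemma transition_jacobian_self:
  assumes "c \<in> A" "x \<in> fst c" shows "transition_jacobian c c x = mat 1"
proof -
  have "((snd c \<circ> chart_inv c) has_derivative (\<lambda>v. v)) (at (snd c x))"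
    by (rule has_derivative_transform_within_open[OF has_derivative_ident chart(2)[OF assms(1)]])
       (use chart[OF assms(1)] assms(2) in auto)
  from has_derivative_unique[OF this transition_has_derivative[OF assms(1,1,2,2)]]
  show ?thesis by (simp add: matrix_eq fun_eq_iff)
qed

lemma transition_jacobian_inverse:
  assumes "c \<in> A" "d \<in> A" "x \<in> fst c" "x \<in> fst d"
  shows "transition_jacobian d c x ** transition_jacobian c d x = mat 1"
  using transition_jacobian_comp[OF assms(1,2,1,3,4,3)] transition_jacobian_self[OF assms(1,3)] by simp

end

section \<open>Contractions with a fixed metric are independent of the chart\<close>

locale riem_metric = closed_mfd A
  for A :: "('m::{t2_space, second_countable_topology}, 'n::{finite, wellorder}) chart set" +
  fixes g :: "('m, 'n) tensor2"
  assumes riemannian_metric: "riemannian_metric A g"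
    and metric_continuous: "\<And>c. c \<in> A \<Longrightarrow> continuous_on (chart_image c) (\<lambda>y. g c (chart_inv c y))"
begin

lemma posdef_metric: "c \<in> A \<Longrightarrow> x \<in> fst c \<Longrightarrow> posdef (g c x)"
  using riemannian_metric
  unfolding riemannian_metric_def symmetric_tensor2_def posdef_def quadratic_form_eq_inner by blast

lemma invertible_metric: "c \<in> A \<Longrightarrow> x \<in> fst c \<Longrightarrow> invertible (g c x)"
  using posdef_metric posdef_invertible by blast

lemma metric_transform:
  assumes "c \<in> A" "d \<in> A" "x \<in> fst c" "x \<in> fst d"
  shows "g c x = transpose (transition_jacobian c d x) ** g d x ** transition_jacobian c d x"
  using riemannian_metric assms
  unfolding riemannian_metric_def symmetric_tensor2_def covariant_tensor2_def by blast

lemma det_metric_transform: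
  assumes "c \<in> A" "d \<in> A" "x \<in> fst c" "x \<in> fst d"
  shows "sqrt (det (g c x)) = \<bar>det (transition_jacobian c d x)\<bar> * sqrt (det (g d x))"
  by (simp add: metric_transform[OF assms] det_mul real_sqrt_mult mult_ac)

text \<open>The contravariant law for the inverse metric, obtained by checking that the left side is
  a right inverse of \<open>g d x\<close>. The chart independence of traces and energies rests on
  it.\<close>

lemma metric_inv_transform:
  assumes "c \<in> A" "d \<in> A" "x \<in> fst c" "x \<in> fst d"
  shows "transition_jacobian c d x ** matrix_inv (g c x) ** transpose (transition_jacobian c d x)
    = matrix_inv (g d x)"
proof -
  let ?J = "transition_jacobian c d x" and ?K = "transition_jacobian d c x"
  have KJ: "?K ** ?J = mat 1" and JK: "?J ** ?K = mat 1"
    using transition_jacobian_inverse[OF assms] transition_jacobian_inverse[OF assms(2,1,4,3)] by auto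
  have KJt: "transpose ?J ** transpose ?K = mat 1"
    using arg_cong[OF KJ, of transpose] by (simp add: matrix_transpose_mul)
  have "g d x ** (?J ** matrix_inv (g c x) ** transpose ?J)
    = transpose ?K ** g c x ** (?K ** ?J) ** matrix_inv (g c x) ** transpose ?J"
    by (simp add: metric_transform[OF assms(2,1,4,3)] matrix_mul_assoc)
  also have "\<dots> = transpose ?K ** (g c x ** matrix_inv (g c x)) ** transpose ?J"
    by (simp add: KJ matrix_mul_assoc)
  also have "\<dots> = transpose (?J ** ?K)"
    by (simp add: matrix_inv_works[OF invertible_metric[OF assms(1,3)]] matrix_transpose_mul)
  finally have "g d x ** (?J ** matrix_inv (g c x) ** transpose ?J) = mat 1" by (simp add: JK)
  then show ?thesis by (rule matrix_inv_unique[symmetric])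
qed

text \<open>Written as a matrix trace, the contraction lets the Jacobian rotate cyclically until it
  is absorbed by the inverse metric. Symmetry of \<omega> matches the index order of the definition
  with that of the matrix product.\<close>

lemma metric_trace_eq:
  assumes \<omega>: "symmetric_tensor2 A \<omega>" and c: "c \<in> A" "x \<in> fst c"
  shows "metric_trace A g \<omega> x = (\<Sum>i\<in>UNIV. \<Sum>j\<in>UNIV. matrix_inv (g c x) $ i $ j * \<omega> c x $ i $ j)"
proof -
  have tr: "(\<Sum>i\<in>UNIV. \<Sum>j\<in>UNIV. matrix_inv (g e x) $ i $ j * \<omega> e x $ i $ j)
      = trace (matrix_inv (g e x) ** \<omega> e x)" if "e \<in> A" "x \<in> fst e" for e
  proof -
    have "transpose (\<omega> e x) = \<omega> e x" using \<omega> that by (auto simp: symmetric_tensor2_def)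
    then have "\<omega> e x $ j $ i = \<omega> e x $ i $ j" for i j by (rule symmetric_component)
    then show ?thesis by (simp add: trace_def matrix_matrix_mult_def)
  qed
  define d where "d = chart_at A x"
  have d: "d \<in> A" "x \<in> fst d" by (simp_all add: d_def chart_at)
  let ?J = "transition_jacobian c d x"
  have "\<omega> c x = transpose ?J ** \<omega> d x ** ?J"
    using \<omega> c d unfolding symmetric_tensor2_def covariant_tensor2_def by blast
  then have "trace (matrix_inv (g c x) ** \<omega> c x)
    = trace ((matrix_inv (g c x) ** transpose ?J ** \<omega> d x) ** ?J)"
    by (simp add: matrix_mul_assoc)
  also have "\<dots> = trace (?J ** (matrix_inv (g c x) ** transpose ?J ** \<omega> d x))"
    by (rule trace_mul_sym)
  also have "\<dots> = trace (matrix_inv (g d x) ** \<omega> d x)"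
    by (simp add: metric_inv_transform[OF c(1) d(1) c(2) d(2), symmetric] matrix_mul_assoc)
  finally show ?thesis
    unfolding metric_trace_def d_def[symmetric] Let_def by (simp add: tr c d)
qed

text \<open>This is the squared gradient norm in covariant form. The covector does not depend on the
  metric, so along the flow only the inverse matrix varies.\<close>

definition energy :: "('m, 'n) vec_field \<Rightarrow> 'm \<Rightarrow> real" where
  "energy \<xi> x = (let c = chart_at A x in \<xi> c x \<bullet> (matrix_inv (g c x) *v \<xi> c x))"

lemma energy_eq:
  assumes "covector_field A \<xi>" and c: "c \<in> A" "x \<in> fst c"
  shows "energy \<xi> x = \<xi> c x \<bullet> (matrix_inv (g c x) *v \<xi> c x)"
proof -
  define d where "d = chart_at A x"
  have d: "d \<in> A" "x \<in> fst d" by (simp_all add: d_def chart_at)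
  let ?J = "transition_jacobian c d x"
  have \<xi>: "\<xi> c x = transpose ?J *v \<xi> d x"
    using assms d unfolding covector_field_def by blast
  have "\<xi> c x \<bullet> (matrix_inv (g c x) *v \<xi> c x) = \<xi> d x \<bullet> (?J *v (matrix_inv (g c x) *v \<xi> c x))"
    by (subst \<xi>) (simp add: transpose_matrix_vector dot_lmul_matrix)
  also have "\<dots> = \<xi> d x \<bullet> (matrix_inv (g d x) *v \<xi> d x)"
    unfolding \<xi> matrix_vector_mul_assoc matrix_mul_assoc
    by (simp only: metric_inv_transform[OF c(1) d(1) c(2) d(2)])
  finally show ?thesis unfolding energy_def d_def[symmetric] Let_def by simp
qed

lemma energy_nonneg: "0 \<le> energy \<xi> x"
  unfolding energy_def Let_def
  by (intro posdef_nonneg posdef_matrix_inv posdef_metric chart_at)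

lemma metric_inner_gradient:
  "metric_inner A g (gradient A g f) (gradient A g f) x = energy (SOME \<xi>. weak_differential A f \<xi>) x"
proof -
  define c where "c = chart_at A x"
  have c: "c \<in> A" "x \<in> fst c" by (simp_all add: c_def chart_at)
  let ?V = "gradient A g f c x"
  have "metric_inner A g (gradient A g f) (gradient A g f) x = ?V \<bullet> (g c x *v ?V)"
    unfolding metric_inner_def c_def[symmetric] Let_def
    by (simp add: inner_vec_def matrix_vector_mult_def sum_distrib_left mult_ac)
  also have "\<dots> = energy (SOME \<xi>. weak_differential A f \<xi>) x"
    unfolding energy_def c_def[symmetric] Let_def gradient_def
    using matrix_inv_works(1)[OF invertible_metric[OF c]]
    by (simp add: matrix_vector_mul_assoc inner_commute matrix_mul_assoc[symmetric])
  finally show ?thesis .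
qed

lemma metric_norm_gradient:
  "metric_norm A g (gradient A g f) x = sqrt (energy (SOME \<xi>. weak_differential A f \<xi>) x)"
  by (simp add: metric_norm_def metric_inner_gradient)

end

section \<open>The Riemannian measure\<close>

context closed_mfd
begin

lemma chart_inv_measurable:
  assumes c: "c \<in> A" shows "chart_inv c \<in> borel_measurable borel"
proof (rule borel_measurableI)
  fix U :: "'m set" assume U: "open U"
  \<comment> \<open>Off the chart image, \<open>inv_into\<close> returns the same junk value everywhere.\<close>
  define u where "u = (SOME y::'m. False)"
  have out: "chart_inv c y = u" if "y \<notin> chart_image c" for y
  proof -
    have "(\<lambda>x. x \<in> fst c \<and> snd c x = y) = (\<lambda>x. False)"
      using that by (auto simp: chart_image_def)
    then show ?thesis by (simp add: chart_inv_def inv_into_def u_def)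
  qed
  have eq: "chart_inv c -` U = (chart_image c \<inter> chart_inv c -` U) \<union> (if u \<in> U then - chart_image c else {})"
    using out by auto
  have "open (chart_image c \<inter> chart_inv c -` U)"
    using continuous_open_preimage[OF chart(4)[OF c] chart(2)[OF c] U] .
  moreover have "- chart_image c \<in> sets borel" using chart(2)[OF c] by auto
  ultimately have "(chart_image c \<inter> chart_inv c -` U) \<union> (if u \<in> U then - chart_image c else {}) \<in> sets borel"
    by auto
  then show "chart_inv c -` U \<inter> space borel \<in> sets borel"
    unfolding eq[symmetric] by simp
qed

lemma chart_image_eq:
  assumes c: "c \<in> A" and "B \<subseteq> fst c" shows "snd c ` B = chart_image c \<inter> chart_inv c -` B"
  using chart[OF c] assms(2) by (force simp: chart_image_def)

lemma chart_image_borel: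
  assumes c: "c \<in> A" and "B \<subseteq> fst c" "B \<in> sets borel" shows "snd c ` B \<in> sets borel"
proof -
  have "chart_inv c -` B \<in> sets borel"
    using measurable_sets[OF chart_inv_measurable[OF c] assms(3)] by simp
  then show ?thesis unfolding chart_image_eq[OF assms(1,2)] using chart(2)[OF c] by auto
qed

lemma finite_chart_cover:
  obtains C where "finite C" "C \<subseteq> A" "C \<noteq> {}" "(\<Union>c\<in>C. fst c) = UNIV"
proof -
  have "UNIV \<subseteq> (\<Union>c\<in>A. fst c)" using smooth_atlas unfolding smooth_atlas_def by blast
  then obtain C where C: "C \<subseteq> A" "finite C" "UNIV \<subseteq> (\<Union>c\<in>C. fst c)"
    using compactE_image[OF compact_UNIV, of A fst] chart(1) by metis
  then show ?thesis using that[of C] by auto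
qed

text \<open>\<open>e\<close> enumerates a finite cover over all of \<open>nat\<close>, hence with
  repetitions; making the domains disjoint leaves empty pieces at the repeated indices.\<close>

lemma chart_partition:
  obtains e :: "nat \<Rightarrow> ('m, 'n) chart" and P where
    "\<And>i. e i \<in> A" "\<And>i. P i \<subseteq> fst (e i)" "\<And>i. P i \<in> sets borel"
    "disjoint_family P" "(\<Union>i. P i) = UNIV"
proof -
  obtain C where C: "finite C" "C \<subseteq> A" "C \<noteq> {}" "(\<Union>c\<in>C. fst c) = UNIV"
    using finite_chart_cover by metis
  define e where "e = from_nat_into C"
  have r: "range e = C" unfolding e_def using C by (intro range_from_nat_into countable_finite)
  have eA: "e i \<in> A" for i using r C(2) by auto
  show ?thesis
  proof
    show "e i \<in> A" for i by (rule eA)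
    show "disjointed (\<lambda>i. fst (e i)) i \<subseteq> fst (e i)" for i by (rule disjointed_subset)
    have "range (disjointed (\<lambda>i. fst (e i))) \<subseteq> sets borel"
      by (rule sets.range_disjointed_sets) (use chart(1)[OF eA] in auto)
    then show "disjointed (\<lambda>i. fst (e i)) i \<in> sets borel" for i by auto
    show "disjoint_family (disjointed (\<lambda>i. fst (e i)))" by (rule disjoint_family_disjointed)
    show "(\<Union>i. disjointed (\<lambda>i. fst (e i)) i) = UNIV" 
      using C(4) r by (simp add: UN_disjointed_eq) blast
  qed
qed

end

section \<open>Densities in charts and the gluing of the Riemannian measure\<close>

context riem_metric
begin

definition vol :: "('m, 'n) chart \<Rightarrow> real ^ 'n::_ \<Rightarrow> real" where
  "vol c y = sqrt (det (g c (chart_inv c y)))"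

text \<open>A push-forward to the whole manifold, so that Borel sets of different charts can be
  measured by one object. The indicator is essential, since \<open>chart_inv\<close> takes an
  arbitrary value off the chart image.\<close>

definition chart_measure :: "('m, 'n) chart \<Rightarrow> 'm measure" where
  "chart_measure c = distr (density lborel (\<lambda>y. ennreal (indicator (chart_image c) y * vol c y)))
     borel (chart_inv c)"

lemma vol_pos: "c \<in> A \<Longrightarrow> y \<in> chart_image c \<Longrightarrow> 0 < vol c y"
  unfolding vol_def by (simp add: posdef_det_pos posdef_metric chart(8))

lemma vol_measurable:
  assumes c: "c \<in> A" shows "(\<lambda>y. indicator (chart_image c) y * vol c y) \<in> borel_measurable borel"
proof -
  have "continuous_on (chart_image c) (vol c)"
    unfolding vol_def by (intro continuous_on_real_sqrt continuous_on_det metric_continuous c)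
  with borel_measurable_continuous_on_indicator[OF _ this] chart(2)[OF c]
  show ?thesis by simp
qed

lemma sets_chart_measure [measurable_cong, simp]: "sets (chart_measure c) = sets borel"
  by (simp add: chart_measure_def)

lemma nn_integral_chart_measure:
  assumes c: "c \<in> A" and F: "F \<in> borel_measurable borel"
  shows "(\<integral>\<^sup>+x. F x \<partial>chart_measure c)
    = (\<integral>\<^sup>+y. ennreal (indicator (chart_image c) y * vol c y) * F (chart_inv c y) \<partial>lborel)"
proof -
  have [measurable]: "chart_inv c \<in> borel_measurable lborel" "F \<in> borel_measurable borel"
    "(\<lambda>y. indicator (chart_image c) y * vol c y) \<in> borel_measurable lborel"
    using chart_inv_measurable[OF c] F vol_measurable[OF c] by auto
  show ?thesis unfolding chart_measure_def
    by (subst nn_integral_distr) (auto simp: nn_integral_density intro!: nn_integral_density)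
qed

lemma emeasure_chart_measure:
  assumes c: "c \<in> A" and B: "B \<in> sets borel"
  shows "emeasure (chart_measure c) B = (\<integral>\<^sup>+y\<in>snd c ` (B \<inter> fst c). ennreal (vol c y) \<partial>lborel)"
proof -
  have "emeasure (chart_measure c) B = (\<integral>\<^sup>+x. indicator B x \<partial>chart_measure c)"
    using B by (intro nn_integral_indicator[symmetric]) simp
  also have "\<dots> = (\<integral>\<^sup>+y. ennreal (indicator (chart_image c) y * vol c y) * indicator B (chart_inv c y) \<partial>lborel)"
    using B by (intro nn_integral_chart_measure c) auto
  also have "\<dots> = (\<integral>\<^sup>+y\<in>snd c ` (B \<inter> fst c). ennreal (vol c y) \<partial>lborel)"
    using chart(8)[OF c] by (intro nn_integral_cong)
      (auto simp: chart_image_eq[OF c, of "B \<inter> fst c"] split: split_indicator)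
  finally show ?thesis .
qed

text \<open>Compatibility needed for the gluing: the Jacobian of the transition map in the change of
  variables is the factor by which the two densities differ.\<close>

lemma chart_measure_overlap:
  assumes c: "c \<in> A" and d: "d \<in> A" and B: "B \<in> sets borel" "B \<subseteq> fst c" "B \<subseteq> fst d"
  shows "emeasure (chart_measure c) B = emeasure (chart_measure d) B"
proof -
  let ?\<tau> = "snd d \<circ> chart_inv c" and ?S = "snd c ` B"
  let ?J = "\<lambda>y. transition_jacobian c d (chart_inv c y)"
  have S: "?S \<in> sets borel" using chart_image_borel c B by blast
  have T: "snd d ` B \<in> sets borel" using chart_image_borel d B by blast
  have inv: "chart_inv c y \<in> B" "snd c (chart_inv c y) = y" "y \<in> chart_image c" if "y \<in> ?S" for y
    using that chart[OF c] B by auto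
  have img: "?\<tau> ` ?S = snd d ` B"
    using chart(5)[OF c] B(2) by (force simp: image_iff)
  have J: "vol c y = \<bar>det (?J y)\<bar> * vol d (?\<tau> y)" if "y \<in> ?S" for y
  proof -
    have x: "chart_inv c y \<in> fst c" "chart_inv c y \<in> fst d" using inv[OF that] B by auto
    then show ?thesis using det_metric_transform[OF c d x] chart(5)[OF d x(2)] by (simp add: vol_def)
  qed
  have "(\<integral>\<^sup>+y\<in>?\<tau> ` ?S. ennreal (vol d y) \<partial>lborel)
    = (\<integral>\<^sup>+y\<in>?S. ennreal (\<bar>det (matrix ((*v) (?J y)))\<bar> * vol d (?\<tau> y)) \<partial>lborel)"
  proof (rule nn_integral_change_of_variables[OF S])
    show "(?\<tau> has_derivative (*v) (?J y)) (at y within ?S)" if "y \<in> ?S" for y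
      using transition_has_derivative[OF c d, of "chart_inv c y"] inv[OF that] B
      by (auto intro: has_derivative_at_withinI)
    show "inj_on ?\<tau> ?S"
    proof (rule inj_onI)
      fix y z assume "y \<in> ?S" "z \<in> ?S" "?\<tau> y = ?\<tau> z"
      then have "chart_inv c y = chart_inv c z"
        using inv(1) chart(5)[OF d] B(3) by (metis comp_apply subsetD)
      then show "y = z" using inv(2) \<open>y \<in> ?S\<close> \<open>z \<in> ?S\<close> by metis
    qed
    show "0 \<le> vol d y" if "y \<in> ?\<tau> ` ?S" for y
      using that B(3) chart(6)[OF d] unfolding img by (auto intro!: less_imp_le vol_pos d)
    have "(\<lambda>y. indicator (snd d ` B) y * (indicator (chart_image d) y * vol d y)) \<in> borel_measurable borel"
      using T vol_measurable[OF d] by measurable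
    moreover have "indicator (snd d ` B) y * (indicator (chart_image d) y * vol d y)
        = indicator (snd d ` B) y * vol d y" for y
      using B(3) chart(6)[OF d] by (auto simp: indicator_def)
    ultimately show "(\<lambda>y. indicator (?\<tau> ` ?S) y * vol d y) \<in> borel_measurable borel"
      unfolding img by simp
    have "(\<lambda>y. indicator ?S y * (indicator (chart_image c) y * vol c y)) \<in> borel_measurable borel"
      using S vol_measurable[OF c] by measurable
    moreover have "indicator ?S y * (indicator (chart_image c) y * vol c y)
        = indicator ?S y * (\<bar>det (matrix ((*v) (?J y)))\<bar> * vol d (?\<tau> y))" for y
      using J[of y] inv(3)[of y] by (auto simp: indicator_def)
    ultimately show "(\<lambda>y. indicator ?S y * (\<bar>det (matrix ((*v) (?J y)))\<bar> * vol d (?\<tau> y)))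
        \<in> borel_measurable borel" by simp
  qed
  also have "\<dots> = (\<integral>\<^sup>+y\<in>?S. ennreal (vol c y) \<partial>lborel)"
    by (intro nn_integral_cong) (auto simp: J split: split_indicator)
  finally have "(\<integral>\<^sup>+y\<in>snd d ` B. ennreal (vol d y) \<partial>lborel) = (\<integral>\<^sup>+y\<in>?S. ennreal (vol c y) \<partial>lborel)"
    unfolding img .
  then show ?thesis using B by (simp add: emeasure_chart_measure c d Int_absorb2)
qed

text \<open>The condition under the \<open>THE\<close> in \<open>riemannian_measure\<close>,
  expressed through \<open>chart_measure\<close>. Existence and uniqueness are needed before
  anything can be said about that description.\<close>

definition is_riem_measure :: "'m measure \<Rightarrow> bool" where
  "is_riem_measure \<mu> \<longleftrightarrow> sets \<mu> = sets borel \<and>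
     (\<forall>c\<in>A. \<forall>B\<in>sets borel. B \<subseteq> fst c \<longrightarrow> emeasure \<mu> B = emeasure (chart_measure c) B)"

lemma is_riem_measure_unique:
  assumes "is_riem_measure \<mu>" "is_riem_measure \<nu>" shows "\<mu> = \<nu>"
proof (rule measure_eqI)
  show "sets \<mu> = sets \<nu>" using assms by (simp add: is_riem_measure_def)
  fix B assume "B \<in> sets \<mu>"
  then have B: "B \<in> sets borel" using assms by (simp add: is_riem_measure_def)
  obtain e :: "nat \<Rightarrow> ('m, 'n) chart" and P where P:
    "\<And>i. e i \<in> A" "\<And>i. P i \<subseteq> fst (e i)" "\<And>i. P i \<in> sets borel"
    "disjoint_family P" "(\<Union>i. P i) = UNIV" using chart_partition by metis
  have "emeasure \<rho> B = (\<Sum>i. emeasure (chart_measure (e i)) (B \<inter> P i))" if "is_riem_measure \<rho>" for \<rho>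
  proof -
    have sub: "B \<inter> P i \<subseteq> fst (e i)" for i using P(2) by blast
    have dj: "disjoint_family (\<lambda>i. B \<inter> P i)" using P(4) unfolding disjoint_family_on_def by blast
    have "(\<Sum>i. emeasure \<rho> (B \<inter> P i)) = emeasure \<rho> (\<Union>i. B \<inter> P i)"
      using B P that unfolding is_riem_measure_def
      by (intro suminf_emeasure dj) auto
    also have "(\<Union>i. B \<inter> P i) = B" using P(5) by blast
    finally have "emeasure \<rho> B = (\<Sum>i. emeasure \<rho> (B \<inter> P i))" by simp
    moreover have "emeasure \<rho> (B \<inter> P i) = emeasure (chart_measure (e i)) (B \<inter> P i)" for i
      using that P(1,3) B sub unfolding is_riem_measure_def by auto
    ultimately show ?thesis by simp
  qed
  then show "emeasure \<mu> B = emeasure \<nu> B" using assms by simp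
qed

text \<open>The pieces of a Borel partition are measured each in its own chart and summed. Agreement
  in an arbitrary chart is then the overlap property applied piece by piece.\<close>

lemma ex_is_riem_measure: "\<exists>\<mu>. is_riem_measure \<mu>"
proof -
  obtain e :: "nat \<Rightarrow> ('m, 'n) chart" and P where P:
    "\<And>i. e i \<in> A" "\<And>i. P i \<subseteq> fst (e i)" "\<And>i. P i \<in> sets borel"
    "disjoint_family P" "(\<Union>i. P i) = UNIV" using chart_partition by metis
  define m where "m = (\<lambda>B. \<Sum>i. emeasure (chart_measure (e i)) (B \<inter> P i))"
  define \<mu> where "\<mu> = measure_of UNIV (sets (borel :: 'm measure)) m"
  have sets: "sets \<mu> = sets borel" 
    unfolding \<mu>_def by (simp add: sets.sigma_sets_eq[of borel, simplified])
  have em: "emeasure \<mu> B = m B" if "B \<in> sets borel" for B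
  proof (rule emeasure_measure_of_sigma[of UNIV "sets borel" m B, folded \<mu>_def])
    show "sigma_algebra UNIV (sets (borel :: 'm measure))"
      using sets.sigma_algebra_axioms[of "borel :: 'm measure"] by simp
    show "positive (sets borel) m" by (simp add: positive_def m_def)
    show "countably_additive (sets borel) m"
    proof (rule countably_additiveI)
      fix S :: "nat \<Rightarrow> 'm set"
      assume S: "range S \<subseteq> sets borel" "disjoint_family S"
      have "m (\<Union>n. S n) = (\<Sum>i. \<Sum>n. emeasure (chart_measure (e i)) (S n \<inter> P i))"
        unfolding m_def
      proof (intro suminf_cong)
        fix i
        have "(\<Union>n. S n) \<inter> P i = (\<Union>n. S n \<inter> P i)" by blast
        moreover have "(\<Sum>n. emeasure (chart_measure (e i)) (S n \<inter> P i))
            = emeasure (chart_measure (e i)) (\<Union>n. S n \<inter> P i)"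
        proof (intro suminf_emeasure)
          show "range (\<lambda>n. S n \<inter> P i) \<subseteq> sets (chart_measure (e i))" using S(1) P(3) by auto
          show "disjoint_family (\<lambda>n. S n \<inter> P i)"
            using S(2) unfolding disjoint_family_on_def by blast
        qed
        ultimately show "emeasure (chart_measure (e i)) ((\<Union>n. S n) \<inter> P i)
            = (\<Sum>n. emeasure (chart_measure (e i)) (S n \<inter> P i))" by simp
      qed
      also have "\<dots> = (\<Sum>n. m (S n))" unfolding m_def
        using nn_integral_suminf[of "\<lambda>n i. emeasure (chart_measure (e i)) (S n \<inter> P i)" "count_space UNIV"]
        by (simp add: nn_integral_count_space_nat)
      finally show "(\<Sum>n. m (S n)) = m (\<Union> (range S))" by simp
    qed
  qed (use that in auto)
  have "is_riem_measure \<mu>" unfolding is_riem_measure_def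
  proof (intro conjI ballI impI sets)
    fix c and B :: "'m set" assume c: "c \<in> A" and B: "B \<in> sets borel" "B \<subseteq> fst c"
    have dj: "disjoint_family (\<lambda>i. B \<inter> P i)" using P(4) unfolding disjoint_family_on_def by blast
    have "m B = (\<Sum>i. emeasure (chart_measure c) (B \<inter> P i))" unfolding m_def
      using P B by (intro suminf_cong chart_measure_overlap c) auto
    also have "\<dots> = emeasure (chart_measure c) (\<Union>i. B \<inter> P i)"
      using P B by (intro suminf_emeasure) (use dj in auto)
    also have "(\<Union>i. B \<inter> P i) = B" using P(5) by blast
    finally show "emeasure \<mu> B = emeasure (chart_measure c) B" using em[OF B(1)] by simp
  qed
  then show ?thesis by blast
qed

lemma is_riem_measure_iff:
  "is_riem_measure \<mu> \<longleftrightarrow> sets \<mu> = sets borel \<and>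
     (\<forall>c\<in>A. \<forall>B\<in>sets borel. B \<subseteq> fst c \<longrightarrow>
        emeasure \<mu> B = (\<integral>\<^sup>+y\<in>snd c ` B. ennreal (sqrt (det (g c (chart_inv c y)))) \<partial>lborel))"
  unfolding is_riem_measure_def vol_def[symmetric]
  by (intro conj_cong refl ball_cong imp_cong) (simp add: emeasure_chart_measure Int_absorb2)

lemma riemannian_measure: "is_riem_measure (riemannian_measure A g)"
  unfolding riemannian_measure_def is_riem_measure_iff[symmetric]
  using ex_is_riem_measure is_riem_measure_unique by (metis theI)

lemma riemannian_measure_eqI: "is_riem_measure \<mu> \<Longrightarrow> riemannian_measure A g = \<mu>"
  using riemannian_measure is_riem_measure_unique by blast

lemma sets_riemannian_measure [measurable_cong, simp]: "sets (riemannian_measure A g) = sets borel"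
  using riemannian_measure by (simp add: is_riem_measure_def)

lemma space_riemannian_measure [simp]: "space (riemannian_measure A g) = UNIV"
  using sets_eq_imp_space_eq[OF sets_riemannian_measure] by simp

lemma nn_integral_riemannian_measure:
  assumes c: "c \<in> A" and F: "F \<in> borel_measurable borel"
  shows "(\<integral>\<^sup>+x\<in>fst c. F x \<partial>riemannian_measure A g)
    = (\<integral>\<^sup>+y. ennreal (indicator (chart_image c) y * vol c y) * F (chart_inv c y) \<partial>lborel)"
proof -
  have fc: "fst c \<in> sets borel" using chart(1)[OF c] by auto
  have "density (riemannian_measure A g) (indicator (fst c)) = chart_measure c"
  proof (rule measure_eqI)
    fix B assume "B \<in> sets (density (riemannian_measure A g) (indicator (fst c)))"
    then have B: "B \<in> sets borel" by simp
    have "emeasure (density (riemannian_measure A g) (indicator (fst c))) B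
      = emeasure (riemannian_measure A g) (fst c \<inter> B)"
      using B fc by (simp add: emeasure_restricted)
    also have "\<dots> = emeasure (chart_measure c) (fst c \<inter> B)"
      using riemannian_measure c B fc by (auto simp: is_riem_measure_def)
    also have "\<dots> = emeasure (chart_measure c) B"
      using B fc by (simp add: emeasure_chart_measure c Int_ac)
    finally show "emeasure (density (riemannian_measure A g) (indicator (fst c))) B
      = emeasure (chart_measure c) B" .
  qed simp
  then have "(\<integral>\<^sup>+x. F x \<partial>chart_measure c)
    = (\<integral>\<^sup>+x. indicator (fst c) x * F x \<partial>riemannian_measure A g)"
    using F fc by (metis nn_integral_density borel_measurable_indicator measurable_cong_sets
      sets_riemannian_measure)
  then show ?thesis using nn_integral_chart_measure[OF c F] by (simp add: mult.commute)
qed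

end

section \<open>Weak differentials\<close>

text \<open>Integrability on a compact box includes measurability there, and countably many boxes
  together with the complement cover the space.\<close>

lemma locally_integrable_borel_measurable:
  assumes "open U" "locally_integrable_on U F"
  shows "(\<lambda>y. indicator U y * F y) \<in> borel_measurable borel"
proof -
  obtain \<D> where \<D>: "countable \<D>" "\<And>X. X \<in> \<D> \<Longrightarrow> X \<subseteq> U" "\<And>X. X \<in> \<D> \<Longrightarrow> \<exists>a b. X = cbox a b" "\<Union>\<D> = U"
    by (rule open_countable_Union_open_cbox[OF \<open>open U\<close>]) blast
  show ?thesis
  proof (rule measurable_piecewise_restrict[where C = "insert (- U) \<D>"])
    show "countable (insert (- U) \<D>)" using \<D>(1) by simp
    show "X \<inter> space borel \<in> sets borel" if X: "X \<in> insert (- U) \<D>" for X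
    proof (cases "X = - U")
      case True
      then show ?thesis using \<open>open U\<close> by auto
    next
      case False
      then obtain a b where "X = cbox a b" using X \<D>(3) by blast
      then show ?thesis by simp
    qed
    show "space borel \<subseteq> \<Union> (insert (- U) \<D>)" using \<D>(4) by blast
    show "(\<lambda>y. indicator U y * F y) \<in> borel_measurable (restrict_space borel X)"
      if X: "X \<in> insert (- U) \<D>" for X
    proof (cases "X = - U")
      case True
      then have "(\<lambda>y. 0 :: real) \<in> borel_measurable (restrict_space borel X)" by simp
      then show ?thesis
        by (rule measurable_cong[THEN iffD1, rotated]) (simp add: True space_restrict_space)
    next
      case False
      then obtain a b where ab: "X = cbox a b" and "X \<subseteq> U" using X \<D>(2,3) by blast
      then have "set_integrable lborel X F" using assms(2) compact_cbox unfolding locally_integrable_on_def by blast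
      then have m: "(\<lambda>y. indicator X y *\<^sub>R F y) \<in> borel_measurable borel"
        unfolding set_integrable_def using borel_measurable_integrable by fastforce
      have eq: "(\<lambda>y. indicator X y *\<^sub>R F y) = (\<lambda>y. indicator X y *\<^sub>R (indicator U y * F y))"
        using \<open>X \<subseteq> U\<close> by (auto simp: fun_eq_iff indicator_def)
      show ?thesis
        by (rule borel_measurable_restrict_space_iff[THEN iffD2])
           (use m[unfolded eq] ab in simp_all)
    qed
  qed
qed

lemma locally_integrable_on_const: "locally_integrable_on U (\<lambda>y. k)"
  unfolding locally_integrable_on_def set_integrable_def
  by (intro allI impI borel_integrable_compact) (auto intro: continuous_intros)

lemma locally_integrable_on_add:
  "locally_integrable_on U F \<Longrightarrow> locally_integrable_on U G \<Longrightarrow> locally_integrable_on U (\<lambda>y. F y + G y)"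
  unfolding locally_integrable_on_def by (auto intro: set_integral_add)

lemma locally_integrable_on_diff:
  "locally_integrable_on U F \<Longrightarrow> locally_integrable_on U G \<Longrightarrow> locally_integrable_on U (\<lambda>y. F y - G y)"
  unfolding locally_integrable_on_def by (auto intro: set_integral_diff)

lemma integrable_locally_integrable_mult:
  assumes U: "open U" and F: "locally_integrable_on U F" and K: "compact K" "K \<subseteq> U"
    and G: "continuous_on UNIV G" "\<And>y. y \<notin> K \<Longrightarrow> G y = 0"
  shows "set_integrable lborel U (\<lambda>y. F y * G y)"
proof -
  have "bounded (G ` K)"
    using G(1) K(1) by (intro compact_imp_bounded compact_continuous_image) (auto intro: continuous_on_subset)
  then obtain B where B: "\<And>y. y \<in> K \<Longrightarrow> \<bar>G y\<bar> \<le> B" by (auto simp: bounded_iff)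
  have int: "integrable lborel (\<lambda>y. indicator K y *\<^sub>R F y)"
    using F K unfolding locally_integrable_on_def set_integrable_def by blast
  have "integrable lborel (\<lambda>y. (indicator K y *\<^sub>R F y) * G y)"
  proof (rule Bochner_Integration.integrable_bound)
    show "integrable lborel (\<lambda>y. B * \<bar>indicator K y *\<^sub>R F y\<bar>)" using int by (intro integrable_mult_right integrable_abs)
    show "(\<lambda>y. (indicator K y *\<^sub>R F y) * G y) \<in> borel_measurable lborel"
      using borel_measurable_integrable[OF int] borel_measurable_continuous_onI[OF G(1)] by measurable
    show "AE y in lborel. norm (indicator K y *\<^sub>R F y * G y) \<le> norm (B * \<bar>indicator K y *\<^sub>R F y\<bar>)"
    proof (intro AE_I2)
      fix y
      show "norm (indicator K y *\<^sub>R F y * G y) \<le> norm (B * \<bar>indicator K y *\<^sub>R F y\<bar>)"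
      proof (cases "y \<in> K")
        case True
        have "\<bar>F y\<bar> * \<bar>G y\<bar> \<le> \<bar>F y\<bar> * \<bar>B\<bar>" using B[OF True] by (intro mult_left_mono) auto
        then show ?thesis using True by (simp add: abs_mult mult.commute)
      qed simp
    qed
  qed
  moreover have eq: "(\<lambda>y. (indicator K y *\<^sub>R F y) * G y) = (\<lambda>y. indicator U y *\<^sub>R (F y * G y))"
  proof
    show "(indicator K y *\<^sub>R F y) * G y = indicator U y *\<^sub>R (F y * G y)" for y
      using G(2)[of y] K(2) by (auto simp: indicator_def)
  qed
  ultimately show ?thesis by (simp only: set_integrable_def)
qed

lemma test_function_partial_deriv:
  assumes "test_function_on U \<eta>"
  obtains K where "compact K" "K \<subseteq> U" "\<And>y. y \<notin> K \<Longrightarrow> \<eta> y = 0" "\<And>i y. y \<notin> K \<Longrightarrow> partial_deriv i \<eta> y = 0"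
    "\<And>i. continuous_on UNIV (partial_deriv i \<eta>)"
    "\<And>y. (\<eta> has_derivative frechet_derivative \<eta> (at y)) (at y)" "continuous_on UNIV \<eta>"
proof
  let ?K = "closure {y. \<eta> y \<noteq> 0}"
  show "compact ?K" "?K \<subseteq> U" using assms by (auto simp: test_function_on_def)
  show z: "\<eta> y = 0" if "y \<notin> ?K" for y using that closure_subset[of "{y. \<eta> y \<noteq> 0}"] by auto
  have C1: "Ck_on (Suc 0) UNIV \<eta>" using assms unfolding test_function_on_def smooth_on_def by blast
  then show D: "(\<eta> has_derivative frechet_derivative \<eta> (at y)) (at y)" for y
    by (simp add: differentiable_on_def frechet_derivative_works)
  show "continuous_on UNIV (partial_deriv i \<eta>)" for i
    using C1 by (simp add: partial_deriv_def[abs_def])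
  show "continuous_on UNIV \<eta>" using Ck_on_continuous[OF C1] .
  show "partial_deriv i \<eta> y = 0" if "y \<notin> ?K" for i y
  proof -
    have "(\<eta> has_derivative (\<lambda>v. 0)) (at y)"
    proof (rule has_derivative_transform_within_open[OF has_derivative_const])
      show "open (- ?K)" by (simp add: open_Compl)
      show "y \<in> - ?K" using that by simp
      show "\<And>x. x \<in> - ?K \<Longrightarrow> 0 = \<eta> x" by (rule sym, rule z) simp
    qed
    from frechet_derivative_at[OF this, symmetric] show ?thesis by (simp add: partial_deriv_def)
  qed
qed

lemma integral_partial_deriv_test_function:
  assumes "open U" "test_function_on U \<eta>"
  shows "(LINT y:U|lborel. partial_deriv i \<eta> y) = 0"
proof -
  obtain K where K: "compact K" "K \<subseteq> U" "\<And>y. y \<notin> K \<Longrightarrow> \<eta> y = 0" "\<And>i y. y \<notin> K \<Longrightarrow> partial_deriv i \<eta> y = 0"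
    "\<And>i. continuous_on UNIV (partial_deriv i \<eta>)"
    "\<And>y. (\<eta> has_derivative frechet_derivative \<eta> (at y)) (at y)" "continuous_on UNIV \<eta>"
    by (rule test_function_partial_deriv[OF assms(2)]) blast
  have "bounded (partial_deriv i \<eta> ` K)"
    using K(1,5) by (intro compact_imp_bounded compact_continuous_image) (auto intro: continuous_on_subset)
  then obtain B where B: "\<And>y. y \<in> K \<Longrightarrow> \<bar>partial_deriv i \<eta> y\<bar> \<le> B" by (auto simp: bounded_iff)
  have B': "\<bar>partial_deriv i \<eta> y\<bar> \<le> max B 0" for y
    using B[of y] K(4)[of y i] by (cases "y \<in> K") auto
  have "(LINT y|lborel. frechet_derivative \<eta> (at y) (axis i 1)) = 0"
    by (rule integral_derivative_compact_support[OF K(6) _ K(1,3)])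
       (use B' in \<open>auto simp: partial_deriv_def\<close>)
  moreover have "indicator U y *\<^sub>R partial_deriv i \<eta> y = frechet_derivative \<eta> (at y) (axis i 1)" for y
    using K(2) K(4)[of y i] by (auto simp: indicator_def partial_deriv_def)
  ultimately show ?thesis by (simp add: set_lebesgue_integral_def)
qed

context closed_mfd
begin

lemma weak_differential_add_const:
  assumes "weak_differential A f \<xi>" shows "weak_differential A (\<lambda>x. f x + k) \<xi>"
  unfolding weak_differential_def
proof (intro conjI ballI allI impI)
  show "covector_field A \<xi>" using assms by (simp add: weak_differential_def)
next
  fix c assume c: "c \<in> A"
  let ?U = "chart_image c"
  have U: "open ?U" using chart(2)[OF c] .
  have f: "locally_integrable_on ?U (\<lambda>y. f (chart_inv c y))"
    using assms c by (simp add: weak_differential_def)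
  then show "locally_integrable_on ?U (\<lambda>y. f (chart_inv c y) + k)"
    by (intro locally_integrable_on_add locally_integrable_on_const)
  show "locally_integrable_on ?U (\<lambda>y. \<xi> c (chart_inv c y) $ i)" for i
    using assms c by (simp add: weak_differential_def)
  fix i \<eta> assume \<eta>: "test_function_on ?U \<eta>"
  obtain K where K: "compact K" "K \<subseteq> ?U" "\<And>y. y \<notin> K \<Longrightarrow> \<eta> y = 0" "\<And>i y. y \<notin> K \<Longrightarrow> partial_deriv i \<eta> y = 0"
    "\<And>i. continuous_on UNIV (partial_deriv i \<eta>)"
    by (rule test_function_partial_deriv[OF \<eta>]) blast
  note int = integrable_locally_integrable_mult[OF U _ K(1,2,5,4)]
  have "(LINT y:?U|lborel. (f (chart_inv c y) + k) * partial_deriv i \<eta> y)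
    = (LINT y:?U|lborel. f (chart_inv c y) * partial_deriv i \<eta> y) + (LINT y:?U|lborel. k * partial_deriv i \<eta> y)"
    unfolding distrib_right by (intro set_integral_add int f locally_integrable_on_const)
  also have "(LINT y:?U|lborel. k * partial_deriv i \<eta> y) = 0"
    using integral_partial_deriv_test_function[OF U \<eta>] by simp
  also have "(LINT y:?U|lborel. f (chart_inv c y) * partial_deriv i \<eta> y)
    = - (LINT y:?U|lborel. \<xi> c (chart_inv c y) $ i * \<eta> y)"
    using assms c \<eta> by (simp add: weak_differential_def)
  finally show "(LINT y:?U|lborel. (f (chart_inv c y) + k) * partial_deriv i \<eta> y)
    = - (LINT y:?U|lborel. \<xi> c (chart_inv c y) $ i * \<eta> y)" by simp
qed

text \<open>As predicates the two sides are equal, so the differentials selected by \<open>SOME\<close>, and with them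
  the gradients, are literally the same.\<close>

lemma weak_differential_add_const_eq: "weak_differential A (\<lambda>x. f x + k) = weak_differential A f"
proof
  fix \<xi>
  show "weak_differential A (\<lambda>x. f x + k) \<xi> = weak_differential A f \<xi>"
    using weak_differential_add_const[of f \<xi> k] weak_differential_add_const[of "\<lambda>x. f x + k" \<xi> "- k"]
    by auto
qed

lemma gradient_add_const: "gradient A g (\<lambda>x. f x + k) = gradient A g f"
  unfolding gradient_def[abs_def] weak_differential_add_const_eq ..

lemma weak_differential_unique:
  assumes "weak_differential A f \<xi>" "weak_differential A f \<zeta>" and c: "c \<in> A"
  shows "AE y in lborel. y \<in> chart_image c \<longrightarrow> \<xi> c (chart_inv c y) = \<zeta> c (chart_inv c y)"
proof -
  let ?U = "chart_image c"
  have U: "open ?U" using chart(2)[OF c] .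
  have "AE y in lborel. y \<in> ?U \<longrightarrow> \<xi> c (chart_inv c y) $ i - \<zeta> c (chart_inv c y) $ i = 0" for i
  proof (rule fundamental_lemma_calculus_of_variations[OF U])
    have li: "locally_integrable_on ?U (\<lambda>y. \<xi> c (chart_inv c y) $ i)"
      "locally_integrable_on ?U (\<lambda>y. \<zeta> c (chart_inv c y) $ i)"
      using assms by (auto simp: weak_differential_def)
    then show "locally_integrable_on ?U (\<lambda>y. \<xi> c (chart_inv c y) $ i - \<zeta> c (chart_inv c y) $ i)"
      by (rule locally_integrable_on_diff)
    fix \<eta> assume \<eta>: "test_function_on ?U \<eta>"
    obtain K where K: "compact K" "K \<subseteq> ?U" "\<And>y. y \<notin> K \<Longrightarrow> \<eta> y = 0" "continuous_on UNIV \<eta>"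
      by (rule test_function_partial_deriv[OF \<eta>]) blast
    have "(LINT y:?U|lborel. (\<xi> c (chart_inv c y) $ i - \<zeta> c (chart_inv c y) $ i) * \<eta> y)
      = (LINT y:?U|lborel. \<xi> c (chart_inv c y) $ i * \<eta> y) - (LINT y:?U|lborel. \<zeta> c (chart_inv c y) $ i * \<eta> y)"
      unfolding left_diff_distrib
      by (intro set_integral_diff integrable_locally_integrable_mult[OF U _ K(1,2,4,3)] li)
    also have "\<dots> = 0"
    proof -
      have "(LINT y:?U|lborel. f (chart_inv c y) * partial_deriv i \<eta> y)
        = - (LINT y:?U|lborel. \<xi> c (chart_inv c y) $ i * \<eta> y)"
        "(LINT y:?U|lborel. f (chart_inv c y) * partial_deriv i \<eta> y)
        = - (LINT y:?U|lborel. \<zeta> c (chart_inv c y) $ i * \<eta> y)"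
        using assms \<eta> by (auto simp: weak_differential_def)
      then show ?thesis by simp
    qed
    finally show "(LINT y:?U|lborel. (\<xi> c (chart_inv c y) $ i - \<zeta> c (chart_inv c y) $ i) * \<eta> y) = 0" .
  qed
  then have "AE y in lborel. \<forall>i\<in>UNIV. y \<in> ?U \<longrightarrow> \<xi> c (chart_inv c y) $ i - \<zeta> c (chart_inv c y) $ i = 0"
    by (intro AE_finite_allI) auto
  then show ?thesis by eventually_elim (auto simp: vec_eq_iff)
qed

lemma continuous_on_manifoldI:
  fixes F :: "'m \<Rightarrow> 'b::topological_space"
  assumes "\<And>c. c \<in> A \<Longrightarrow> continuous_on (chart_image c) (\<lambda>y. F (chart_inv c y))"
  shows "continuous_on UNIV F"
proof -
  have "continuous_on (fst c) F" if c: "c \<in> A" for c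
  proof -
    have "continuous_on (fst c) (\<lambda>x. F (chart_inv c (snd c x)))"
      by (rule continuous_on_compose2[OF assms[OF c] chart(3)[OF c]]) (use chart(6)[OF c] in auto)
    then show ?thesis by (rule continuous_on_eq) (simp add: chart(5)[OF c])
  qed
  then have "continuous_on (\<Union>c\<in>A. fst c) F" using chart(1) by (intro continuous_on_open_UN) auto
  moreover have "(\<Union>c\<in>A. fst c) = UNIV" using smooth_atlas by (simp add: smooth_atlas_def)
  ultimately show ?thesis by simp
qed

lemma borel_measurable_manifoldI:
  fixes F :: "'m \<Rightarrow> real"
  assumes "\<And>c. c \<in> A \<Longrightarrow> (\<lambda>y. indicator (chart_image c) y * F (chart_inv c y)) \<in> borel_measurable borel"
  shows "F \<in> borel_measurable borel"
proof -
  obtain C where C: "finite C" "C \<subseteq> A" "C \<noteq> {}" "(\<Union>c\<in>C. fst c) = UNIV"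
    using finite_chart_cover by metis
  show ?thesis
  proof (rule measurable_piecewise_restrict[where C = "fst ` C"])
    show "countable (fst ` C)" using C(1) by (intro countable_finite finite_imageI)
    show "X \<inter> space borel \<in> sets borel" if "X \<in> fst ` C" for X using that C(2) chart(1) by auto
    show "space borel \<subseteq> \<Union> (fst ` C)" using C(4) by simp
    fix X assume "X \<in> fst ` C"
    then obtain c where c: "c \<in> A" "X = fst c" using C(2) by auto
    have "snd c \<in> borel_measurable (restrict_space borel X)"
      unfolding c(2) by (rule borel_measurable_continuous_on_restrict[OF chart(3)[OF c(1)]])
    from measurable_compose[OF this assms[OF c(1)]]
    show "F \<in> borel_measurable (restrict_space borel X)"
      by (rule measurable_cong[THEN iffD1, rotated])
         (use chart[OF c(1)] in \<open>auto simp: space_restrict_space c(2)\<close>)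
  qed
qed

end

section \<open>Measurability, null sets and finiteness for the Riemannian measure\<close>

context riem_metric
begin

lemma continuous_metric_inv:
  "c \<in> A \<Longrightarrow> continuous_on (chart_image c) (\<lambda>y. matrix_inv (g c (chart_inv c y)))"
  by (intro continuous_on_matrix_inv metric_continuous invertible_metric chart(8))

lemma continuous_on_metric_trace:
  assumes "symmetric_tensor2 A \<omega>" "\<And>c. c \<in> A \<Longrightarrow> continuous_on (chart_image c) (\<lambda>y. \<omega> c (chart_inv c y))"
  shows "continuous_on UNIV (metric_trace A g \<omega>)"
proof (rule continuous_on_manifoldI)
  fix c assume c: "c \<in> A"
  have "continuous_on (chart_image c) (\<lambda>y. \<Sum>i\<in>UNIV. \<Sum>j\<in>UNIV.
      matrix_inv (g c (chart_inv c y)) $ i $ j * \<omega> c (chart_inv c y) $ i $ j)"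
    by (intro continuous_intros continuous_metric_inv assms c)
  then show "continuous_on (chart_image c) (\<lambda>y. metric_trace A g \<omega> (chart_inv c y))"
    by (rule continuous_on_eq) (simp add: metric_trace_eq[OF assms(1) c] chart(8)[OF c])
qed

lemma energy_measurable:
  assumes "weak_differential A f \<xi>" shows "energy \<xi> \<in> borel_measurable borel"
proof (rule borel_measurable_manifoldI)
  fix c assume c: "c \<in> A"
  let ?U = "chart_image c"
  have cov: "covector_field A \<xi>" using assms by (simp add: weak_differential_def)
  have U: "open ?U" using chart(2)[OF c] .
  have m1: "(\<lambda>y. indicator ?U y * \<xi> c (chart_inv c y) $ i) \<in> borel_measurable borel" for i
    using assms c U by (intro locally_integrable_borel_measurable) (auto simp: weak_differential_def)
  have m2: "(\<lambda>y. indicator ?U y * matrix_inv (g c (chart_inv c y)) $ i $ j) \<in> borel_measurable borel" for i j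
  proof -
    have "continuous_on ?U (\<lambda>y. matrix_inv (g c (chart_inv c y)) $ i $ j)"
      by (intro continuous_intros continuous_metric_inv c)
    with borel_measurable_continuous_on_indicator[OF _ this] U show ?thesis by simp
  qed
  have "(\<lambda>y. \<Sum>i\<in>UNIV. \<Sum>j\<in>UNIV. (indicator ?U y * matrix_inv (g c (chart_inv c y)) $ i $ j) *
      (indicator ?U y * \<xi> c (chart_inv c y) $ i) * (indicator ?U y * \<xi> c (chart_inv c y) $ j))
      \<in> borel_measurable borel"
    using m1 m2 by measurable
  moreover have "(\<Sum>i\<in>UNIV. \<Sum>j\<in>UNIV. (indicator ?U y * matrix_inv (g c (chart_inv c y)) $ i $ j) *
      (indicator ?U y * \<xi> c (chart_inv c y) $ i) * (indicator ?U y * \<xi> c (chart_inv c y) $ j))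
      = indicator ?U y * energy \<xi> (chart_inv c y)" for y
    by (cases "y \<in> ?U") (simp_all add: energy_eq[OF cov c chart(8)[OF c]] quadratic_form_eq_inner)
  ultimately show "(\<lambda>y. indicator ?U y * energy \<xi> (chart_inv c y)) \<in> borel_measurable borel"
    by simp
qed

text \<open>In each chart the exceptional set is enclosed in a Borel null set \<open>N\<close>,
  whose preimage has measure 0 because the measure has a density there; finitely many charts
  suffice.\<close>

lemma AE_riemannian_measureI:
  assumes Q: "\<And>c. c \<in> A \<Longrightarrow> AE y in lborel. y \<in> chart_image c \<longrightarrow> Q (chart_inv c y)"
  shows "AE x in riemannian_measure A g. Q x"
proof -
  obtain C where C: "finite C" "C \<subseteq> A" "C \<noteq> {}" "(\<Union>c\<in>C. fst c) = UNIV"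
    using finite_chart_cover by metis
  have "AE x in riemannian_measure A g. x \<in> fst c \<longrightarrow> Q x" if c: "c \<in> A" for c
  proof -
    obtain N where N: "N \<in> null_sets lborel" "{y. \<not> (y \<in> chart_image c \<longrightarrow> Q (chart_inv c y))} \<subseteq> N"
      using AE_E[OF Q[OF c]] by (auto simp: null_sets_def)
    define B where "B = {x \<in> fst c. snd c x \<in> N}"
    have "snd c \<in> borel_measurable (restrict_space borel (fst c))"
      by (rule borel_measurable_continuous_on_restrict[OF chart(3)[OF c]])
    from measurable_sets[OF this, of N] have "snd c -` N \<inter> fst c \<in> sets (restrict_space borel (fst c))"
      using N(1) by (auto simp: null_sets_def space_restrict_space)
    then have B: "B \<in> sets borel" "B \<subseteq> fst c"
      using chart(1)[OF c] by (auto simp: B_def sets_restrict_space_iff vimage_def Int_def conj_commute)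
    have "emeasure (riemannian_measure A g) B = (\<integral>\<^sup>+y\<in>snd c ` B. ennreal (vol c y) \<partial>lborel)"
      using riemannian_measure c B by (simp add: is_riem_measure_def emeasure_chart_measure Int_absorb2)
    also have "\<dots> = (\<integral>\<^sup>+y. 0 \<partial>(lborel :: (real ^ 'n::_) measure))"
      using AE_not_in[OF N(1)]
      by (intro nn_integral_cong_AE) (auto elim!: eventually_mono simp: B_def indicator_def)
    finally have "B \<in> null_sets (riemannian_measure A g)" using B by (simp add: null_sets_def)
    from AE_not_in[OF this] show ?thesis
    proof eventually_elim
      case (elim x)
      show ?case
      proof
        assume x: "x \<in> fst c"
        then have "snd c x \<in> chart_image c" "snd c x \<notin> N" using elim chart(6)[OF c] by (auto simp: B_def)
        then have "Q (chart_inv c (snd c x))" using N(2) by blast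
        then show "Q x" by (simp add: chart(5)[OF c x])
      qed
    qed
  qed
  then have "AE x in riemannian_measure A g. \<forall>c\<in>C. x \<in> fst c \<longrightarrow> Q x"
    using C(1,2) by (intro AE_finite_allI) auto
  then show ?thesis using C(4) by (auto elim!: eventually_mono)
qed

text \<open>This permits any convenient weak differential to stand in for the one selected in
  \<open>gradient\<close>, at the cost of a null set.\<close>

lemma energy_AE_unique:
  assumes "weak_differential A f \<xi>" "weak_differential A f \<zeta>"
  shows "AE x in riemannian_measure A g. energy \<xi> x = energy \<zeta> x"
proof (rule AE_riemannian_measureI)
  fix c assume c: "c \<in> A"
  have "covector_field A \<xi>" "covector_field A \<zeta>" using assms by (auto simp: weak_differential_def)
  with weak_differential_unique[OF assms c]
  show "AE y in lborel. y \<in> chart_image c \<longrightarrow> energy \<xi> (chart_inv c y) = energy \<zeta> (chart_inv c y)"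
    by (auto elim!: eventually_mono simp: energy_eq[OF _ c chart(8)[OF c]])
qed

text \<open>The density is bounded on a closed coordinate ball, which gives local finiteness;
  compactness does the rest.\<close>

lemma finite_measure_riemannian: "finite_measure (riemannian_measure A g)"
proof
  have "\<exists>U. open U \<and> x \<in> U \<and> emeasure (riemannian_measure A g) U < \<infinity>" for x
  proof -
    define c where "c = chart_at A x"
    have c: "c \<in> A" "x \<in> fst c" by (simp_all add: c_def chart_at)
    obtain r where r: "0 < r" "cball (snd c x) r \<subseteq> chart_image c"
      using open_contains_cball[of "chart_image c"] chart(2,6)[OF c(1)] c(2) by blast
    define U where "U = fst c \<inter> snd c -` ball (snd c x) r"
    have U: "open U" unfolding U_def
      using continuous_open_preimage[OF chart(3)[OF c(1)] chart(1)[OF c(1)]] by simp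
    have sub: "snd c ` U \<subseteq> cball (snd c x) r" by (auto simp: U_def)
    have "continuous_on (cball (snd c x) r) (vol c)"
      unfolding vol_def
      using continuous_on_subset[OF metric_continuous[OF c(1)] r(2)]
      by (intro continuous_on_real_sqrt continuous_on_det)
    then have "integrable lborel (\<lambda>y. indicator (cball (snd c x) r) y *\<^sub>R vol c y)"
      by (intro borel_integrable_compact) auto
    then have "(\<integral>\<^sup>+y. ennreal (norm (indicator (cball (snd c x) r) y *\<^sub>R vol c y)) \<partial>lborel) < \<infinity>"
      by (simp add: integrable_iff_bounded)
    moreover have "emeasure (riemannian_measure A g) U
      \<le> (\<integral>\<^sup>+y. ennreal (norm (indicator (cball (snd c x) r) y *\<^sub>R vol c y)) \<partial>lborel)"
    proof -
      have "emeasure (riemannian_measure A g) U = (\<integral>\<^sup>+y\<in>snd c ` U. ennreal (vol c y) \<partial>lborel)"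
        using riemannian_measure c U
        by (simp add: is_riem_measure_def emeasure_chart_measure Int_absorb2 U_def)
      also have "\<dots> \<le> (\<integral>\<^sup>+y. ennreal (norm (indicator (cball (snd c x) r) y *\<^sub>R vol c y)) \<partial>lborel)"
        using sub by (intro nn_integral_mono) (auto simp: indicator_def ennreal_leI)
      finally show ?thesis .
    qed
    ultimately have "emeasure (riemannian_measure A g) U < \<infinity>" by (rule le_less_trans[rotated])
    moreover have "x \<in> U" using c r by (simp add: U_def)
    ultimately show ?thesis using U by blast
  qed
  then obtain U where U: "\<And>x. open (U x)" "\<And>x. x \<in> U x" "\<And>x. emeasure (riemannian_measure A g) (U x) < \<infinity>"
    by metis
  have "UNIV \<subseteq> (\<Union>x\<in>UNIV. U x)" using U(2) by blast
  then obtain X where X: "finite X" "UNIV \<subseteq> (\<Union>x\<in>X. U x)"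
    using compactE_image[OF compact_UNIV, of UNIV U] U(1) by metis
  have "emeasure (riemannian_measure A g) (\<Union>x\<in>X. U x) \<le> (\<Sum>x\<in>X. emeasure (riemannian_measure A g) (U x))"
    using U(1) X(1) by (intro emeasure_subadditive_finite) auto
  also have "\<dots> < \<infinity>" using U(3) X(1) by simp
  also have "(\<Union>x\<in>X. U x) = UNIV" using X(2) by blast
  finally show "emeasure (riemannian_measure A g) (space (riemannian_measure A g)) \<noteq> \<infinity>" by simp
qed

text \<open>In a chart the density is positive and a nonempty open set is not negligible. This later
  prevents a nonconstant continuous function from being constant almost everywhere.\<close>

lemma emeasure_open_pos:
  assumes "open U" "U \<noteq> {}" shows "0 < emeasure (riemannian_measure A g) U"
proof (rule ccontr)
  assume "\<not> ?thesis"
  then have 0: "emeasure (riemannian_measure A g) U = 0" by simp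
  obtain x where x: "x \<in> U" using assms(2) by blast
  define c where "c = chart_at A x"
  have c: "c \<in> A" "x \<in> fst c" by (simp_all add: c_def chart_at)
  let ?B = "fst c \<inter> U"
  have B: "?B \<in> sets borel" using assms(1) chart(1)[OF c(1)] by auto
  have oS: "open (snd c ` ?B)" using open_chart_preimage[OF c(1) assms(1)] .
  have "emeasure (riemannian_measure A g) ?B \<le> emeasure (riemannian_measure A g) U"
    using assms(1) by (intro emeasure_mono) auto
  then have "(\<integral>\<^sup>+y\<in>snd c ` ?B. ennreal (vol c y) \<partial>lborel) = 0"
    using riemannian_measure c B 0 by (auto simp: is_riem_measure_def emeasure_chart_measure Int_absorb2 Int_commute)
  moreover have eq: "(\<lambda>y. ennreal (vol c y) * indicator (snd c ` ?B) y)
      = (\<lambda>y. ennreal (indicator (chart_image c) y * vol c y) * indicator (snd c ` ?B) y)"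
    using chart(6)[OF c(1)] by (auto simp: fun_eq_iff indicator_def)
  have m: "(\<lambda>y. ennreal (indicator (chart_image c) y * vol c y) * indicator (snd c ` ?B) y)
      \<in> borel_measurable lborel"
    using vol_measurable[OF c(1)] borel_open[OF oS] by measurable
  ultimately have "(\<integral>\<^sup>+y. ennreal (indicator (chart_image c) y * vol c y) * indicator (snd c ` ?B) y \<partial>lborel) = 0"
    by (simp only: eq)
  then have "AE y in lborel. ennreal (indicator (chart_image c) y * vol c y) * indicator (snd c ` ?B) y = 0"
    using nn_integral_0_iff_AE[OF m] by blast
  then have "AE y in lborel. y \<notin> snd c ` ?B"
  proof eventually_elim
    case (elim y)
    show ?case
    proof
      assume y: "y \<in> snd c ` ?B"
      then have "y \<in> chart_image c" using chart(6)[OF c(1)] by auto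
      with vol_pos[OF c(1) this] elim y show False by simp
    qed
  qed
  then have "snd c ` ?B \<in> null_sets lborel"
    using oS by (subst (asm) AE_iff_null_sets[symmetric]) auto
  then have "negligible (snd c ` ?B)"
    by (simp add: negligible_iff_null_sets null_sets_completionI)
  then show False using open_not_negligible[OF oS] x c by blast
qed

end

section \<open>Relative density of two metrics\<close>

locale two_riem_metrics = g1: riem_metric A g1 + g2: riem_metric A g2
  for A :: "('m::{t2_space, second_countable_topology}, 'n::{finite, wellorder}) chart set"
    and g1 g2 :: "('m, 'n) tensor2"
begin

definition vol_ratio :: "'m \<Rightarrow> real" where
  "vol_ratio x = (let c = chart_at A x in sqrt (det (g2 c x)) / sqrt (det (g1 c x)))"

text \<open>A change of chart multiplies both densities by the same nonzero Jacobian, which cancels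
  in the quotient.\<close>

lemma vol_ratio_eq:
  assumes c: "c \<in> A" "x \<in> fst c" shows "vol_ratio x = sqrt (det (g2 c x)) / sqrt (det (g1 c x))"
proof -
  define d where "d = chart_at A x"
  have d: "d \<in> A" "x \<in> fst d" by (simp_all add: d_def g1.chart_at)
  have "det (transition_jacobian c d x) \<noteq> 0"
    using g1.det_metric_transform[OF c(1) d(1) c(2) d(2)] posdef_det_pos[OF g1.posdef_metric[OF c]] by auto
  then show ?thesis
    unfolding vol_ratio_def d_def[symmetric] Let_def
    using g1.det_metric_transform[OF c(1) d(1) c(2) d(2)] g2.det_metric_transform[OF c(1) d(1) c(2) d(2)]
    by simp
qed

lemma continuous_on_vol_ratio: "continuous_on UNIV vol_ratio"
proof (rule g1.continuous_on_manifoldI)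
  fix c assume c: "c \<in> A"
  have "continuous_on (chart_image c)
      (\<lambda>y. sqrt (det (g2 c (chart_inv c y))) / sqrt (det (g1 c (chart_inv c y))))"
    using posdef_det_pos[OF g1.posdef_metric[OF c g1.chart(8)[OF c]]]
    by (intro continuous_intros continuous_on_det g1.metric_continuous g2.metric_continuous c) force
  then show "continuous_on (chart_image c) (\<lambda>y. vol_ratio (chart_inv c y))"
    by (rule continuous_on_eq) (simp add: vol_ratio_eq[OF c] g1.chart(8)[OF c])
qed

lemma riemannian_measure_density:
  "riemannian_measure A g2 = density (riemannian_measure A g1) (\<lambda>x. ennreal (vol_ratio x))"
proof (rule g2.riemannian_measure_eqI, unfold g2.is_riem_measure_def, intro conjI ballI impI)
  have [measurable]: "vol_ratio \<in> borel_measurable borel"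
    by (rule borel_measurable_continuous_onI[OF continuous_on_vol_ratio])
  then have m: "(\<lambda>x. ennreal (vol_ratio x)) \<in> borel_measurable (riemannian_measure A g1)" by measurable
  fix c and B :: "'m set" assume c: "c \<in> A" and B: "B \<in> sets borel" "B \<subseteq> fst c"
  note [measurable] = B(1)
  have "emeasure (density (riemannian_measure A g1) (\<lambda>x. ennreal (vol_ratio x))) B
    = (\<integral>\<^sup>+x\<in>fst c. ennreal (vol_ratio x) * indicator B x \<partial>riemannian_measure A g1)"
    using m B by (subst emeasure_density) (auto intro!: nn_integral_cong simp: indicator_def)
  also have "\<dots> = (\<integral>\<^sup>+y. ennreal (indicator (chart_image c) y * g1.vol c y) *
      (ennreal (vol_ratio (chart_inv c y)) * indicator B (chart_inv c y)) \<partial>lborel)"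
    by (intro g1.nn_integral_riemannian_measure c) measurable
  also have "\<dots> = (\<integral>\<^sup>+y. ennreal (indicator (chart_image c) y * g2.vol c y) * indicator B (chart_inv c y) \<partial>lborel)"
  proof (intro nn_integral_cong)
    fix y
    show "ennreal (indicator (chart_image c) y * g1.vol c y) *
        (ennreal (vol_ratio (chart_inv c y)) * indicator B (chart_inv c y))
      = ennreal (indicator (chart_image c) y * g2.vol c y) * indicator B (chart_inv c y)"
    proof (cases "y \<in> chart_image c")
      case True
      have "g1.vol c y * vol_ratio (chart_inv c y) = g2.vol c y"
        using g1.vol_pos[OF c True] unfolding vol_ratio_eq[OF c g1.chart(8)[OF c True]]
        by (simp add: g1.vol_def g2.vol_def)
      moreover have "0 \<le> g1.vol c y" using g1.vol_pos[OF c True] by simp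
      ultimately show ?thesis using True by (simp add: mult.assoc[symmetric] ennreal_mult'[symmetric])
    qed simp
  qed
  also have "\<dots> = (\<integral>\<^sup>+x. indicator B x \<partial>g2.chart_measure c)"
    by (intro g2.nn_integral_chart_measure[symmetric] c) measurable
  also have "\<dots> = emeasure (g2.chart_measure c) B" using B by simp
  finally show "emeasure (density (riemannian_measure A g1) (\<lambda>x. ennreal (vol_ratio x))) B
    = emeasure (g2.chart_measure c) B" .
qed simp

end

section \<open>Power inequalities\<close>

text \<open>The odd power of exponent p - 1. Up to the factor \<open>p\<close> it is the derivative
  of |a|^p, and it is the integrand of the constraint in the eigenvalue problem.\<close>

definition spow :: "real \<Rightarrow> real \<Rightarrow> real" where
  "spow p a = \<bar>a\<bar> powr (p - 2) * a"

lemma abs_spow: "\<bar>spow p a\<bar> = \<bar>a\<bar> powr (p - 1)"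
proof (cases "a = 0")
  case False
  have "\<bar>a\<bar> powr (p - 2) * \<bar>a\<bar> powr 1 = \<bar>a\<bar> powr (p - 1)"
    by (simp only: powr_add[symmetric]) simp
  then show ?thesis using False by (simp add: spow_def abs_mult)
qed (simp add: spow_def)

lemma spow_self: "spow p a * a = \<bar>a\<bar> powr p"
proof (cases "a = 0")
  case False
  have "\<bar>a\<bar> powr (p - 2) * \<bar>a\<bar> powr 2 = \<bar>a\<bar> powr p"
    by (simp only: powr_add[symmetric]) simp
  then show ?thesis using False by (simp add: spow_def power2_eq_square powr_numeral mult.assoc abs_mult[symmetric])
qed (simp add: spow_def)

lemma spow_eq_sgn: "spow p a = sgn a * \<bar>a\<bar> powr (p - 1)"
proof -
  have "spow p a = sgn a * \<bar>spow p a\<bar>" by (simp add: spow_def abs_mult sgn_if)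
  then show ?thesis by (simp only: abs_spow)
qed

lemma spow_minus: "spow p (- a) = - spow p a"
  by (simp add: spow_def)

lemma spow_mono:
  assumes "1 < p" "a \<le> b" shows "spow p a \<le> spow p b"
proof -
  consider "0 \<le> a" | "a < 0" "0 \<le> b" | "b < 0" by linarith
  then show ?thesis
  proof cases
    case 1
    then show ?thesis using assms powr_mono2[of "p - 1" a b]
      by (cases "a = 0"; cases "b = 0") (auto simp: spow_eq_sgn)
  next
    case 2
    then have "spow p a \<le> 0" "0 \<le> spow p b" by (auto simp: spow_eq_sgn sgn_if)
    then show ?thesis by linarith
  next
    case 3
    then show ?thesis using assms powr_mono2[of "p - 1" "- b" "- a"] by (auto simp: spow_eq_sgn)
  qed
qed

lemma isCont_spow: assumes "2 < p" shows "isCont (spow p) a"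
  unfolding spow_def using assms by (intro continuous_intros) auto

text \<open>Young's inequality with the conjugate exponents p / (p - 1) and p gives convexity of
  |x|^p directly, without differentiation at 0.\<close>

lemma powr_above_tangent:
  assumes "1 < p" shows "\<bar>a\<bar> powr p + p * spow p a * (b - a) \<le> \<bar>b\<bar> powr p"
proof -
  have "spow p a * b \<le> \<bar>a\<bar> powr (p - 1) * \<bar>b\<bar>"
    by (metis abs_ge_self abs_mult abs_spow)
  also have "\<dots> \<le> (\<bar>a\<bar> powr (p - 1)) powr (p / (p - 1)) / (p / (p - 1)) + \<bar>b\<bar> powr p / p"
    using assms by (intro Youngs_inequality) (auto simp: field_simps)
  also have "(\<bar>a\<bar> powr (p - 1)) powr (p / (p - 1)) = \<bar>a\<bar> powr p"
    using assms by (simp add: powr_powr)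
  finally have "p * (spow p a * b) \<le> p * (\<bar>a\<bar> powr p / (p / (p - 1)) + \<bar>b\<bar> powr p / p)"
    using assms by (intro mult_left_mono) auto
  also have "p * (\<bar>a\<bar> powr p / (p / (p - 1)) + \<bar>b\<bar> powr p / p) = (p - 1) * \<bar>a\<bar> powr p + \<bar>b\<bar> powr p"
    using assms by (simp add: distrib_left)
  finally have "p * (spow p a * b) \<le> (p - 1) * \<bar>a\<bar> powr p + \<bar>b\<bar> powr p" .
  moreover have "p * spow p a * (b - a) = p * (spow p a * b) - p * \<bar>a\<bar> powr p"
    by (simp only: right_diff_distrib mult.assoc spow_self)
  moreover have "(p - 1) * \<bar>a\<bar> powr p = p * \<bar>a\<bar> powr p - \<bar>a\<bar> powr p" by (simp add: left_diff_distrib)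
  ultimately show ?thesis by linarith
qed

text \<open>The tangent inequality is taken at the midpoint, where the two linear terms
  cancel.\<close>

lemma powr_midpoint_convex:
  fixes q :: real
  assumes "1 < q" "0 \<le> u" "0 \<le> v" shows "((u + v) / 2) powr q \<le> (u powr q + v powr q) / 2"
proof -
  let ?m = "(u + v) / 2"
  have "\<bar>?m\<bar> powr q + q * spow q ?m * (u - ?m) \<le> \<bar>u\<bar> powr q"
    "\<bar>?m\<bar> powr q + q * spow q ?m * (v - ?m) \<le> \<bar>v\<bar> powr q"
    by (rule powr_above_tangent[OF assms(1)])+
  moreover have K: "K * (u - ?m) + K * (v - ?m) = 0" for K :: real
    by (simp add: field_simps)
  ultimately have "2 * \<bar>?m\<bar> powr q \<le> \<bar>u\<bar> powr q + \<bar>v\<bar> powr q"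
    using K[of "q * spow q ?m"] by linarith
  then show ?thesis using assms by simp
qed

lemma powr_superadditive:
  assumes "1 \<le> q" "0 \<le> x" "0 \<le> (y::real)" shows "x powr q + y powr q \<le> (x + y) powr q"
proof -
  have split: "z powr q = z * z powr (q - 1)" if "0 \<le> z" for z :: real
    using that by (cases "z = 0") (simp_all add: powr_mult_base)
  have "x * x powr (q - 1) \<le> x * (x + y) powr (q - 1)" "y * y powr (q - 1) \<le> y * (x + y) powr (q - 1)"
    using assms by (auto intro!: mult_left_mono powr_mono2)
  then show ?thesis using assms by (simp add: split distrib_right)
qed

text \<open>The parallelogram identity handles the squares; the exponent p / 2 > 1 is then
  superadditive on one side and convex on the other.\<close>

lemma clarkson_real:
  fixes p :: real
  assumes "2 < p"
  shows "\<bar>(a + b) / 2\<bar> powr p + \<bar>(a - b) / 2\<bar> powr p \<le> (\<bar>a\<bar> powr p + \<bar>b\<bar> powr p) / 2"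
proof -
  have sq: "\<bar>z\<bar> powr p = (z\<^sup>2) powr (p / 2)" for z :: real
  proof (cases "z = 0")
    case False
    have "z\<^sup>2 = \<bar>z\<bar> powr 2" using False by (simp add: powr_numeral)
    then show ?thesis by (simp only: powr_powr) simp
  qed simp
  have "((a + b) / 2)\<^sup>2 powr (p / 2) + ((a - b) / 2)\<^sup>2 powr (p / 2)
    \<le> (((a + b) / 2)\<^sup>2 + ((a - b) / 2)\<^sup>2) powr (p / 2)"
    using assms by (intro powr_superadditive) auto
  also have "((a + b) / 2)\<^sup>2 + ((a - b) / 2)\<^sup>2 = (a\<^sup>2 + b\<^sup>2) / 2"
    by (simp add: power2_eq_square field_simps)
  also have "((a\<^sup>2 + b\<^sup>2) / 2) powr (p / 2) \<le> (a\<^sup>2 powr (p / 2) + b\<^sup>2 powr (p / 2)) / 2"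
    using assms by (intro powr_midpoint_convex) auto
  finally show ?thesis unfolding sq .
qed

text \<open>Clarkson's inequality for \<open>a\<close> and a - c, combined with the tangent at
  \<open>a\<close> evaluated at the midpoint a - c / 2. The constant is twice the factor 2^(-p)
  produced by halving \<open>c\<close>.\<close>

lemma powr_strongly_convex:
  assumes "2 < p"
  shows "\<bar>a\<bar> powr p - p * spow p a * c + 2 powr (1 - p) * \<bar>c\<bar> powr p \<le> \<bar>a - c\<bar> powr p"
proof -
  have "\<bar>(a + (a - c)) / 2\<bar> powr p + \<bar>(a - (a - c)) / 2\<bar> powr p \<le> (\<bar>a\<bar> powr p + \<bar>a - c\<bar> powr p) / 2"
    by (rule clarkson_real[OF assms])
  moreover have "\<bar>a\<bar> powr p + p * spow p a * ((a + (a - c)) / 2 - a) \<le> \<bar>(a + (a - c)) / 2\<bar> powr p"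
    using assms by (intro powr_above_tangent) simp
  moreover have "p * spow p a * ((a + (a - c)) / 2 - a) = - (p * spow p a * c) / 2"
    by (simp add: field_simps)
  moreover have "2 * \<bar>(a - (a - c)) / 2\<bar> powr p = 2 powr (1 - p) * \<bar>c\<bar> powr p"
    by (simp add: powr_divide powr_diff)
  ultimately show ?thesis by (simp add: field_simps)
qed

text \<open>Below c / 2 the difference a - c is at most - c / 2; above it, |a| dominates c / 2. The
  bound tends to minus infinity with \<open>c\<close>, which yields the sign change used for
  centring.\<close>

lemma spow_diff_le:
  assumes "2 < p" "0 < c" shows "spow p (a - c) \<le> 2 * \<bar>a\<bar> powr (p - 1) - (c / 2) powr (p - 1)"
proof (cases "a \<le> c / 2")
  case True
  have "spow p (a - c) \<le> spow p (- (c / 2))" using True assms by (intro spow_mono) auto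
  also have "\<dots> = - ((c / 2) powr (p - 1))" using assms by (simp add: spow_eq_sgn)
  finally show ?thesis using powr_ge_zero[of "\<bar>a\<bar>" "p - 1"] by linarith
next
  case False
  have "spow p (a - c) \<le> spow p a" using assms by (intro spow_mono) auto
  also have "\<dots> \<le> \<bar>a\<bar> powr (p - 1)" by (metis abs_ge_self abs_spow)
  finally have "spow p (a - c) \<le> \<bar>a\<bar> powr (p - 1)" .
  moreover have "(c / 2) powr (p - 1) \<le> \<bar>a\<bar> powr (p - 1)" using False assms by (intro powr_mono2) auto
  ultimately show ?thesis by linarith
qed

lemma powr_diff_const_le:
  fixes p :: real
  assumes "1 \<le> p" shows "\<bar>a - c\<bar> powr p \<le> 2 powr p * (\<bar>a\<bar> powr p + \<bar>c\<bar> powr p)"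
proof -
  have "\<bar>a - c\<bar> powr p \<le> (2 * max \<bar>a\<bar> \<bar>c\<bar>) powr p" using assms by (intro powr_mono2) auto
  also have "\<dots> = 2 powr p * max \<bar>a\<bar> \<bar>c\<bar> powr p" by (simp add: powr_mult)
  also have "max \<bar>a\<bar> \<bar>c\<bar> powr p \<le> \<bar>a\<bar> powr p + \<bar>c\<bar> powr p" by (auto simp: max_def)
  finally show ?thesis by simp
qed

lemma powr_pred_le: "1 \<le> p \<Longrightarrow> \<bar>a\<bar> powr (p - 1) \<le> 1 + \<bar>a\<bar> powr p" for p :: real
proof (cases "\<bar>a\<bar> \<le> 1")
  case True
  assume "1 \<le> p"
  then have "\<bar>a\<bar> powr (p - 1) \<le> 1 powr (p - 1)" using True by (intro powr_mono2) auto
  then show ?thesis using powr_ge_zero[of "\<bar>a\<bar>" p] by (simp del: powr_ge_zero)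
next
  case False
  then have "\<bar>a\<bar> powr (p - 1) \<le> \<bar>a\<bar> powr p" by (intro powr_mono) auto
  then show ?thesis by simp
qed

section \<open>Centring a function over a finite measure space\<close>

context finite_measure
begin

lemma integrable_powr_diff_const:
  fixes f :: "'a \<Rightarrow> real"
  assumes "1 \<le> p" and [measurable]: "f \<in> borel_measurable M" and int: "integrable M (\<lambda>x. \<bar>f x\<bar> powr p)"
  shows "integrable M (\<lambda>x. \<bar>f x - c\<bar> powr p)"
proof (rule Bochner_Integration.integrable_bound)
  show "integrable M (\<lambda>x. 2 powr p * (\<bar>f x\<bar> powr p + \<bar>c\<bar> powr p))"
    using int by (intro integrable_mult_right Bochner_Integration.integrable_add integrable_const)
  show "AE x in M. norm (\<bar>f x - c\<bar> powr p) \<le> norm (2 powr p * (\<bar>f x\<bar> powr p + \<bar>c\<bar> powr p))"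
    using powr_diff_const_le[OF assms(1)] by simp
qed measurable

lemma integrable_spow:
  assumes "2 < p" and [measurable]: "f \<in> borel_measurable M" and int: "integrable M (\<lambda>x. \<bar>f x\<bar> powr p)"
  shows "integrable M (\<lambda>x. spow p (f x))"
proof (rule Bochner_Integration.integrable_bound)
  show "integrable M (\<lambda>x. 1 + \<bar>f x\<bar> powr p)"
    using int by (intro Bochner_Integration.integrable_add integrable_const)
  show "(\<lambda>x. spow p (f x)) \<in> borel_measurable M" unfolding spow_def by measurable
  show "AE x in M. norm (spow p (f x)) \<le> norm (1 + \<bar>f x\<bar> powr p)"
    using powr_pred_le[of p] assms(1) by (simp add: abs_spow)
qed

text \<open>The constraint integral of f - c depends continuously on c, by dominated convergence,
  and has opposite signs for large c and large -c, so it has a zero between them.\<close>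

lemma ex_spow_centering:
  assumes p: "2 < p" and f [measurable]: "f \<in> borel_measurable M" and int: "integrable M (\<lambda>x. \<bar>f x\<bar> powr p)"
  shows "\<exists>c. (LINT x|M. spow p (f x - c)) = 0"
proof -
  define \<phi> where "\<phi> = (\<lambda>c. LINT x|M. spow p (f x - c))"
  have ints: "integrable M (\<lambda>x. spow p (f x - c))" for c
    using integrable_powr_diff_const[OF _ f int, of c] p by (intro integrable_spow) auto
  have [measurable]: "spow p \<in> borel_measurable borel"
    unfolding spow_def by measurable
  have cont: "isCont \<phi> c" for c
    unfolding continuous_at_sequentially comp_def
  proof (intro allI impI)
    fix X :: "nat \<Rightarrow> real" assume X: "X \<longlonglongrightarrow> c"
    then obtain R where R: "0 \<le> R" "\<And>k. \<bar>X k\<bar> \<le> R"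
      using convergent_imp_Bseq[OF convergentI[OF X]] by (auto simp: Bseq_def intro: less_imp_le)
    have "(\<lambda>k. LINT x|M. spow p (f x - X k)) \<longlonglongrightarrow> (LINT x|M. spow p (f x - c))"
    proof (rule integral_dominated_convergence)
      show "integrable M (\<lambda>x. 1 + 2 powr p * (\<bar>f x\<bar> powr p + R powr p))"
        using int by (intro integrable_mult_right Bochner_Integration.integrable_add integrable_const)
      show "AE x in M. (\<lambda>k. spow p (f x - X k)) \<longlonglongrightarrow> spow p (f x - c)"
        by (intro AE_I2 isCont_tendsto_compose[OF isCont_spow[OF p]] tendsto_intros X)
      show "AE x in M. norm (spow p (f x - X k)) \<le> 1 + 2 powr p * (\<bar>f x\<bar> powr p + R powr p)" for k
      proof (intro AE_I2)
        fix x
        have "norm (spow p (f x - X k)) \<le> 1 + \<bar>f x - X k\<bar> powr p"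
          using powr_pred_le[of p] p by (simp add: abs_spow)
        also have "\<dots> \<le> 1 + 2 powr p * (\<bar>f x\<bar> powr p + \<bar>X k\<bar> powr p)"
          using powr_diff_const_le[of p] p by simp
        also have "\<bar>X k\<bar> powr p \<le> R powr p" using R p by (intro powr_mono2) auto
        finally show "norm (spow p (f x - X k)) \<le> 1 + 2 powr p * (\<bar>f x\<bar> powr p + R powr p)" by simp
      qed
    qed measurable
    then show "(\<lambda>k. \<phi> (X k)) \<longlonglongrightarrow> \<phi> c" by (simp add: \<phi>_def)
  qed
  show ?thesis
  \<comment> \<open>A null measure is treated apart because the choice of \<open>c\<close> below
    divides by the total mass.\<close>
  proof (cases "measure M (space M) = 0")
    case True
    then have "emeasure M (space M) = 0" by (simp add: emeasure_eq_measure)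
    then have "space M \<in> null_sets M" by (simp add: null_sets_def)
    then have "AE x in M. spow p (f x - 0) = 0" using AE_not_in AE_space by fastforce
    then have "(LINT x|M. spow p (f x - 0)) = (LINT x|M. 0)" by (intro integral_cong_AE) auto
    then show ?thesis by (intro exI[of _ 0]) simp
  next
    case False
    then have V: "0 < measure M (space M)" using measure_nonneg[of M "space M"] by linarith
    have intp: "integrable M (\<lambda>x. \<bar>f x\<bar> powr (p - 1))"
      using integrable_abs[OF ints[of 0]] by (simp add: abs_spow)
    define B where "B = (LINT x|M. 2 * \<bar>f x\<bar> powr (p - 1))"
    \<comment> \<open>Chosen so that (c / 2)^(p - 1) times the total mass is |B| plus the total
      mass, which outweighs \<open>B\<close>.\<close>
    define c where "c = 2 * (\<bar>B\<bar> / measure M (space M) + 1) powr (1 / (p - 1))"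
    have c: "0 < c" unfolding c_def using V by (auto intro!: add_nonneg_pos simp: powr_gt_zero add_nonneg_eq_0_iff)
    have c2: "(c / 2) powr (p - 1) = \<bar>B\<bar> / measure M (space M) + 1"
    proof -
      have "0 \<le> \<bar>B\<bar> / measure M (space M) + 1" using V by simp
      then show ?thesis using p by (simp add: c_def powr_powr)
    qed
    have B: "(LINT x|M. 2 * \<bar>f x\<bar> powr (p - 1) - (c / 2) powr (p - 1)) \<le> 0"
    proof -
      have "(LINT x|M. 2 * \<bar>f x\<bar> powr (p - 1) - (c / 2) powr (p - 1))
        = B - measure M (space M) * (c / 2) powr (p - 1)"
        using intp by (simp add: B_def)
      also have "\<dots> = B - \<bar>B\<bar> - measure M (space M)" using V by (simp add: c2 field_simps)
      finally show ?thesis using V by simp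
    qed
    have intB: "integrable M (\<lambda>x. 2 * \<bar>f x\<bar> powr (p - 1) - (c / 2) powr (p - 1))"
      using intp by (intro Bochner_Integration.integrable_diff integrable_mult_right integrable_const)
    have "\<phi> c \<le> (LINT x|M. 2 * \<bar>f x\<bar> powr (p - 1) - (c / 2) powr (p - 1))"
      unfolding \<phi>_def by (intro integral_mono ints intB spow_diff_le p c)
    then have lo: "\<phi> c \<le> 0" using B by linarith
    \<comment> \<open>\<open>spow\<close> is odd, so the same bound applied to the negative of
      \<open>f\<close> fixes the opposite sign at - c.\<close>
    have "- \<phi> (- c) = (LINT x|M. spow p (- f x - c))"
      using spow_minus[of p "f _ + c"] by (simp add: \<phi>_def integral_minus[symmetric] del: integral_minus)
    also have "\<dots> \<le> (LINT x|M. 2 * \<bar>f x\<bar> powr (p - 1) - (c / 2) powr (p - 1))"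
    proof (intro integral_mono intB)
      show "integrable M (\<lambda>x. spow p (- f x - c))"
        using integrable_minus[OF ints[of "- c"]] spow_minus[of p "f _ + c"] by simp
      show "spow p (- f x - c) \<le> 2 * \<bar>f x\<bar> powr (p - 1) - (c / 2) powr (p - 1)" for x
        using spow_diff_le[OF p c, of "- f x"] by simp
    qed
    finally have "0 \<le> \<phi> (- c)" using B by linarith
    then obtain c' where "\<phi> c' = 0"
      using IVT2'[of \<phi> c 0 "- c"] lo c cont by (auto simp: continuous_at_imp_continuous_on)
    then show ?thesis by (auto simp: \<phi>_def)
  qed
qed

end

section \<open>Nonconstant Sobolev functions\<close>

lemma frechet_derivative_eq_gradient_inner:
  fixes \<eta> :: "real ^ 'n::finite \<Rightarrow> real"
  assumes "(\<eta> has_derivative frechet_derivative \<eta> (at y)) (at y)"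
  shows "frechet_derivative \<eta> (at y) v = (\<chi> i. partial_deriv i \<eta> y) \<bullet> v"
proof -
  have lin: "linear (frechet_derivative \<eta> (at y))" using assms has_derivative_linear by blast
  have "v = (\<Sum>i\<in>UNIV. v $ i *\<^sub>R axis i 1)" 
    by (simp only: scalar_mult_eq_scaleR[symmetric] basis_expansion)
  then have "frechet_derivative \<eta> (at y) v = frechet_derivative \<eta> (at y) (\<Sum>i\<in>UNIV. v $ i *\<^sub>R axis i 1)"
    by (rule arg_cong)
  also have "\<dots> = (\<Sum>i\<in>UNIV. v $ i *\<^sub>R frechet_derivative \<eta> (at y) (axis i 1))"
    by (simp add: linear_sum[OF lin] linear_scale[OF lin])
  finally show ?thesis by (simp add: inner_vec_def partial_deriv_def mult.commute)
qed

context closed_mfd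
begin

text \<open>The product with a test function, extended by zero, is differentiable everywhere because
  the support stays in a compact part of the chart. The integral of its derivative vanishes, and
  that is integration by parts.\<close>

lemma weak_differentialI:
  assumes cov: "covector_field A \<xi>"
    and der: "\<And>d y. d \<in> A \<Longrightarrow> y \<in> chart_image d \<Longrightarrow>
      ((\<lambda>y. f (chart_inv d y)) has_derivative (\<lambda>v. \<xi> d (chart_inv d y) \<bullet> v)) (at y)"
    and cont: "\<And>d. d \<in> A \<Longrightarrow> continuous_on (chart_image d) (\<lambda>y. \<xi> d (chart_inv d y))"
  shows "weak_differential A f \<xi>"
  unfolding weak_differential_def
proof (intro conjI ballI allI impI cov)
  fix d assume d: "d \<in> A"
  let ?V = "chart_image d" and ?F = "\<lambda>y. f (chart_inv d y)" and ?X = "\<lambda>y. \<xi> d (chart_inv d y)"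
  have V: "open ?V" using chart(2)[OF d] .
  have cF: "continuous_on ?V ?F"
    using der[OF d] V by (intro continuous_at_imp_continuous_on ballI has_derivative_continuous)
  have cX: "continuous_on ?V (\<lambda>y. ?X y $ i)" for i by (intro continuous_intros cont d)
  have li: "locally_integrable_on ?V G" if "continuous_on ?V G" for G
    unfolding locally_integrable_on_def set_integrable_def
    using that by (intro allI impI borel_integrable_compact) (auto intro: continuous_on_subset)
  show "locally_integrable_on ?V ?F" by (rule li[OF cF])
  show "locally_integrable_on ?V (\<lambda>y. ?X y $ i)" for i by (rule li[OF cX])
  fix i \<phi> assume \<phi>: "test_function_on ?V \<phi>"
  obtain K where K: "compact K" "K \<subseteq> ?V" "\<And>y. y \<notin> K \<Longrightarrow> \<phi> y = 0" "\<And>i y. y \<notin> K \<Longrightarrow> partial_deriv i \<phi> y = 0"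
    "\<And>i. continuous_on UNIV (partial_deriv i \<phi>)"
    "\<And>y. (\<phi> has_derivative frechet_derivative \<phi> (at y)) (at y)" "continuous_on UNIV \<phi>"
    by (rule test_function_partial_deriv[OF \<phi>]) blast
  define D where "D = (\<lambda>y v. if y \<in> ?V then ?F y * frechet_derivative \<phi> (at y) v + (?X y \<bullet> v) * \<phi> y else 0)"
  define G where "G = (\<lambda>y. if y \<in> ?V then ?F y * \<phi> y else 0)"
  have G0: "G y = 0" if "y \<notin> K" for y using K(3)[OF that] by (simp add: G_def)
  have derG: "(G has_derivative D y) (at y)" for y
  proof (cases "y \<in> ?V")
    case True
    have "((\<lambda>y. ?F y * \<phi> y) has_derivative D y) (at y)"
      using has_derivative_mult[OF der[OF d True] K(6)[of y]] True by (simp add: D_def)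
    then show ?thesis
      by (rule has_derivative_transform_within_open[OF _ V True]) (simp add: G_def)
  next
    case False
    have "((\<lambda>y. 0) has_derivative D y) (at y)" using False by (simp add: D_def)
    then show ?thesis
    proof (rule has_derivative_transform_within_open)
      show "open (- K)" using compact_imp_closed[OF K(1)] by (simp add: open_Compl)
      show "y \<in> - K" using False K(2) by blast
    qed (simp add: G0)
  qed
  have D1: "D y (axis i 1) = indicator ?V y * (?F y * partial_deriv i \<phi> y) + indicator ?V y * (?X y $ i * \<phi> y)" for y
    by (simp add: D_def partial_deriv_def inner_axis)
  have "continuous_on K (\<lambda>y. ?F y * partial_deriv i \<phi> y + ?X y $ i * \<phi> y)"
    using K(2,5,7) cF cont[OF d] by (intro continuous_intros) (auto intro: continuous_on_subset)
  then have "bounded ((\<lambda>y. ?F y * partial_deriv i \<phi> y + ?X y $ i * \<phi> y) ` K)"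
    by (intro compact_imp_bounded compact_continuous_image K(1))
  then obtain B where B: "\<And>y. y \<in> K \<Longrightarrow> \<bar>?F y * partial_deriv i \<phi> y + ?X y $ i * \<phi> y\<bar> \<le> B"
    by (auto simp: bounded_iff)
  have "(LINT y|lborel. D y (axis i 1)) = 0"
  proof (rule integral_derivative_compact_support[OF derG _ K(1) G0])
    fix y
    show "\<bar>D y (axis i 1)\<bar> \<le> \<bar>B\<bar>"
    proof (cases "y \<in> K")
      case True
      then show ?thesis unfolding D1 using B[OF True] K(2) by auto
    next
      case False
      then show ?thesis by (simp add: D1 K(3,4))
    qed
  qed
  moreover have "(LINT y|lborel. D y (axis i 1))
    = (LINT y:?V|lborel. ?F y * partial_deriv i \<phi> y) + (LINT y:?V|lborel. ?X y $ i * \<phi> y)"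
    unfolding D1 set_lebesgue_integral_def
    using integrable_locally_integrable_mult[OF V li[OF cF] K(1,2,5,4)]
      integrable_locally_integrable_mult[OF V li[OF cX] K(1,2,7,3)]
    by (simp add: set_integrable_def)
  ultimately show "(LINT y:?V|lborel. ?F y * partial_deriv i \<phi> y) = - (LINT y:?V|lborel. ?X y $ i * \<phi> y)"
    by simp
qed

text \<open>A box bump is transported from one chart and extended by zero. Its support
  \<open>?K\<close> is compact, hence closed in the Hausdorff manifold, so in every chart two open
  sets cover the picture: the overlap with \<open>c\<close>, where the transition map is used, and
  the complement of \<open>?K\<close>, where everything is 0.\<close>

lemma ex_bump:
  obtains f :: "'m \<Rightarrow> real" and \<xi> and x0 x1
  where "weak_differential A f \<xi>" "continuous_on UNIV f" "covector_field A \<xi>"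
    "\<And>d. d \<in> A \<Longrightarrow> continuous_on (chart_image d) (\<lambda>y. \<xi> d (chart_inv d y))"
    "f x0 = 0" "0 < f x1"
proof -
  define c where "c = chart_at A undefined"
  have c: "c \<in> A" by (simp add: c_def chart_at)
  let ?J = transition_jacobian
  have "snd c undefined \<in> chart_image c" using chart_at(2) chart(6)[OF c] by (simp add: c_def)
  then obtain a b where ab: "snd c undefined \<in> box a b" "cbox a b \<subseteq> chart_image c"
    using open_contains_cbox[OF chart(2)[OF c]] by blast
  define \<eta> where "\<eta> = box_bump 0 a b"
  define G\<eta> where "G\<eta> = (\<lambda>y. \<chi> i. partial_deriv i \<eta> y)"
  \<comment> \<open>The preimage of \<open>UNIV\<close> is the whole space; only global regularity
    of \<eta> is extracted here.\<close>
  have \<eta>: "test_function_on (box_bump 0 a b -` UNIV) \<eta>"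
    unfolding \<eta>_def by (rule test_function_box_bump) simp
  then obtain S where S: "\<And>i. continuous_on UNIV (partial_deriv i \<eta>)"
    "\<And>y. (\<eta> has_derivative frechet_derivative \<eta> (at y)) (at y)" "continuous_on UNIV \<eta>"
    by (rule test_function_partial_deriv) blast
  have \<eta>0: "\<eta> y = 0" if "y \<notin> cbox a b" for y
    using that box_bump_pos_iff[of 0 a b y] box_bump_nonneg[of 0 a b y] box_subset_cbox[of a b]
    by (auto simp: \<eta>_def less_le)
  have G0: "G\<eta> y = 0" if "y \<notin> cbox a b" for y
  proof -
    have "(\<eta> has_derivative (\<lambda>v. 0)) (at y)"
    proof (rule has_derivative_transform_within_open[OF has_derivative_const])
      show "open (- cbox a b)" by (simp add: open_Compl closed_cbox)
      show "y \<in> - cbox a b" using that by simp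
      show "0 = \<eta> x" if "x \<in> - cbox a b" for x using \<eta>0[of x] that by simp
    qed
    from frechet_derivative_at[OF this, symmetric] show ?thesis
      by (simp add: G\<eta>_def partial_deriv_def vec_eq_iff)
  qed
  have cG: "continuous_on UNIV G\<eta>" unfolding G\<eta>_def by (intro continuous_intros S)
  define f where "f = (\<lambda>x. if x \<in> fst c then \<eta> (snd c x) else 0)"
  define \<xi> where "\<xi> = (\<lambda>d x. if x \<in> fst c then transpose (?J d c x) *v G\<eta> (snd c x) else 0)"
  let ?K = "chart_inv c ` cbox a b"
  have "compact ?K" using chart(4)[OF c] ab(2) compact_cbox
    by (intro compact_continuous_image) (auto intro: continuous_on_subset)
  then have oK: "open (- ?K)" by (simp add: compact_imp_closed open_Compl)
  have off: "f x = 0" "\<xi> d x = 0" if "x \<notin> ?K" for x d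
  proof -
    have "x \<in> fst c \<Longrightarrow> snd c x \<notin> cbox a b" using that chart(5)[OF c, of x] by force
    then show "f x = 0" "\<xi> d x = 0" by (auto simp: f_def \<xi>_def \<eta>0 G0)
  qed
  have Kc: "?K \<subseteq> fst c" using chart(8)[OF c] ab(2) by blast
  have cov: "covector_field A \<xi>"
    unfolding covector_field_def
  proof (intro ballI)
    fix d e x assume d: "d \<in> A" "e \<in> A" "x \<in> fst d \<inter> fst e"
    show "\<xi> d x = transpose (?J d e x) *v \<xi> e x"
    proof (cases "x \<in> fst c")
      case True
      then have "?J d c x = ?J e c x ** ?J d e x" using d c by (intro transition_jacobian_comp) auto
      then show ?thesis using True
        by (simp add: \<xi>_def matrix_transpose_mul matrix_vector_mul_assoc del: transpose_matrix_vector)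
    qed (simp add: \<xi>_def)
  qed
  have onc: "y \<in> overlap d c" if "d \<in> A" "y \<in> chart_image d" "chart_inv d y \<in> fst c" for d y
    using that chart(7,8)[OF that(1,2)] by (intro image_eqI[of _ _ "chart_inv d y"]) auto
  have offK: "open (chart_image d \<inter> chart_inv d -` (- ?K))" if "d \<in> A" for d
    by (rule continuous_open_preimage[OF chart(4)[OF that] chart(2)[OF that] oK])
  have der: "((\<lambda>y. f (chart_inv d y)) has_derivative (\<lambda>v. \<xi> d (chart_inv d y) \<bullet> v)) (at y)"
    if d: "d \<in> A" and y: "y \<in> chart_image d" for d y
  proof (cases "chart_inv d y \<in> fst c")
    case True
    let ?x = "chart_inv d y"
    have x: "?x \<in> fst d" "snd d ?x = y" using chart(7,8)[OF d y] by auto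
    have "((snd c \<circ> chart_inv d) has_derivative (\<lambda>v. ?J d c ?x *v v)) (at y)"
      using transition_has_derivative[OF d c x(1) True] x(2) by simp
    from has_derivative_compose[OF this S(2)]
    have "((\<lambda>z. \<eta> (snd c (chart_inv d z))) has_derivative
        (\<lambda>v. frechet_derivative \<eta> (at (snd c ?x)) (?J d c ?x *v v))) (at y)" by simp
    moreover have "frechet_derivative \<eta> (at (snd c ?x)) (?J d c ?x *v v) = \<xi> d ?x \<bullet> v" for v
      unfolding frechet_derivative_eq_gradient_inner[OF S(2)] G\<eta>_def[symmetric]
      using True by (simp add: \<xi>_def G\<eta>_def transpose_matrix_vector dot_lmul_matrix)
    ultimately have "((\<lambda>z. \<eta> (snd c (chart_inv d z))) has_derivative (\<lambda>v. \<xi> d ?x \<bullet> v)) (at y)" by simp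
    then show ?thesis
      by (rule has_derivative_transform_within_open[OF _ open_overlap[OF d c] onc[OF d y True]])
         (use chart(5)[OF d] in \<open>auto simp: f_def\<close>)
  next
    case False
    then have "chart_inv d y \<notin> ?K" using Kc by blast
    then have "((\<lambda>z. 0) has_derivative (\<lambda>v. \<xi> d (chart_inv d y) \<bullet> v)) (at y)" by (simp add: off)
    then show ?thesis
      by (rule has_derivative_transform_within_open[OF _ offK[OF d]])
         (use y \<open>chart_inv d y \<notin> ?K\<close> off in auto)
  qed
  have cont: "continuous_on (chart_image d) (\<lambda>y. \<xi> d (chart_inv d y))" if d: "d \<in> A" for d
  proof -
    let ?U = "chart_image d \<inter> chart_inv d -` (- ?K)"
    have "continuous_on (overlap d c) (\<lambda>y. snd c (chart_inv d y))"
      using Ck_on_continuous[OF Ck_on_transition[OF d c, of 0]] by (simp add: comp_def)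
    from continuous_on_compose2[OF cG this]
    have "continuous_on (overlap d c) (\<lambda>y. transpose (?J d c (chart_inv d y)) *v G\<eta> (snd c (chart_inv d y)))"
      unfolding matrix_vector_mult_def transpose_def
      by (intro continuous_intros continuous_on_transition_jacobian d c) simp
    then have 1: "continuous_on (overlap d c) (\<lambda>y. \<xi> d (chart_inv d y))"
      by (rule continuous_on_eq) (use chart(5)[OF d] in \<open>auto simp: \<xi>_def\<close>)
    have 2: "continuous_on ?U (\<lambda>y. \<xi> d (chart_inv d y))"
      by (rule continuous_on_eq[OF continuous_on_const[of _ 0]]) (simp add: off)
    have "chart_image d = overlap d c \<union> ?U"
      using onc[OF d] Kc chart(6)[OF d] by auto
    with continuous_on_open_Un[OF open_overlap[OF d c] offK[OF d] 1 2] show ?thesis by simp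
  qed
  have contf: "continuous_on UNIV f"
    using der chart(2)
    by (intro continuous_on_manifoldI continuous_at_imp_continuous_on ballI has_derivative_continuous)
  \<comment> \<open>The corner \<open>a\<close> lies in the closed box but not in the open one, so
    it gives a point of the chart at which the bump is 0.\<close>
  have box: "a \<in> cbox a b" "a \<notin> box a b" using ab(1) by (auto simp: mem_box_cart intro: less_imp_le order.strict_trans less_trans)
  show ?thesis
  proof (rule that[OF weak_differentialI[OF cov der cont] contf cov cont])
    have "chart_inv c a \<in> fst c" "snd c (chart_inv c a) = a" using box(1) ab(2) chart(7,8)[OF c] by auto
    then show "f (chart_inv c a) = 0"
      using box_bump_pos_iff[of 0 a b a] box_bump_nonneg[of 0 a b a] box(2)
      by (simp add: f_def \<eta>_def less_le)
    show "0 < f undefined" using box_bump_pos_iff[of 0 a b] ab(1) chart_at(2)[of undefined]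
      by (simp add: f_def \<eta>_def c_def)
  qed
qed

end

context riem_metric
begin

text \<open>This excludes the junk value \<open>Inf {}\<close> in the definition of the eigenvalue.  The gradient is
  built from a weak differential selected by \<open>SOME\<close>, so the smooth differential of the bump
  function only helps through uniqueness of weak differentials.\<close>

lemma ex_nonconstant_sobolev:
  assumes p: "1 \<le> p"
  obtains f where "f \<in> sobolev A g p" "\<And>k. \<not> (AE x in riemannian_measure A g. f x = k)"
proof -
  interpret finite_measure "riemannian_measure A g" by (rule finite_measure_riemannian)
  obtain f :: "'m \<Rightarrow> real" and \<xi> x0 x1 where f: "weak_differential A f \<xi>" "continuous_on UNIV f" "covector_field A \<xi>"
    "\<And>d. d \<in> A \<Longrightarrow> continuous_on (chart_image d) (\<lambda>y. \<xi> d (chart_inv d y))"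
    "f x0 = 0" "0 < f x1" by (rule ex_bump) blast
  have fm: "f \<in> borel_measurable borel" using f(2) by (rule borel_measurable_continuous_onI)
  have bound: "\<exists>B. \<forall>x. \<bar>F x\<bar> \<le> B" if "continuous_on UNIV F" for F :: "'m \<Rightarrow> real"
    using compact_imp_bounded[OF compact_continuous_image[OF that compact_UNIV]]
    by (auto simp: bounded_iff)
  obtain B where B: "\<And>x. \<bar>f x\<bar> \<le> B" using bound[OF f(2)] by blast
  have "continuous_on UNIV (energy \<xi>)"
  proof (rule continuous_on_manifoldI)
    fix c assume c: "c \<in> A"
    have "continuous_on (chart_image c) (\<lambda>y. \<Sum>i\<in>UNIV. \<Sum>j\<in>UNIV. matrix_inv (g c (chart_inv c y)) $ i $ j
        * \<xi> c (chart_inv c y) $ i * \<xi> c (chart_inv c y) $ j)"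
      by (intro continuous_intros continuous_metric_inv f c)
    then show "continuous_on (chart_image c) (\<lambda>y. energy \<xi> (chart_inv c y))"
      by (rule continuous_on_eq) (simp add: energy_eq[OF f(3) c chart(8)[OF c]] quadratic_form_eq_inner)
  qed
  then obtain C where C: "\<And>x. \<bar>energy \<xi> x\<bar> \<le> C" using bound by blast
  define \<zeta> where "\<zeta> = (SOME \<xi>. weak_differential A f \<xi>)"
  have \<zeta>: "weak_differential A f \<zeta>" unfolding \<zeta>_def by (rule someI[of _ \<xi>]) (rule f(1))
  have [measurable]: "energy \<zeta> \<in> borel_measurable borel" by (rule energy_measurable[OF \<zeta>])
  have "f \<in> sobolev A g p"
    unfolding sobolev_def
  proof (intro CollectI conjI fm exI[of _ \<xi>] f(1))
    show "integrable (riemannian_measure A g) (\<lambda>x. \<bar>f x\<bar> powr p)"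
    proof (rule integrable_const_bound[of _ "B powr p"])
      show "AE x in riemannian_measure A g. norm (\<bar>f x\<bar> powr p) \<le> B powr p"
        using B p by (intro AE_I2) (auto intro!: powr_mono2)
    qed (use fm in measurable)
    show "integrable (riemannian_measure A g) (\<lambda>x. metric_norm A g (gradient A g f) x powr p)"
      unfolding metric_norm_gradient \<zeta>_def[symmetric]
    proof (rule integrable_const_bound[of _ "sqrt C powr p"])
      show "AE x in riemannian_measure A g. norm (sqrt (energy \<zeta> x) powr p) \<le> sqrt C powr p"
        using energy_AE_unique[OF f(1) \<zeta>]
      proof eventually_elim
        case (elim x)
        have "energy \<zeta> x \<le> C" using C[of x] elim by linarith
        then show ?case using p by (auto intro!: powr_mono2 simp: energy_nonneg)
      qed
    qed measurable
  qed
  moreover have "\<not> (AE x in riemannian_measure A g. f x = k)" for k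
  proof
    assume AE: "AE x in riemannian_measure A g. f x = k"
    have U: "open (f -` (- {k}))" using f(2) by (intro open_vimage) auto
    have "f -` (- {k}) \<in> null_sets (riemannian_measure A g)"
      using AE U by (subst AE_iff_null_sets) (auto elim: eventually_mono)
    then have "f -` (- {k}) = {}" using emeasure_open_pos[OF U] by (auto simp: null_sets_def)
    then have "f x = k" for x by blast
    from this[of x0] this[of x1] f(5,6) show False by simp
  qed
  ultimately show ?thesis by (rule that)
qed

end

section \<open>Pointwise growth along the flow\<close>

text \<open>A Gronwall argument: the product of \<open>y\<close> with the exponential of -\<kappa>
  is nondecreasing. Derivatives are taken within \<open>S\<close>, one-sided at the ends, and become
  two-sided at the interior points where monotonicity is tested.\<close>

lemma exponential_growth_bound:
  fixes y \<kappa> :: "real \<Rightarrow> real"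
  assumes "a \<le> b" and S: "{a..b} \<subseteq> S"
    and y: "\<And>s. s \<in> S \<Longrightarrow> (y has_real_derivative y' s) (at s within S)"
    and \<kappa>: "\<And>s. s \<in> S \<Longrightarrow> (\<kappa> has_real_derivative \<kappa>' s) (at s within S)"
    and le: "\<And>s. s \<in> {a..b} \<Longrightarrow> \<kappa>' s * y s \<le> y' s"
  shows "y a * exp (\<kappa> b - \<kappa> a) \<le> y b"
proof -
  let ?z = "\<lambda>s. y s * exp (- \<kappa> s)"
  have z: "(?z has_real_derivative (y' s - \<kappa>' s * y s) * exp (- \<kappa> s)) (at s within S)" if "s \<in> S" for s
    by (rule derivative_eq_intros y \<kappa> that refl | simp add: algebra_simps)+
  have "?z a \<le> ?z b"
  proof (rule DERIV_nonneg_imp_increasing_open[OF \<open>a \<le> b\<close>])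
    fix s assume s: "a < s" "s < b"
    then have "s \<in> interior S" using interior_mono[OF S] by (auto simp: interior_atLeastAtMost_real)
    then have "(?z has_real_derivative (y' s - \<kappa>' s * y s) * exp (- \<kappa> s)) (at s)"
      using z[of s] interior_subset by (metis at_within_interior subsetD)
    moreover have "0 \<le> (y' s - \<kappa>' s * y s) * exp (- \<kappa> s)" using le[of s] s by simp
    ultimately show "\<exists>d. (?z has_real_derivative d) (at s) \<and> 0 \<le> d" by blast
  next
    show "continuous_on {a..b} ?z"
      using continuous_on_subset[OF DERIV_continuous_on[OF z] S] by simp
  qed
  then have "?z a * exp (\<kappa> b) \<le> ?z b * exp (\<kappa> b)" by (intro mult_right_mono) auto
  then show ?thesis by (simp add: mult.assoc exp_add[symmetric])
qed

context closed_mfd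
begin

text \<open>Supplies compact sets \<open>{0..T} \<times> K\<close>, on which continuity in
  coordinates turns into bounds, moduli of continuity and extrema uniform over the manifold.\<close>

lemma compact_chart_cover:
  obtains D :: "(('m, 'n) chart \<times> (real ^ 'n::_) set) set" where "finite D"
    "\<And>c K. (c, K) \<in> D \<Longrightarrow> c \<in> A \<and> compact K \<and> K \<subseteq> chart_image c"
    "\<And>x. \<exists>c K. (c, K) \<in> D \<and> x \<in> chart_inv c ` K"
proof -
  let ?c = "chart_at A"
  have "\<exists>r. 0 < r \<and> cball (snd (?c x) x) r \<subseteq> chart_image (?c x)" for x
    using open_contains_cball[of "chart_image (?c x)"] chart(2,6)[OF chart_at(1)] chart_at(2) by blast
  then obtain r where r: "\<And>x. 0 < r x" "\<And>x. cball (snd (?c x) x) (r x) \<subseteq> chart_image (?c x)" by metis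
  define U where "U = (\<lambda>x. fst (?c x) \<inter> snd (?c x) -` ball (snd (?c x) x) (r x))"
  have U: "open (U x)" "x \<in> U x" for x
    unfolding U_def using chart_at r(1)
    by (auto intro: continuous_open_preimage[OF chart(3)[OF chart_at(1)] chart(1)[OF chart_at(1)]])
  have "UNIV \<subseteq> (\<Union>x\<in>UNIV. U x)" using U(2) by blast
  then obtain X where X: "finite X" "UNIV \<subseteq> (\<Union>x\<in>X. U x)"
    using compactE_image[OF compact_UNIV, of UNIV U] U(1) by metis
  show ?thesis
  proof (rule that[of "(\<lambda>x. (?c x, cball (snd (?c x) x) (r x))) ` X"])
    fix x
    obtain z where z: "z \<in> X" "x \<in> U z" using X(2) by blast
    then have "x = chart_inv (?c z) (snd (?c z) x)" "snd (?c z) x \<in> cball (snd (?c z) z) (r z)"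
      using chart(5)[OF chart_at(1)] by (auto simp: U_def)
    then have "x \<in> chart_inv (?c z) ` cball (snd (?c z) z) (r z)" by blast
    with z(1) show "\<exists>c K. (c, K) \<in> (\<lambda>x. (?c x, cball (snd (?c x) x) (r x))) ` X \<and> x \<in> chart_inv c ` K"
      by blast
    show "c \<in> A \<and> compact K \<and> K \<subseteq> chart_image c"
      if "(c, K) \<in> (\<lambda>x. (?c x, cball (snd (?c x) x) (r x))) ` X" for c K
      using that r(2) chart_at(1) by (elim imageE) simp
  qed (use X(1) in simp)
qed

end

locale pinched_flow = closed_mfd A
  for A :: "('m::{t2_space, second_countable_topology}, 'n::{finite, wellorder}) chart set" +
  fixes g h :: "real \<Rightarrow> ('m, 'n) tensor2" and T p \<alpha> :: real
  assumes dim: "1 < CARD('n)" and T: "0 < T" and flow: "geometric_flow A T g h" and p: "1 \<le> p"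
    and \<alpha>: "\<alpha> \<in> {1 / p ..< 1 / real CARD('n)}"
    and pinched: "\<And>t. t \<in> {0..T} \<Longrightarrow>
      tensor2_nonneg A (\<lambda>c x. h t c x - (\<alpha> * metric_trace A (g t) (h t) x) *\<^sub>R g t c x)"
    and trace_nonneg: "\<And>t x. t \<in> {0..T} \<Longrightarrow> 0 \<le> metric_trace A (g t) (h t) x"
begin

abbreviation H :: "real \<Rightarrow> 'm \<Rightarrow> real" where "H t \<equiv> metric_trace A (g t) (h t)"

lemma alpha_p: "1 \<le> \<alpha> * p" and p_gt_2: "2 < p"
proof -
  have n: "2 \<le> real CARD('n)" using dim by simp
  show "1 \<le> \<alpha> * p" using \<alpha> p by (simp add: field_simps)
  have "1 / p < 1 / real CARD('n)" using \<alpha> by simp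
  then have "real CARD('n) < p" using p n by (simp add: field_simps)
  then show "2 < p" using n by linarith
qed

lemma smooth_metric: "c \<in> A \<Longrightarrow> Ck_on k ({0..T} \<times> chart_image c) (\<lambda>(t, y). g t c (chart_inv c y))"
  and smooth_h: "c \<in> A \<Longrightarrow> Ck_on k ({0..T} \<times> chart_image c) (\<lambda>(t, y). h t c (chart_inv c y))"
  using flow by (auto simp: geometric_flow_def smooth_tensor2_family_def smooth_on_def)

lemma Ck_on_metric: "t \<in> {0..T} \<Longrightarrow> c \<in> A \<Longrightarrow> Ck_on k (chart_image c) (\<lambda>y. g t c (chart_inv c y))"
  and Ck_on_h: "t \<in> {0..T} \<Longrightarrow> c \<in> A \<Longrightarrow> Ck_on k (chart_image c) (\<lambda>y. h t c (chart_inv c y))"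
  using Ck_on_slice[OF chart(2) _ smooth_metric] Ck_on_slice[OF chart(2) _ smooth_h] by fastforce+

lemma riem: "t \<in> {0..T} \<Longrightarrow> riem_metric A (g t)"
proof
  assume t: "t \<in> {0..T}"
  show "riemannian_metric A (g t)" using flow t by (simp add: geometric_flow_def)
  show "continuous_on (chart_image c) (\<lambda>y. g t c (chart_inv c y))" if "c \<in> A" for c
    using Ck_on_continuous[OF Ck_on_metric[OF t that, of 0]] .
qed

lemma symmetric_h: "t \<in> {0..T} \<Longrightarrow> symmetric_tensor2 A (h t)"
  using flow by (simp add: geometric_flow_def)

lemma metric_derivative:
  assumes "c \<in> A" "x \<in> fst c" "t \<in> {0..T}"
  shows "((\<lambda>s. g s c x $ i $ j) has_real_derivative ((- 2) *\<^sub>R h t c x) $ i $ j) (at t within {0..T})"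
  using flow assms by (auto simp: geometric_flow_def)

lemma continuous_on_metric_time:
  assumes c: "c \<in> A" "x \<in> fst c" shows "continuous_on {0..T} (\<lambda>s. g s c x)"
proof -
  have "continuous_on {0..T} (\<lambda>s. (\<lambda>(t, y). g t c (chart_inv c y)) (s, snd c x))"
    by (rule continuous_on_compose2[OF Ck_on_continuous[OF smooth_metric[OF c(1), of 0]]])
       (use chart(6)[OF c] in \<open>auto intro!: continuous_intros\<close>)
  then show ?thesis by (simp add: chart(5)[OF c])
qed

lemma invertible_g: "t \<in> {0..T} \<Longrightarrow> c \<in> A \<Longrightarrow> x \<in> fst c \<Longrightarrow> invertible (g t c x)"
  using riem_metric.invertible_metric[OF riem] by blast

lemma H_eq: "t \<in> {0..T} \<Longrightarrow> c \<in> A \<Longrightarrow> x \<in> fst c \<Longrightarrow>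
    H t x = (\<Sum>i\<in>UNIV. \<Sum>j\<in>UNIV. matrix_inv (g t c x) $ i $ j * h t c x $ i $ j)"
  using riem_metric.metric_trace_eq[OF riem symmetric_h] by blast

lemma continuous_on_H_chart:
  assumes c: "c \<in> A" shows "continuous_on ({0..T} \<times> chart_image c) (\<lambda>(t, y). H t (chart_inv c y))"
proof -
  have "continuous_on ({0..T} \<times> chart_image c) (\<lambda>z. \<Sum>i\<in>UNIV. \<Sum>j\<in>UNIV.
      matrix_inv (g (fst z) c (chart_inv c (snd z))) $ i $ j * h (fst z) c (chart_inv c (snd z)) $ i $ j)"
    using Ck_on_continuous[OF smooth_metric[OF c, of 0]] Ck_on_continuous[OF smooth_h[OF c, of 0]]
    by (intro continuous_intros continuous_on_matrix_inv)
       (auto simp: case_prod_unfold intro!: invertible_g c chart(8)[OF c])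
  then show ?thesis
    by (rule continuous_on_eq) (auto simp: H_eq[OF _ c chart(8)[OF c]])
qed

section \<open>Control of the trace, uniform in space and time\<close>

lemma H_bounded: obtains K where "0 < K" "\<And>t x. t \<in> {0..T} \<Longrightarrow> H t x \<le> K"
proof -
  obtain D where D: "finite D" "\<And>c K. (c, K) \<in> D \<Longrightarrow> c \<in> A \<and> compact K \<and> K \<subseteq> chart_image c"
    "\<And>x. \<exists>c K. (c, K) \<in> D \<and> x \<in> chart_inv c ` K" by (rule compact_chart_cover) blast
  have "\<exists>B. \<forall>t\<in>{0..T}. \<forall>y\<in>snd d. H t (chart_inv (fst d) y) \<le> B" if "d \<in> D" for d
  proof -
    obtain c K where d: "d = (c, K)" by fastforce
    with D(2) that have cK: "c \<in> A" "compact K" "K \<subseteq> chart_image c" by auto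
    have "compact ((\<lambda>(t, y). H t (chart_inv c y)) ` ({0..T} \<times> K))"
      using continuous_on_subset[OF continuous_on_H_chart[OF cK(1)], of "{0..T} \<times> K"] cK
      by (intro compact_continuous_image compact_Times) auto
    from compact_imp_bounded[OF this] obtain B where "\<forall>z\<in>{0..T} \<times> K. \<bar>H (fst z) (chart_inv c (snd z))\<bar> \<le> B"
      by (auto simp: bounded_iff case_prod_unfold)
    then show ?thesis by (intro exI[of _ B]) (force simp: d)
  qed
  then obtain B where B: "\<And>d t y. d \<in> D \<Longrightarrow> t \<in> {0..T} \<Longrightarrow> y \<in> snd d \<Longrightarrow> H t (chart_inv (fst d) y) \<le> B d"
    by metis
  show ?thesis
  proof (rule that[of "1 + (\<Sum>d\<in>D. \<bar>B d\<bar>)"])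
    show "0 < 1 + (\<Sum>d\<in>D. \<bar>B d\<bar>)" by (intro add_pos_nonneg sum_nonneg) auto
    fix t x assume t: "t \<in> {0..T}"
    obtain c K y where d: "(c, K) \<in> D" "y \<in> K" "x = chart_inv c y" using D(3)[of x] by blast
    have "H t x \<le> \<bar>B (c, K)\<bar>" using B[OF d(1) t] d by fastforce
    also have "\<dots> \<le> (\<Sum>d\<in>D. \<bar>B d\<bar>)" using d(1) D(1) by (intro member_le_sum) auto
    finally show "H t x \<le> 1 + (\<Sum>d\<in>D. \<bar>B d\<bar>)" by simp
  qed
qed

text \<open>Only the time varies between the two values, so the point can be kept in a single
  compact piece, and the minimum of finitely many moduli serves every \<open>x\<close>.\<close>

lemma H_uniformly_continuous:
  assumes "0 < \<epsilon>"
  obtains \<delta> where "0 < \<delta>" "\<And>s t x. s \<in> {0..T} \<Longrightarrow> t \<in> {0..T} \<Longrightarrow> \<bar>s - t\<bar> < \<delta> \<Longrightarrow> \<bar>H s x - H t x\<bar> < \<epsilon>"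
proof -
  obtain D where D: "finite D" "\<And>c K. (c, K) \<in> D \<Longrightarrow> c \<in> A \<and> compact K \<and> K \<subseteq> chart_image c"
    "\<And>x. \<exists>c K. (c, K) \<in> D \<and> x \<in> chart_inv c ` K" by (rule compact_chart_cover) blast
  have "\<exists>\<delta>>0. \<forall>s\<in>{0..T}. \<forall>t\<in>{0..T}. \<forall>y\<in>snd d. \<bar>s - t\<bar> < \<delta> \<longrightarrow>
      \<bar>H s (chart_inv (fst d) y) - H t (chart_inv (fst d) y)\<bar> < \<epsilon>" if "d \<in> D" for d
  proof -
    obtain c K where d: "d = (c, K)" by fastforce
    with D(2) that have cK: "c \<in> A" "compact K" "K \<subseteq> chart_image c" by auto
    have "uniformly_continuous_on ({0..T} \<times> K) (\<lambda>(t, y). H t (chart_inv c y))"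
      using continuous_on_subset[OF continuous_on_H_chart[OF cK(1)], of "{0..T} \<times> K"] cK
      by (intro compact_uniformly_continuous compact_Times) auto
    from this[unfolded uniformly_continuous_on_def, rule_format, OF assms]
    obtain \<delta> where \<delta>: "0 < \<delta>" "\<And>z z'. z \<in> {0..T} \<times> K \<Longrightarrow> z' \<in> {0..T} \<times> K \<Longrightarrow> dist z' z < \<delta> \<Longrightarrow>
        dist ((\<lambda>(t, y). H t (chart_inv c y)) z') ((\<lambda>(t, y). H t (chart_inv c y)) z) < \<epsilon>" by blast
    show ?thesis
    proof (intro exI[of _ \<delta>] conjI \<delta>(1) ballI impI)
      fix s t y assume "s \<in> {0..T}" "t \<in> {0..T}" "y \<in> snd d" "\<bar>s - t\<bar> < \<delta>"
      then show "\<bar>H s (chart_inv (fst d) y) - H t (chart_inv (fst d) y)\<bar> < \<epsilon>"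
        using \<delta>(2)[of "(t, y)" "(s, y)"] by (simp add: d dist_Pair_Pair dist_real_def)
    qed
  qed
  then obtain \<delta> where \<delta>: "\<And>d. d \<in> D \<Longrightarrow> 0 < \<delta> d" "\<And>d s t y. d \<in> D \<Longrightarrow> s \<in> {0..T} \<Longrightarrow> t \<in> {0..T} \<Longrightarrow> y \<in> snd d \<Longrightarrow>
      \<bar>s - t\<bar> < \<delta> d \<Longrightarrow> \<bar>H s (chart_inv (fst d) y) - H t (chart_inv (fst d) y)\<bar> < \<epsilon>"
    by metis
  show ?thesis
  proof (rule that[of "Min (insert 1 (\<delta> ` D))"])
    show "0 < Min (insert 1 (\<delta> ` D))" using D(1) \<delta>(1) by simp
    fix s t x assume st: "s \<in> {0..T}" "t \<in> {0..T}" "\<bar>s - t\<bar> < Min (insert 1 (\<delta> ` D))"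
    obtain c K y where d: "(c, K) \<in> D" "y \<in> K" "x = chart_inv c y" using D(3)[of x] by blast
    have "\<bar>s - t\<bar> < \<delta> (c, K)" using st(3) D(1) d(1) by simp
    then show "\<bar>H s x - H t x\<bar> < \<epsilon>" using \<delta>(2)[OF d(1) st(1,2)] d(2,3) by simp
  qed
qed

text \<open>Integrals over the moving measures are written over the fixed measure \<open>M0\<close> with the density
  \<open>volr t\<close>, so that the flow is followed pointwise in \<open>x\<close> by ordinary differential inequalities.\<close>

definition volr :: "real \<Rightarrow> 'm \<Rightarrow> real" where
  "volr t x = two_riem_metrics.vol_ratio A (g 0) (g t) x"

text \<open>The selected differential does not depend on \<open>t\<close>: at each point one and the
  same covector is measured by all the metrics, and the energy becomes a smooth function of time
  alone.\<close>

definition en :: "('m \<Rightarrow> real) \<Rightarrow> real \<Rightarrow> 'm \<Rightarrow> real" where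
  "en f t x = riem_metric.energy A (g t) (SOME \<xi>. weak_differential A f \<xi>) x"

definition M0 :: "'m measure" where "M0 = riemannian_measure A (g 0)"

lemma two_metrics: "t \<in> {0..T} \<Longrightarrow> two_riem_metrics A (g 0) (g t)"
  using riem T by (intro two_riem_metrics.intro) auto

lemma sets_M0 [measurable_cong, simp]: "sets M0 = sets borel"
  using riem_metric.sets_riemannian_measure[OF riem] T by (auto simp: M0_def)

lemma volr_eq: "t \<in> {0..T} \<Longrightarrow> c = chart_at A x \<Longrightarrow> volr t x = sqrt (det (g t c x)) / sqrt (det (g 0 c x))"
  by (simp add: volr_def two_riem_metrics.vol_ratio_def[OF two_metrics] Let_def)

lemma det_g_pos: "t \<in> {0..T} \<Longrightarrow> c \<in> A \<Longrightarrow> x \<in> fst c \<Longrightarrow> 0 < det (g t c x)"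
  using posdef_det_pos riem_metric.posdef_metric[OF riem] by blast

lemma volr_pos: "t \<in> {0..T} \<Longrightarrow> 0 < volr t x"
  using T det_g_pos[OF _ chart_at] by (simp add: volr_eq)

lemma volr_measurable: "t \<in> {0..T} \<Longrightarrow> volr t \<in> borel_measurable borel"
  using borel_measurable_continuous_onI[OF two_riem_metrics.continuous_on_vol_ratio[OF two_metrics]]
  unfolding volr_def[abs_def] .

lemma H_measurable: "t \<in> {0..T} \<Longrightarrow> H t \<in> borel_measurable borel"
proof -
  assume t: "t \<in> {0..T}"
  show ?thesis
    by (rule borel_measurable_continuous_onI, rule riem_metric.continuous_on_metric_trace[OF riem[OF t] symmetric_h[OF t]])
       (rule Ck_on_continuous[OF Ck_on_h[OF t, where k = 0]])
qed

lemma riem_measure_density: "t \<in> {0..T} \<Longrightarrow> riemannian_measure A (g t) = density M0 (\<lambda>x. ennreal (volr t x))"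
  unfolding M0_def volr_def by (rule two_riem_metrics.riemannian_measure_density[OF two_metrics])

lemma integral_riem:
  fixes F :: "'m \<Rightarrow> real"
  assumes t: "t \<in> {0..T}" and F: "F \<in> borel_measurable borel"
  shows "integrable (riemannian_measure A (g t)) F \<longleftrightarrow> integrable M0 (\<lambda>x. volr t x * F x)"
    "(LINT x|riemannian_measure A (g t). F x) = (LINT x|M0. volr t x * F x)"
proof -
  have [measurable]: "volr t \<in> borel_measurable M0" "F \<in> borel_measurable M0"
    using volr_measurable[OF t] F by auto
  have nn: "AE x in M0. 0 \<le> volr t x" using volr_pos[OF t] by (intro AE_I2) (simp add: less_imp_le)
  show "integrable (riemannian_measure A (g t)) F \<longleftrightarrow> integrable M0 (\<lambda>x. volr t x * F x)"
    unfolding riem_measure_density[OF t] by (rule integrable_real_density[OF _ nn]) measurable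
  show "(LINT x|riemannian_measure A (g t). F x) = (LINT x|M0. volr t x * F x)"
    unfolding riem_measure_density[OF t] by (rule integral_real_density[OF _ nn]) measurable
qed

lemma AE_riem: "t \<in> {0..T} \<Longrightarrow> (AE x in riemannian_measure A (g t). Q x) \<longleftrightarrow> (AE x in M0. Q x)"
proof -
  assume t: "t \<in> {0..T}"
  then have "(\<lambda>x. ennreal (volr t x)) \<in> borel_measurable M0" using volr_measurable by auto
  then show ?thesis unfolding riem_measure_density[OF t] using volr_pos[OF t] by (simp add: AE_density)
qed

text \<open>Jacobi's formula with \<open>g' = - 2 h\<close> gives the determinant the logarithmic
  derivative -2 H, which the square root halves. The reference density at time 0 is a constant
  factor.\<close>

lemma volr_derivative:
  assumes t: "t \<in> {0..T}"
  shows "((\<lambda>s. volr s x) has_real_derivative - H t x * volr t x) (at t within {0..T})"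
proof -
  define c where "c = chart_at A x"
  have c: "c \<in> A" "x \<in> fst c" by (simp_all add: c_def chart_at)
  let ?d = "\<lambda>s. det (g s c x)"
  have d0: "0 < ?d 0" "0 < ?d t" using det_g_pos[OF _ c] T t by auto
  have sym: "h t c x $ j $ i = h t c x $ i $ j" for i j
    using symmetric_h[OF t] c by (intro symmetric_component) (auto simp: symmetric_tensor2_def)
  have "(?d has_real_derivative ?d t * (\<Sum>i\<in>UNIV. \<Sum>j\<in>UNIV.
      matrix_inv (g t c x) $ i $ j * ((- 2) *\<^sub>R h t c x) $ j $ i)) (at t within {0..T})"
    by (rule has_real_derivative_det[OF metric_derivative[OF c t] invertible_g[OF t c]])
  also have "(\<Sum>i\<in>UNIV. \<Sum>j\<in>UNIV. matrix_inv (g t c x) $ i $ j * ((- 2) *\<^sub>R h t c x) $ j $ i) = - 2 * H t x"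
    unfolding H_eq[OF t c] sum_distrib_left by (intro sum.cong refl) (simp add: sym)
  finally have "(?d has_real_derivative - 2 * H t x * ?d t) (at t within {0..T})" by (simp add: mult_ac)
  from DERIV_chain'[OF this DERIV_real_sqrt[OF d0(2)]]
  have "((\<lambda>s. sqrt (?d s)) has_real_derivative inverse (sqrt (?d t)) / 2 * (- 2 * H t x * ?d t)) (at t within {0..T})" .
  also have "inverse (sqrt (?d t)) / 2 * (- 2 * H t x * ?d t) = - H t x * sqrt (?d t)"
  proof -
    have "?d t = sqrt (?d t) * sqrt (?d t)" using d0(2) by simp
    then show ?thesis using d0(2) by (simp add: field_simps)
  qed
  finally have "((\<lambda>s. sqrt (?d s) / sqrt (?d 0)) has_real_derivative - H t x * sqrt (?d t) / sqrt (?d 0)) (at t within {0..T})"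
    by (rule DERIV_cdivide)
  then show ?thesis
    by (rule has_field_derivative_transform_within[OF _ zero_less_one t, THEN DERIV_cong])
       (use t in \<open>auto simp: volr_eq c_def\<close>)
qed

lemma en_eq: "t \<in> {0..T} \<Longrightarrow> c = chart_at A x \<Longrightarrow> \<xi> = (SOME \<xi>. weak_differential A f \<xi>) c x \<Longrightarrow>
    en f t x = \<xi> \<bullet> (matrix_inv (g t c x) *v \<xi>)"
  by (simp add: en_def riem_metric.energy_def[OF riem] Let_def)

lemma en_nonneg: "t \<in> {0..T} \<Longrightarrow> 0 \<le> en f t x"
  unfolding en_def by (rule riem_metric.energy_nonneg[OF riem])

lemma en_add_const: "en (\<lambda>x. f x + k) = en f"
  by (simp add: en_def[abs_def] weak_differential_add_const_eq)

lemma en_diff_const: "en (\<lambda>x. f x - k) = en f"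
  using en_add_const[of f "- k"] by simp

lemma en_measurable:
  assumes "t \<in> {0..T}" "\<exists>\<xi>. weak_differential A f \<xi>" shows "en f t \<in> borel_measurable borel"
  using riem_metric.energy_measurable[OF riem[OF assms(1)]] someI_ex[OF assms(2)]
  unfolding en_def[abs_def] by blast

text \<open>Inverting the metric reverses the sign of -2 h, and \<open>V\<close> is the covector
  with its index raised, so the derivative equals 2 h(V, V), to which the pinching applies.\<close>

lemma en_derivative:
  assumes t: "t \<in> {0..T}"
  obtains E' where "((\<lambda>s. en f s x) has_real_derivative E') (at t within {0..T})"
    "2 * \<alpha> * H t x * en f t x \<le> E'"
proof -
  define c where "c = chart_at A x"
  have c: "c \<in> A" "x \<in> fst c" by (simp_all add: c_def chart_at)
  define \<xi> where "\<xi> = (SOME \<xi>. weak_differential A f \<xi>) c x"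
  let ?P = "matrix_inv (g t c x)"
  define V where "V = ?P *v \<xi>"
  have pdP: "posdef ?P" using posdef_matrix_inv riem_metric.posdef_metric[OF riem[OF t] c] by blast
  have symP: "transpose ?P = ?P" using pdP by (simp add: posdef_def)
  let ?Q = "- (?P ** ((- 2) *\<^sub>R h t c x) ** ?P)"
  have dP: "((\<lambda>s. matrix_inv (g s c x) $ i $ j) has_real_derivative ?Q $ i $ j) (at t within {0..T})" for i j
    using has_real_derivative_matrix_inv[OF metric_derivative[OF c t] invertible_g[OF _ c] t continuous_on_metric_time[OF c], of i j] by simp
  have "((\<lambda>s. \<Sum>i\<in>UNIV. \<Sum>j\<in>UNIV. matrix_inv (g s c x) $ i $ j * (\<xi> $ i * \<xi> $ j)) has_real_derivative
      (\<Sum>i\<in>UNIV. \<Sum>j\<in>UNIV. ?Q $ i $ j * (\<xi> $ i * \<xi> $ j))) (at t within {0..T})"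
    by (intro DERIV_sum DERIV_cmult_right dP)
  then have "((\<lambda>s. \<xi> \<bullet> (matrix_inv (g s c x) *v \<xi>)) has_real_derivative \<xi> \<bullet> (?Q *v \<xi>)) (at t within {0..T})"
    by (simp only: quadratic_form_eq_inner[symmetric] mult.assoc)
  then have der: "((\<lambda>s. en f s x) has_real_derivative \<xi> \<bullet> (?Q *v \<xi>)) (at t within {0..T})"
    by (rule has_field_derivative_transform_within[OF _ zero_less_one t])
       (simp add: en_eq[OF _ c_def \<xi>_def])
  have Q: "\<xi> \<bullet> (?Q *v \<xi>) = 2 * (V \<bullet> (h t c x *v V))"
  proof -
    have "?Q = (- 1) *\<^sub>R (?P ** ((- 2) *\<^sub>R h t c x) ** ?P)" by simp
    then have "?Q *v \<xi> = (- 1) *\<^sub>R (?P *v ((- 2) *\<^sub>R (h t c x *v V)))"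
      by (simp only: V_def matrix_vector_mul_assoc[symmetric] scaleR_matrix_vector_assoc[symmetric])
    also have "\<dots> = ?P *v (2 *\<^sub>R (h t c x *v V))"
      by (simp only: matrix_vector_mult_scaleR scaleR_scaleR) simp
    finally have "?Q *v \<xi> = ?P *v (2 *\<^sub>R (h t c x *v V))" .
    moreover have "\<xi> \<bullet> (?P *v w) = (transpose ?P *v \<xi>) \<bullet> w" for w
      by (simp add: transpose_matrix_vector dot_lmul_matrix)
    ultimately show ?thesis by (simp only: symP V_def[symmetric] inner_scaleR_right)
  qed
  have gV: "V \<bullet> (g t c x *v V) = en f t x"
  proof -
    have "g t c x *v V = \<xi>"
      unfolding V_def by (simp add: matrix_vector_mul_assoc matrix_inv_works[OF invertible_g[OF t c]])
    then show ?thesis unfolding en_eq[OF t c_def \<xi>_def] V_def by (simp add: inner_commute)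
  qed
  have "0 \<le> V \<bullet> ((h t c x - (\<alpha> * H t x) *\<^sub>R g t c x) *v V)"
    using pinched[OF t] c unfolding tensor2_nonneg_def quadratic_form_eq_inner by blast
  then have "\<alpha> * H t x * en f t x \<le> V \<bullet> (h t c x *v V)"
    by (simp add: matrix_vector_mult_diff_rdistrib inner_diff_right scaleR_matrix_vector_assoc[symmetric] gV)
  with der Q show ?thesis by (intro that) auto
qed

text \<open>\<kappa> is a free lower barrier for the time integral of \<open>H\<close>: 0 for
  monotonicity, a linear function in the difference quotients, a primitive of \<psi> for the
  exponential bound.\<close>

lemma volr_decay:
  assumes ab: "a \<in> {0..T}" "b \<in> {0..T}" "a \<le> b"
    and \<kappa>: "\<And>s. s \<in> {0..T} \<Longrightarrow> (\<kappa> has_real_derivative \<kappa>' s) (at s within {0..T})"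
    and le: "\<And>s. s \<in> {a..b} \<Longrightarrow> \<kappa>' s \<le> H s x"
  shows "volr b x * exp (\<kappa> b - \<kappa> a) \<le> volr a x"
proof -
  \<comment> \<open>The growth lemma bounds from below, so an upper bound on the density is obtained
    from its negative and the rate -\<kappa>'.\<close>
  have "- volr a x * exp (- \<kappa> b - - \<kappa> a) \<le> - volr b x"
  proof (rule exponential_growth_bound[where S = "{0..T}"])
    show "((\<lambda>s. - volr s x) has_real_derivative H s x * volr s x) (at s within {0..T})" if "s \<in> {0..T}" for s
      using DERIV_minus[OF volr_derivative[OF that]] by simp
    show "((\<lambda>s. - \<kappa> s) has_real_derivative - \<kappa>' s) (at s within {0..T})" if "s \<in> {0..T}" for s
      by (rule DERIV_minus[OF \<kappa>[OF that]])
    show "- \<kappa>' s * - volr s x \<le> H s x * volr s x" if "s \<in> {a..b}" for s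
      using le[OF that] volr_pos[of s x] ab that by (simp add: mult_right_mono)
  qed (use ab in auto)
  then have "volr b x * exp (\<kappa> b - \<kappa> a) \<le> (volr a x * exp (\<kappa> a - \<kappa> b)) * exp (\<kappa> b - \<kappa> a)"
    by (intro mult_right_mono) auto
  also have "\<dots> = volr a x" by (simp add: mult.assoc exp_add[symmetric])
  finally show ?thesis .
qed

text \<open>The reverse comparison, with an upper bound on \<open>H\<close>; it carries
  integrability from a later to an earlier time.\<close>

lemma volr_decay_bound:
  assumes ab: "a \<in> {0..T}" "b \<in> {0..T}" "a \<le> b" and K: "\<And>s. s \<in> {0..T} \<Longrightarrow> H s x \<le> K"
  shows "volr a x \<le> volr b x * exp (K * (b - a))"
proof -
  have "volr a x * exp (- K * b - - K * a) \<le> volr b x"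
  proof (rule exponential_growth_bound[where S = "{0..T}"])
    show "((\<lambda>s. volr s x) has_real_derivative - H s x * volr s x) (at s within {0..T})" if "s \<in> {0..T}" for s
      by (rule volr_derivative[OF that])
    show "((\<lambda>s. - K * s) has_real_derivative - K) (at s within {0..T})" for s
      by (auto intro!: derivative_eq_intros)
    show "- K * volr s x \<le> - H s x * volr s x" if "s \<in> {a..b}" for s
      using K[of s] volr_pos[of s x] ab that by (simp add: mult_right_mono)
  qed (use ab in auto)
  then have "(volr a x * exp (- K * b - - K * a)) * exp (K * (b - a)) \<le> volr b x * exp (K * (b - a))"
    by (intro mult_right_mono) auto
  then show ?thesis by (simp add: mult.assoc exp_add[symmetric] algebra_simps)
qed

text \<open>The power p / 2 of the energy contributes the rate \<alpha> p H and the density -H. A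
  zero covector has zero energy at all times; any other has positive energy at all times, so that
  the power is differentiable.\<close>

lemma energy_growth:
  assumes ab: "a \<in> {0..T}" "b \<in> {0..T}" "a \<le> b"
    and \<kappa>: "\<And>s. s \<in> {0..T} \<Longrightarrow> (\<kappa> has_real_derivative \<kappa>' s) (at s within {0..T})"
    and le: "\<And>s. s \<in> {a..b} \<Longrightarrow> \<kappa>' s \<le> H s x"
  shows "volr a x * en f a x powr (p / 2) * exp ((\<alpha> * p - 1) * (\<kappa> b - \<kappa> a)) \<le> volr b x * en f b x powr (p / 2)"
proof -
  define c where "c = chart_at A x"
  have c: "c \<in> A" "x \<in> fst c" by (simp_all add: c_def chart_at)
  define \<xi> where "\<xi> = (SOME \<xi>. weak_differential A f \<xi>) c x"
  show ?thesis
  proof (cases "\<xi> = 0")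
    case True
    then show ?thesis using ab by (simp add: en_eq[OF _ c_def \<xi>_def])
  next
    case False
    have pos: "0 < en f s x" if "s \<in> {0..T}" for s
      unfolding en_eq[OF that c_def \<xi>_def]
      using posdef_matrix_inv[OF riem_metric.posdef_metric[OF riem[OF that] c]] False
      by (simp add: posdef_def)
    have "\<exists>e. ((\<lambda>s. en f s x) has_real_derivative e) (at s within {0..T}) \<and> 2 * \<alpha> * H s x * en f s x \<le> e"
      if "s \<in> {0..T}" for s by (rule en_derivative[OF that, of f x]) blast
    then obtain E' where E': "\<And>s. s \<in> {0..T} \<Longrightarrow> ((\<lambda>s. en f s x) has_real_derivative E' s) (at s within {0..T})"
      "\<And>s. s \<in> {0..T} \<Longrightarrow> 2 * \<alpha> * H s x * en f s x \<le> E' s"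
      by metis
    have "volr a x * en f a x powr (p / 2) * exp ((\<alpha> * p - 1) * \<kappa> b - (\<alpha> * p - 1) * \<kappa> a)
      \<le> volr b x * en f b x powr (p / 2)"
    proof (rule exponential_growth_bound[where S = "{0..T}"])
      fix s assume s: "s \<in> {0..T}"
      have "((\<lambda>s. en f s x powr (p / 2)) has_real_derivative
          (p / 2) * en f s x powr (p / 2 - 1) * E' s) (at s within {0..T})"
        using DERIV_chain'[OF E'(1)[OF s] has_real_derivative_powr[OF pos[OF s]]] .
      from DERIV_mult[OF volr_derivative[OF s] this]
      show "((\<lambda>s. volr s x * en f s x powr (p / 2)) has_real_derivative
          - H s x * volr s x * en f s x powr (p / 2) +
          (p / 2) * en f s x powr (p / 2 - 1) * E' s * volr s x) (at s within {0..T})" .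
      show "((\<lambda>s. (\<alpha> * p - 1) * \<kappa> s) has_real_derivative (\<alpha> * p - 1) * \<kappa>' s) (at s within {0..T})"
        by (rule DERIV_cmult[OF \<kappa>[OF s]])
    next
      fix s assume s: "s \<in> {a..b}"
      then have s': "s \<in> {0..T}" using ab by auto
      let ?y = "volr s x * en f s x powr (p / 2)"
      have y0: "0 \<le> ?y" using volr_pos[OF s', of x] by simp
      have pw: "en f s x powr (p / 2 - 1) * en f s x = en f s x powr (p / 2)"
        using pos[OF s'] powr_mult_base[of "en f s x" "p / 2 - 1"] by (simp add: mult.commute)
      have "(\<alpha> * p - 1) * \<kappa>' s * ?y \<le> (\<alpha> * p - 1) * H s x * ?y"
        using alpha_p le[OF s] y0 by (intro mult_right_mono mult_left_mono) auto
      also have "\<dots> = - H s x * ?y + (p / 2) * (en f s x powr (p / 2 - 1) * en f s x) * (2 * \<alpha> * H s x) * volr s x"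
        unfolding pw by (simp add: algebra_simps)
      also have "\<dots> = - H s x * ?y + (p / 2) * en f s x powr (p / 2 - 1) * (2 * \<alpha> * H s x * en f s x) * volr s x"
        by (simp add: mult_ac)
      also have "\<dots> \<le> - H s x * ?y + (p / 2) * en f s x powr (p / 2 - 1) * E' s * volr s x"
        using E'(2)[OF s'] p volr_pos[OF s', of x]
        by (intro add_left_mono mult_right_mono mult_left_mono) auto
      finally show "(\<alpha> * p - 1) * \<kappa>' s * ?y \<le> - H s x * volr s x * en f s x powr (p / 2) +
          (p / 2) * en f s x powr (p / 2 - 1) * E' s * volr s x" by (simp add: mult_ac)
    qed (use ab in auto)
    then show ?thesis by (simp add: right_diff_distrib)
  qed
qed

end

section \<open>The eigenvalue along the flow\<close>

text \<open>The difference quotients \<open>(f t - f (t - s)) / s\<close> are integrated over \<open>t\<close>, which avoids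
  differentiability of \<open>f\<close>.\<close>

lemma mono_on_integral_le_increment:
  fixes f \<theta> :: "real \<Rightarrow> real"
  assumes mono: "mono_on {0..T} f" and t: "0 \<le> t1" "t1 < t2" "t2 \<le> T"
    and int: "\<theta> integrable_on {t1..t2}"
    and quot: "\<And>\<epsilon>. 0 < \<epsilon> \<Longrightarrow> \<exists>\<delta>>0. \<forall>t s. t \<le> T \<and> 0 < s \<and> s < \<delta> \<and> 0 \<le> t - s \<longrightarrow>
      s * (\<theta> t - \<epsilon>) \<le> f t - f (t - s)"
  shows "f t1 + integral {t1..t2} \<theta> \<le> f t2"
proof (rule field_le_epsilon)
  fix e :: real assume e: "0 < e"
  \<comment> \<open>One \<epsilon> pays for the integral of \<theta> over the short initial interval
    lost by the shift, the term \<epsilon> (t2 - t1) for the error in the quotients.\<close>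
  define \<epsilon> where "\<epsilon> = e / (1 + (t2 - t1))"
  have "\<epsilon> * (1 + (t2 - t1)) = e" using t by (simp add: \<epsilon>_def)
  then have \<epsilon>: "0 < \<epsilon>" "\<epsilon> + \<epsilon> * (t2 - t1) = e" using e t by (simp_all add: \<epsilon>_def distrib_left)
  obtain \<delta> where \<delta>: "0 < \<delta>" "\<And>t s. t \<le> T \<Longrightarrow> 0 < s \<Longrightarrow> s < \<delta> \<Longrightarrow> 0 \<le> t - s \<Longrightarrow>
      s * (\<theta> t - \<epsilon>) \<le> f t - f (t - s)" using quot[OF \<epsilon>(1)] by blast
  have "continuous_on {t1..t2} (\<lambda>x. integral {t1..x} \<theta>)" by (rule indefinite_integral_continuous_1[OF int])
  then obtain d where d: "0 < d" "\<And>x. x \<in> {t1..t2} \<Longrightarrow> dist x t1 < d \<Longrightarrow>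
      dist (integral {t1..x} \<theta>) (integral {t1..t1} \<theta>) < \<epsilon>"
    using t \<epsilon>(1) unfolding continuous_on_iff by (metis atLeastAtMost_iff less_imp_le order_refl)
  define s where "s = min (min \<delta> d) (t2 - t1) / 2"
  have s: "0 < s" "s < \<delta>" "s < d" "s < t2 - t1" using \<delta>(1) d(1) t by (auto simp: s_def)
  have fint: "f integrable_on {a..b}" if "0 \<le> a" "b \<le> T" for a b
    using that by (intro integrable_on_mono_on mono_on_subset[OF mono]) auto
  have \<theta>int: "\<theta> integrable_on {a..b}" if "t1 \<le> a" "b \<le> t2" for a b
    using that by (intro integrable_on_subinterval[OF int]) auto
  have sh: "(f \<circ> (+) (- s)) integrable_on {t1 + s..t2}"
    using has_integral_shift_Icc_real[of f "- s" _ "t1 + s" t2] fint[of t1 "t2 - s"] t s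
    by (auto simp: integrable_on_def)
  have "integral {t1 + s..t2} (\<lambda>t. s * (\<theta> t - \<epsilon>)) \<le> integral {t1 + s..t2} (\<lambda>t. f t - (f \<circ> (+) (- s)) t)"
  proof (rule integral_le)
    show "(\<lambda>t. s * (\<theta> t - \<epsilon>)) integrable_on {t1 + s..t2}"
    proof -
      have "(\<lambda>t. \<theta> t - \<epsilon>) integrable_on {t1 + s..t2}"
        using s by (intro integrable_diff \<theta>int integrable_const_ivl) auto
      from integrable_cmul[OF this, of s] show ?thesis by simp
    qed
    show "(\<lambda>t. f t - (f \<circ> (+) (- s)) t) integrable_on {t1 + s..t2}"
      using t s by (intro integrable_diff fint sh) auto
    show "s * (\<theta> x - \<epsilon>) \<le> f x - (f \<circ> (+) (- s)) x" if "x \<in> {t1 + s..t2}" for x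
      using \<delta>(2)[of x s] that s t by (simp add: add.commute)
  qed
  also have "integral {t1 + s..t2} (\<lambda>t. s * (\<theta> t - \<epsilon>)) = s * (integral {t1 + s..t2} \<theta> - \<epsilon> * (t2 - t1 - s))"
  proof -
    have "integral {t1 + s..t2} (\<lambda>t. \<theta> t - \<epsilon>) = integral {t1 + s..t2} \<theta> - integral {t1 + s..t2} (\<lambda>_. \<epsilon>)"
      using s by (intro integral_diff \<theta>int integrable_const_ivl) auto
    also have "integral {t1 + s..t2} (\<lambda>_. \<epsilon>) = \<epsilon> * (t2 - t1 - s)" using s by (simp add: mult.commute)
    finally show ?thesis by (simp only: integral_mult_right)
  qed
  also have "integral {t1 + s..t2} (\<lambda>t. f t - (f \<circ> (+) (- s)) t) = integral {t1 + s..t2} f - integral {t1..t2 - s} f"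
    using integral_shift_Icc_real[of "t1 + s" t2 f "- s"] t s by (subst integral_diff) (auto intro!: fint sh)
  \<comment> \<open>The shifted and unshifted integrals cancel on their overlap; only two end
    intervals of length \<open>s\<close> remain, on which monotonicity of \<open>f\<close> gives the
    bounds.\<close>
  also have "\<dots> = integral {t2 - s..t2} f - integral {t1..t1 + s} f"
    using Henstock_Kurzweil_Integration.integral_combine[of t1 "t1 + s" t2 f]
      Henstock_Kurzweil_Integration.integral_combine[of t1 "t2 - s" t2 f] fint[of t1 t2] t s by simp
  also have "\<dots> \<le> s * f t2 - s * f t1"
  proof -
    have "integral {t2 - s..t2} f \<le> integral {t2 - s..t2} (\<lambda>_. f t2)"
      using t s by (intro integral_le fint) (auto intro!: mono_onD[OF mono])
    moreover have "integral {t1..t1 + s} (\<lambda>_. f t1) \<le> integral {t1..t1 + s} f"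
      using t s by (intro integral_le fint) (auto intro!: mono_onD[OF mono])
    ultimately show ?thesis using s by simp
  qed
  finally have "s * (integral {t1 + s..t2} \<theta> - \<epsilon> * (t2 - t1 - s)) \<le> s * (f t2 - f t1)"
    by (simp add: right_diff_distrib)
  then have "integral {t1 + s..t2} \<theta> - \<epsilon> * (t2 - t1 - s) \<le> f t2 - f t1" using s(1) by simp
  moreover have "integral {t1..t2} \<theta> = integral {t1..t1 + s} \<theta> + integral {t1 + s..t2} \<theta>"
    using Henstock_Kurzweil_Integration.integral_combine[of t1 "t1 + s" t2 \<theta>] int s by simp
  moreover have "\<bar>integral {t1..t1 + s} \<theta>\<bar> < \<epsilon>"
    using d(2)[of "t1 + s"] s by (simp add: dist_real_def)
  moreover have "\<epsilon> * (t2 - t1 - s) \<le> \<epsilon> * (t2 - t1)" using \<epsilon>(1) s(1) by simp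
  ultimately show "f t1 + integral {t1..t2} \<theta> \<le> f t2 + e" using \<epsilon>(2) by linarith
qed

section \<open>Rayleigh quotients over the fixed reference measure\<close>

context pinched_flow
begin

definition lam :: "real \<Rightarrow> real" where "lam t = first_p_eigenvalue A (g t) p"

definition grad_int :: "('m \<Rightarrow> real) \<Rightarrow> real \<Rightarrow> real" where
  "grad_int f t = (LINT x|M0. volr t x * en f t x powr (p / 2))"

definition pow_int :: "('m \<Rightarrow> real) \<Rightarrow> real \<Rightarrow> real" where
  "pow_int f t = (LINT x|M0. volr t x * \<bar>f x\<bar> powr p)"

lemma metric_norm_gradient_powr:
  assumes "t \<in> {0..T}"
  shows "metric_norm A (g t) (gradient A (g t) f) x powr q = en f t x powr (q / 2)"
  using en_nonneg[OF assms, of f x] riem_metric.metric_norm_gradient[OF riem[OF assms], of f x]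
  by (simp add: en_def powr_half_sqrt[symmetric] powr_powr)

lemma en_powr_measurable:
  assumes "t \<in> {0..T}" "\<exists>\<xi>. weak_differential A f \<xi>"
  shows "(\<lambda>x. en f t x powr q) \<in> borel_measurable borel"
  using en_measurable[OF assms] by measurable

lemma sobolev_iff:
  assumes t: "t \<in> {0..T}"
  shows "f \<in> sobolev A (g t) p \<longleftrightarrow> f \<in> borel_measurable borel \<and> (\<exists>\<xi>. weak_differential A f \<xi>) \<and>
    integrable M0 (\<lambda>x. volr t x * \<bar>f x\<bar> powr p) \<and> integrable M0 (\<lambda>x. volr t x * en f t x powr (p / 2))"
proof -
  have "(\<lambda>x. \<bar>f x\<bar> powr p) \<in> borel_measurable borel" if "f \<in> borel_measurable borel"
    using that by measurable
  then show ?thesis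
    using integral_riem(1)[OF t] en_powr_measurable[OF t, of f "p / 2"]
    unfolding sobolev_def metric_norm_gradient_powr[OF t] by blast
qed

lemma sobolevD:
  assumes t: "t \<in> {0..T}" and f: "f \<in> sobolev A (g t) p"
  shows "f \<in> borel_measurable borel" "\<exists>\<xi>. weak_differential A f \<xi>"
    "integrable M0 (\<lambda>x. volr t x * \<bar>f x\<bar> powr p)" "integrable M0 (\<lambda>x. volr t x * en f t x powr (p / 2))"
    "integrable (riemannian_measure A (g t)) (\<lambda>x. \<bar>f x\<bar> powr p)"
    "(LINT x|riemannian_measure A (g t). \<bar>f x\<bar> powr p) = pow_int f t"
    "(LINT x|riemannian_measure A (g t). metric_norm A (g t) (gradient A (g t) f) x powr p) = grad_int f t"
proof -
  show 1: "f \<in> borel_measurable borel" "\<exists>\<xi>. weak_differential A f \<xi>"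
    "integrable M0 (\<lambda>x. volr t x * \<bar>f x\<bar> powr p)" "integrable M0 (\<lambda>x. volr t x * en f t x powr (p / 2))"
    using f sobolev_iff[OF t] by auto
  have m: "(\<lambda>x. \<bar>f x\<bar> powr p) \<in> borel_measurable borel" using 1(1) by measurable
  show "integrable (riemannian_measure A (g t)) (\<lambda>x. \<bar>f x\<bar> powr p)"
    "(LINT x|riemannian_measure A (g t). \<bar>f x\<bar> powr p) = pow_int f t"
    using integral_riem[OF t m] 1(3) by (auto simp: pow_int_def)
  show "(LINT x|riemannian_measure A (g t). metric_norm A (g t) (gradient A (g t) f) x powr p) = grad_int f t"
    unfolding metric_norm_gradient_powr[OF t]
    using integral_riem(2)[OF t en_powr_measurable[OF t 1(2)]] by (simp add: grad_int_def)
qed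

lemma finite_riem: "t \<in> {0..T} \<Longrightarrow> finite_measure (riemannian_measure A (g t))"
  by (rule riem_metric.finite_measure_riemannian[OF riem])

lemma borel_riem: "t \<in> {0..T} \<Longrightarrow> f \<in> borel_measurable borel \<Longrightarrow> f \<in> borel_measurable (riemannian_measure A (g t))"
  for f :: "'m \<Rightarrow> real"
  using riem_metric.sets_riemannian_measure[OF riem] by (simp cong: measurable_cong_sets)

lemma sobolev_diff_const:
  assumes t: "t \<in> {0..T}" and f: "f \<in> sobolev A (g t) p"
  shows "(\<lambda>x. f x - k) \<in> sobolev A (g t) p"
proof -
  note f' = sobolevD[OF t f]
  have m: "(\<lambda>x. \<bar>f x - k\<bar> powr p) \<in> borel_measurable borel" using f'(1) by measurable
  have "integrable (riemannian_measure A (g t)) (\<lambda>x. \<bar>f x - k\<bar> powr p)"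
    by (rule finite_measure.integrable_powr_diff_const[OF finite_riem[OF t] p borel_riem[OF t f'(1)] f'(5)])
  then have "integrable M0 (\<lambda>x. volr t x * \<bar>f x - k\<bar> powr p)" using integral_riem(1)[OF t m] by simp
  moreover have "\<exists>\<xi>. weak_differential A (\<lambda>x. f x - k) \<xi>"
    using f'(2) weak_differential_add_const_eq[of f "- k"] by simp
  moreover have "(\<lambda>x. f x - k) \<in> borel_measurable borel" using f'(1) by measurable
  ultimately show ?thesis using f'(4) by (simp add: sobolev_iff[OF t] en_diff_const)
qed

text \<open>Going back in time the weighted energy decreases and the density grows by at most a
  constant factor. A function of a later time is therefore a legitimate test function at an earlier
  one.\<close>

lemma sobolev_antimono:
  assumes ab: "a \<in> {0..T}" "b \<in> {0..T}" "a \<le> b" and f: "f \<in> sobolev A (g b) p"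
  shows "f \<in> sobolev A (g a) p"
proof -
  note f' = sobolevD[OF ab(2) f]
  obtain K where K: "0 < K" "\<And>t x. t \<in> {0..T} \<Longrightarrow> H t x \<le> K" by (rule H_bounded) blast
  have [measurable]: "f \<in> borel_measurable borel" "volr a \<in> borel_measurable borel" "en f a \<in> borel_measurable borel"
    using f'(1,2) volr_measurable ab en_measurable by auto
  have "integrable M0 (\<lambda>x. volr a x * \<bar>f x\<bar> powr p)"
  proof (rule Bochner_Integration.integrable_bound)
    show "integrable M0 (\<lambda>x. exp (K * (b - a)) * (volr b x * \<bar>f x\<bar> powr p))"
      using f'(3) by (rule integrable_mult_right)
    show "AE x in M0. norm (volr a x * \<bar>f x\<bar> powr p) \<le> norm (exp (K * (b - a)) * (volr b x * \<bar>f x\<bar> powr p))"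
    proof (intro AE_I2)
      fix x
      have "volr a x * \<bar>f x\<bar> powr p \<le> (volr b x * exp (K * (b - a))) * \<bar>f x\<bar> powr p"
        using volr_decay_bound[OF ab K(2)] by (intro mult_right_mono) auto
      then show "norm (volr a x * \<bar>f x\<bar> powr p) \<le> norm (exp (K * (b - a)) * (volr b x * \<bar>f x\<bar> powr p))"
        using volr_pos[OF ab(1), of x] volr_pos[OF ab(2), of x] by (simp add: abs_mult mult_ac)
    qed
  qed measurable
  moreover have "integrable M0 (\<lambda>x. volr a x * en f a x powr (p / 2))"
  proof (rule Bochner_Integration.integrable_bound[OF f'(4)])
    show "AE x in M0. norm (volr a x * en f a x powr (p / 2)) \<le> norm (volr b x * en f b x powr (p / 2))"
    proof (intro AE_I2)
      fix x
      have "volr a x * en f a x powr (p / 2) * exp ((\<alpha> * p - 1) * (0 - 0)) \<le> volr b x * en f b x powr (p / 2)"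
        by (rule energy_growth[OF ab, of "\<lambda>_. 0" "\<lambda>_. 0"]) (use ab trace_nonneg in auto)
      then show "norm (volr a x * en f a x powr (p / 2)) \<le> norm (volr b x * en f b x powr (p / 2))"
        using volr_pos[OF ab(1), of x] volr_pos[OF ab(2), of x] by (simp add: abs_mult)
    qed
  qed measurable
  ultimately show ?thesis using f'(1,2) by (simp add: sobolev_iff[OF ab(1)])
qed

definition admissible :: "real \<Rightarrow> ('m \<Rightarrow> real) \<Rightarrow> bool" where
  "admissible t f \<longleftrightarrow> f \<in> sobolev A (g t) p \<and> \<not> (AE x in riemannian_measure A (g t). f x = 0) \<and>
     (LINT x|riemannian_measure A (g t). spow p (f x)) = 0"

lemma lam_eq:
  assumes t: "t \<in> {0..T}"
  shows "lam t = Inf {grad_int f t / pow_int f t | f. admissible t f}"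
proof -
  have "{(LINT x|riemannian_measure A (g t). metric_norm A (g t) (gradient A (g t) f) x powr p) /
            (LINT x|riemannian_measure A (g t). \<bar>f x\<bar> powr p) | f.
          f \<in> sobolev A (g t) p \<and> \<not> (AE x in riemannian_measure A (g t). f x = 0) \<and>
          (LINT x|riemannian_measure A (g t). \<bar>f x\<bar> powr (p - 2) * f x) = 0}
    = {grad_int f t / pow_int f t | f. admissible t f}"
    unfolding admissible_def spow_def
    by (intro Collect_cong ex_cong1) (auto simp: sobolevD(6,7)[OF t])
  then show ?thesis by (simp add: lam_def first_p_eigenvalue_def)
qed

lemma volr_nonneg: "t \<in> {0..T} \<Longrightarrow> 0 \<le> volr t x"
  using volr_pos less_imp_le by blast

lemma grad_int_nonneg: "t \<in> {0..T} \<Longrightarrow> 0 \<le> grad_int f t"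
  and pow_int_nonneg: "t \<in> {0..T} \<Longrightarrow> 0 \<le> pow_int f t"
  unfolding grad_int_def pow_int_def
  by (auto intro!: Bochner_Integration.integral_nonneg mult_nonneg_nonneg volr_nonneg)

lemma pow_int_pos:
  assumes t: "t \<in> {0..T}" and f: "f \<in> sobolev A (g t) p" and nz: "\<not> (AE x in riemannian_measure A (g t). f x = 0)"
  shows "0 < pow_int f t"
proof (rule ccontr)
  assume "\<not> 0 < pow_int f t"
  then have "(LINT x|M0. volr t x * \<bar>f x\<bar> powr p) = 0" using pow_int_nonneg[OF t, of f] by (simp add: pow_int_def)
  then have "AE x in M0. volr t x * \<bar>f x\<bar> powr p = 0"
    using integral_nonneg_eq_0_iff_AE[OF sobolevD(3)[OF t f]] volr_nonneg[OF t] by simp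
  then have "AE x in M0. f x = 0"
    by eventually_elim (use volr_pos[OF t] in \<open>auto simp: less_le\<close>)
  then show False using nz by (simp add: AE_riem[OF t])
qed

lemma ex_centered:
  assumes t: "t \<in> {0..T}" and f: "f \<in> sobolev A (g t) p"
  obtains c where "(LINT x|riemannian_measure A (g t). spow p (f x - c)) = 0"
  using finite_measure.ex_spow_centering[OF finite_riem[OF t] p_gt_2 borel_riem[OF t sobolevD(1)[OF t f]] sobolevD(5)[OF t f]]
  by blast

lemma ex_admissible: assumes t: "t \<in> {0..T}" shows "\<exists>f. admissible t f"
proof -
  obtain f where f: "f \<in> sobolev A (g t) p" "\<And>k. \<not> (AE x in riemannian_measure A (g t). f x = k)"
    by (rule riem_metric.ex_nonconstant_sobolev[OF riem[OF t] p]) blast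
  obtain c where "(LINT x|riemannian_measure A (g t). spow p (f x - c)) = 0" by (rule ex_centered[OF t f(1)])
  then have "admissible t (\<lambda>x. f x - c)"
    using f(2)[of c] sobolev_diff_const[OF t f(1)] by (simp add: admissible_def)
  then show ?thesis by blast
qed

lemma lam_le: "t \<in> {0..T} \<Longrightarrow> admissible t f \<Longrightarrow> lam t \<le> grad_int f t / pow_int f t"
  unfolding lam_eq
  by (intro cInf_lower bdd_belowI[of _ 0]) (auto intro!: divide_nonneg_nonneg grad_int_nonneg pow_int_nonneg)

lemma lam_greatest:
  assumes "t \<in> {0..T}" "\<And>f. admissible t f \<Longrightarrow> B \<le> grad_int f t / pow_int f t" shows "B \<le> lam t"
  unfolding lam_eq[OF assms(1)] using assms ex_admissible by (intro cInf_greatest) auto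

lemma lam_nonneg: "t \<in> {0..T} \<Longrightarrow> 0 \<le> lam t"
  by (intro lam_greatest divide_nonneg_nonneg grad_int_nonneg pow_int_nonneg)

text \<open>Clearing the denominator makes the inequality valid also when f - c vanishes almost
  everywhere and no Rayleigh quotient is available.\<close>

lemma lam_centered:
  assumes t: "t \<in> {0..T}" and f: "f \<in> sobolev A (g t) p"
  obtains c where "lam t * pow_int (\<lambda>x. f x - c) t \<le> grad_int f t"
proof -
  obtain c where c: "(LINT x|riemannian_measure A (g t). spow p (f x - c)) = 0" by (rule ex_centered[OF t f])
  have fc: "(\<lambda>x. f x - c) \<in> sobolev A (g t) p" by (rule sobolev_diff_const[OF t f])
  have gr: "grad_int (\<lambda>x. f x - c) t = grad_int f t" by (simp add: grad_int_def en_diff_const)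
  show ?thesis
  proof (rule that[of c], cases "AE x in riemannian_measure A (g t). f x - c = 0")
    case True
    then have "AE x in M0. f x - c = 0" by (simp only: AE_riem[OF t])
    then have "AE x in M0. volr t x * \<bar>f x - c\<bar> powr p = 0" by eventually_elim simp
    then have "pow_int (\<lambda>x. f x - c) t = 0" unfolding pow_int_def by (rule integral_eq_zero_AE)
    then show "lam t * pow_int (\<lambda>x. f x - c) t \<le> grad_int f t" using grad_int_nonneg[OF t] by simp
  next
    case False
    then have "admissible t (\<lambda>x. f x - c)" using fc c by (simp add: admissible_def)
    then have "lam t \<le> grad_int f t / pow_int (\<lambda>x. f x - c) t" using lam_le[OF t] gr by fastforce
    then show "lam t * pow_int (\<lambda>x. f x - c) t \<le> grad_int f t"
      using pow_int_pos[OF t fc False] by (simp add: field_simps)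
  qed
qed

text \<open>A function admissible at the later time \<open>b\<close> is recentred and tested at
  \<open>a\<close>. The factor \<alpha> p is the sum of \<alpha> p - 1 from the numerator and 1 from
  the denominator. The trivial barrier gives monotonicity of \<open>lam\<close>, a primitive of
  \<psi> the exponential bound.\<close>

lemma lam_growth:
  assumes ab: "a \<in> {0..T}" "b \<in> {0..T}" "a \<le> b"
    and \<kappa>: "\<And>s. s \<in> {0..T} \<Longrightarrow> (\<kappa> has_real_derivative \<kappa>' s) (at s within {0..T})"
    and le: "\<And>s x. s \<in> {0..T} \<Longrightarrow> \<kappa>' s \<le> H s x"
  shows "lam a * exp (\<alpha> * p * (\<kappa> b - \<kappa> a)) \<le> lam b"
proof (rule lam_greatest[OF ab(2)])
  fix f assume f: "admissible b f"
  let ?\<Delta> = "\<kappa> b - \<kappa> a" and ?\<mu> = "riemannian_measure A (g b)"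
  have fb: "f \<in> sobolev A (g b) p" and f0: "\<not> (AE x in ?\<mu>. f x = 0)" and fS: "(LINT x|?\<mu>. spow p (f x)) = 0"
    using f by (auto simp: admissible_def)
  have fa: "f \<in> sobolev A (g a) p" by (rule sobolev_antimono[OF ab fb])
  note fb' = sobolevD[OF ab(2) fb] and fa' = sobolevD[OF ab(1) fa]
  obtain c where c: "lam a * pow_int (\<lambda>x. f x - c) a \<le> grad_int f a" by (rule lam_centered[OF ab(1) fa])
  have fcb: "(\<lambda>x. f x - c) \<in> sobolev A (g b) p" by (rule sobolev_diff_const[OF ab(2) fb])
  have fca: "(\<lambda>x. f x - c) \<in> sobolev A (g a) p" by (rule sobolev_diff_const[OF ab(1) fa])
  note fcb' = sobolevD[OF ab(2) fcb] and fca' = sobolevD[OF ab(1) fca]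
  have sab: "s \<in> {0..T}" if "s \<in> {a..b}" for s using that ab by auto
  have g1: "grad_int f a * exp ((\<alpha> * p - 1) * ?\<Delta>) \<le> grad_int f b"
  proof -
    have "grad_int f a * exp ((\<alpha> * p - 1) * ?\<Delta>)
      = (LINT x|M0. volr a x * en f a x powr (p / 2) * exp ((\<alpha> * p - 1) * ?\<Delta>))"
      by (simp add: grad_int_def)
    also have "\<dots> \<le> grad_int f b"
      unfolding grad_int_def
      using fa'(4) fb'(4) sab by (intro integral_mono energy_growth[OF ab \<kappa>] le) auto
    finally show ?thesis .
  qed
  have p1: "pow_int (\<lambda>x. f x - c) b * exp ?\<Delta> \<le> pow_int (\<lambda>x. f x - c) a"
  proof -
    have "pow_int (\<lambda>x. f x - c) b * exp ?\<Delta> = (LINT x|M0. volr b x * \<bar>f x - c\<bar> powr p * exp ?\<Delta>)"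
      by (simp add: pow_int_def)
    also have "\<dots> \<le> pow_int (\<lambda>x. f x - c) a"
      unfolding pow_int_def
    proof (intro integral_mono)
      fix x
      have "(volr b x * exp ?\<Delta>) * \<bar>f x - c\<bar> powr p \<le> volr a x * \<bar>f x - c\<bar> powr p"
        using sab by (intro mult_right_mono volr_decay[OF ab \<kappa>] le) auto
      then show "volr b x * \<bar>f x - c\<bar> powr p * exp ?\<Delta> \<le> volr a x * \<bar>f x - c\<bar> powr p"
        by (simp add: mult_ac)
    qed (use fcb'(3) fca'(3) in auto)
    finally show ?thesis .
  qed
  \<comment> \<open>The constraint at \<open>b\<close> removes the linear term of the tangent
    inequality, so shifting by \<open>c\<close> can only increase the mass at that time.\<close>
  have p2: "pow_int f b \<le> pow_int (\<lambda>x. f x - c) b"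
  proof -
    have intS: "integrable ?\<mu> (\<lambda>x. spow p (f x))"
      by (rule finite_measure.integrable_spow[OF finite_riem[OF ab(2)] p_gt_2 borel_riem[OF ab(2) fb'(1)] fb'(5)])
    have "pow_int f b = (LINT x|?\<mu>. \<bar>f x\<bar> powr p + (- p * c) * spow p (f x))"
      using intS fb'(5) fS fb'(6) by simp
    also have "\<dots> \<le> (LINT x|?\<mu>. \<bar>f x - c\<bar> powr p)"
    proof (intro integral_mono)
      show "integrable ?\<mu> (\<lambda>x. \<bar>f x\<bar> powr p + (- p * c) * spow p (f x))" using intS fb'(5) by simp
      show "integrable ?\<mu> (\<lambda>x. \<bar>f x - c\<bar> powr p)" using fcb'(5) .
      show "\<bar>f x\<bar> powr p + (- p * c) * spow p (f x) \<le> \<bar>f x - c\<bar> powr p" for x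
        using powr_above_tangent[of p "f x" "f x - c"] p_gt_2 by (simp add: mult_ac)
    qed
    finally show ?thesis using fcb'(6) by simp
  qed
  have "(lam a * exp (\<alpha> * p * ?\<Delta>)) * pow_int f b
    = lam a * (pow_int f b * exp ?\<Delta>) * exp ((\<alpha> * p - 1) * ?\<Delta>)"
    by (simp add: mult.assoc exp_add[symmetric] left_diff_distrib)
  also have "\<dots> \<le> lam a * pow_int (\<lambda>x. f x - c) a * exp ((\<alpha> * p - 1) * ?\<Delta>)"
  proof (intro mult_right_mono mult_left_mono lam_nonneg[OF ab(1)])
    have "pow_int f b * exp ?\<Delta> \<le> pow_int (\<lambda>x. f x - c) b * exp ?\<Delta>" using p2 by (intro mult_right_mono) auto
    with p1 show "pow_int f b * exp ?\<Delta> \<le> pow_int (\<lambda>x. f x - c) a" by linarith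
  qed auto
  also have "\<dots> \<le> grad_int f a * exp ((\<alpha> * p - 1) * ?\<Delta>)" using c by (intro mult_right_mono) auto
  also note g1
  finally show "lam a * exp (\<alpha> * p * ?\<Delta>) \<le> grad_int f b / pow_int f b"
    using pow_int_pos[OF ab(2) fb f0] by (simp add: field_simps)
qed

lemma lam_mono: "mono_on {0..T} lam"
proof (rule mono_onI)
  fix a b assume "a \<in> {0..T}" "b \<in> {0..T}" "a \<le> b"
  from lam_growth[OF this, of "\<lambda>_. 0" "\<lambda>_. 0"] trace_nonneg show "lam a \<le> lam b" by simp
qed

end

section \<open>Difference quotients of the eigenvalue\<close>

text \<open>From exp y \<ge> 1 + y and the identity (1 - y + y^2) (1 + y) = 1 + y^3.\<close>

lemma exp_minus_le_quadratic: "0 \<le> y \<Longrightarrow> exp (- y) \<le> 1 - y + y\<^sup>2" for y :: real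
proof -
  assume y: "0 \<le> y"
  have "exp (- y) = 1 / exp y" by (simp add: exp_minus inverse_eq_divide)
  also have "\<dots> \<le> 1 / (1 + y)" using y exp_ge_add_one_self[of y] by (intro divide_left_mono) auto
  also have "\<dots> \<le> 1 - y + y\<^sup>2"
  proof -
    have "1 \<le> (1 - y + y\<^sup>2) * (1 + y)" using y by (simp add: algebra_simps power2_eq_square)
    then show ?thesis using y by (simp add: pos_divide_le_eq)
  qed
  finally show ?thesis .
qed

text \<open>The arithmetic of one time step \<eta>: \<open>l\<close> and \<open>l'\<close> are the
  later and the earlier eigenvalue, \<open>X\<close> and \<open>Y\<close> the means of
  \<open>H\<close> against mass and energy, \<open>e\<close> the oscillation of \<open>H\<close>. If
  the increment were too small, it would itself be of order \<eta>; replacing \<open>l'\<close> by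
  \<open>l\<close> in the product with \<eta> X then costs only second order, and
  \<open>main\<close> gives a contradiction.\<close>

lemma rayleigh_increment_algebra:
  fixes l l' \<eta> :: real
  assumes l: "0 \<le> l'" "l' \<le> l" "l \<le> \<Lambda>" and \<eta>: "0 < \<eta>" and q: "0 \<le> q" and K: "0 \<le> K" and C: "0 \<le> C" "0 \<le> e"
    and X: "0 \<le> X" "X \<le> K" and Y: "0 \<le> Y" "Y \<le> K * l"
    and main: "l' * (1 + \<eta> * (X - C * e)) \<le> l * (1 + q * \<eta> * e + (q * \<eta> * K)\<^sup>2) - q * \<eta> * Y"
    and e: "e * ((C + q) * \<Lambda>) \<le> \<epsilon> / 2"
    and small: "\<eta> * (q\<^sup>2 * K\<^sup>2 * \<Lambda> + (\<Lambda> * K + q * (K * \<Lambda>)) * K) \<le> \<epsilon> / 2" and \<epsilon>: "0 < \<epsilon>"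
  shows "\<eta> * (l * X + q * Y - \<epsilon>) \<le> l - l'"
proof (rule ccontr)
  define r where "r = l - l'"
  define \<theta> where "\<theta> = \<Lambda> * K + q * (K * \<Lambda>)"
  assume "\<not> ?thesis"
  then have r: "0 \<le> r" "r < \<eta> * (l * X + q * Y - \<epsilon>)" "l' = l - r" using l by (auto simp: r_def)
  have "l * X \<le> \<Lambda> * K" "q * Y \<le> q * (K * \<Lambda>)"
    using l X Y q K by (auto intro!: mult_mono mult_left_mono order.trans[OF Y(2)])
  then have "\<eta> * (l * X + q * Y - \<epsilon>) \<le> \<eta> * \<theta>"
    using \<eta> \<epsilon> by (intro mult_left_mono) (auto simp: \<theta>_def)
  \<comment> \<open>The contrary assumption is what makes the increment first order in
    \<eta>.\<close>
  then have r2: "r \<le> \<eta> * \<theta>" using r(2) by linarith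
  have \<theta>0: "0 \<le> \<theta>" using l q K by (auto simp: \<theta>_def)
  have "r * (\<eta> * (X - C * e)) \<le> r * (\<eta> * K)"
    using r(1) \<eta> X C by (intro mult_left_mono) (auto intro: order.trans[of _ X])
  also have "\<dots> \<le> (\<eta> * \<theta>) * (\<eta> * K)" using r2 \<eta> K by (intro mult_right_mono) auto
  finally have rz: "r * (\<eta> * (X - C * e)) \<le> \<eta> * (\<eta> * (\<theta> * K))" by (simp add: mult_ac)
  have "l * (C + q) * e \<le> \<Lambda> * (C + q) * e" using l C q by (intro mult_right_mono) auto
  moreover have "\<Lambda> * (C + q) * e = e * ((C + q) * \<Lambda>)" by (simp only: mult_ac)
  ultimately have le: "l * (C + q) * e \<le> \<epsilon> / 2" using e by linarith
  have "l * (q\<^sup>2 * K\<^sup>2) \<le> \<Lambda> * (q\<^sup>2 * K\<^sup>2)" using l by (intro mult_right_mono) auto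
  then have "\<eta> * (l * (q\<^sup>2 * K\<^sup>2) + \<theta> * K) \<le> \<eta> * (q\<^sup>2 * K\<^sup>2 * \<Lambda> + \<theta> * K)"
    using \<eta> by (intro mult_left_mono) (auto simp: mult_ac)
  then have sm: "\<eta> * (l * (q\<^sup>2 * K\<^sup>2) + \<theta> * K) \<le> \<epsilon> / 2" using small by (simp add: \<theta>_def)
  have "\<eta> * (l * (C + q) * e + \<eta> * (l * (q\<^sup>2 * K\<^sup>2) + \<theta> * K)) \<le> \<eta> * \<epsilon>"
    using \<eta> le sm by (intro mult_left_mono) auto
  moreover have "\<eta> * (l * X + q * Y) \<le> r + r * (\<eta> * (X - C * e)) + \<eta> * (l * (C + q) * e) + \<eta> * (\<eta> * (l * (q\<^sup>2 * K\<^sup>2)))"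
    using main unfolding r(3) by (simp add: algebra_simps power2_eq_square)
  ultimately have "\<eta> * (l * X + q * Y) \<le> r + \<eta> * \<epsilon>" using rz by (simp add: distrib_left)
  then show False using r(2) by (simp add: right_diff_distrib)
qed

context pinched_flow
begin

lemma integrable_H_mult:
  assumes t: "t \<in> {0..T}" and F: "integrable M0 F" shows "integrable M0 (\<lambda>x. H t x * F x)"
proof -
  obtain K where K: "0 < K" "\<And>t x. t \<in> {0..T} \<Longrightarrow> H t x \<le> K" by (rule H_bounded) blast
  show ?thesis
  proof (rule Bochner_Integration.integrable_bound)
    show "integrable M0 (\<lambda>x. K * F x)" using F by (rule integrable_mult_right)
    have [measurable]: "H t \<in> borel_measurable borel" "F \<in> borel_measurable M0"
      using H_measurable[OF t] F by auto
    show "(\<lambda>x. H t x * F x) \<in> borel_measurable M0" by measurable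
    show "AE x in M0. norm (H t x * F x) \<le> norm (K * F x)"
      using K trace_nonneg[OF t] t by (auto simp: abs_mult intro!: mult_right_mono)
  qed
qed

text \<open>Testing the weak equation with \<open>u\<close> itself gives the Rayleigh identity.
  Comparing with the test function u + 1 shows that \<open>lam t\<close> times the constraint
  integral vanishes, so the constraint is derived from the equation.\<close>

lemma eigenfunction_identities:
  assumes t: "t \<in> {0..T}" and u: "p_eigenfunction A (g t) p (lam t) u"
    and norm: "(LINT x|riemannian_measure A (g t). \<bar>u x\<bar> powr p) = 1"
  shows "u \<in> sobolev A (g t) p" "pow_int u t = 1" "grad_int u t = lam t"
    "lam t \<noteq> 0 \<Longrightarrow> (LINT x|riemannian_measure A (g t). spow p (u x)) = 0"
    "Theta A p \<alpha> (g t) (h t) u = lam t * (LINT x|M0. H t x * (volr t x * \<bar>u x\<bar> powr p))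
      + (\<alpha> * p - 1) * (LINT x|M0. H t x * (volr t x * en u t x powr (p / 2)))"
proof -
  let ?\<mu> = "riemannian_measure A (g t)"
  show us: "u \<in> sobolev A (g t) p" using u by (simp add: p_eigenfunction_def)
  note u' = sobolevD[OF t us]
  show "pow_int u t = 1" using u'(6) norm by simp
  have weak: "(LINT x|?\<mu>. metric_norm A (g t) (gradient A (g t) u) x powr (p - 2) *
      metric_inner A (g t) (gradient A (g t) u) (gradient A (g t) \<phi>) x) = lam t * (LINT x|?\<mu>. spow p (u x) * \<phi> x)"
    if "\<phi> \<in> sobolev A (g t) p" for \<phi>
    using u that by (simp add: p_eigenfunction_def has_p_laplacian_def spow_def mult.assoc)
  have "metric_norm A (g t) (gradient A (g t) u) x powr (p - 2) * metric_inner A (g t) (gradient A (g t) u) (gradient A (g t) u) x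
      = metric_norm A (g t) (gradient A (g t) u) x powr p" for x
  proof -
    have "metric_inner A (g t) (gradient A (g t) u) (gradient A (g t) u) x = en u t x"
      using riem_metric.metric_inner_gradient[OF riem[OF t]] by (simp add: en_def)
    moreover have "en u t x powr ((p - 2) / 2) * en u t x = en u t x powr (p / 2)"
      using powr_mult_base[OF en_nonneg[OF t], of u x "(p - 2) / 2"] by (simp add: mult.commute field_simps)
    ultimately show ?thesis by (simp add: metric_norm_gradient_powr[OF t])
  qed
  then have "grad_int u t = lam t * (LINT x|?\<mu>. \<bar>u x\<bar> powr p)"
    using weak[OF us] u'(7) by (simp add: spow_self)
  then show gr: "grad_int u t = lam t" using norm by simp
  \<comment> \<open>u + 1 has literally the gradient of \<open>u\<close>, whereas the selected
    gradient of the constant 1 is only known to vanish almost everywhere.\<close>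
  have us1: "(\<lambda>x. u x - (- 1)) \<in> sobolev A (g t) p" by (rule sobolev_diff_const[OF t us])
  have intS: "integrable ?\<mu> (\<lambda>x. spow p (u x))"
    by (rule finite_measure.integrable_spow[OF finite_riem[OF t] p_gt_2 borel_riem[OF t u'(1)] u'(5)])
  have "gradient A (g t) (\<lambda>x. u x - (- 1)) = gradient A (g t) u"
    using gradient_add_const[of "g t" u 1] by simp
  then have "lam t * (LINT x|?\<mu>. spow p (u x) * u x) = lam t * (LINT x|?\<mu>. spow p (u x) * (u x - (- 1)))"
    using weak[OF us] weak[OF us1] by simp
  also have "(LINT x|?\<mu>. spow p (u x) * (u x - (- 1))) = (LINT x|?\<mu>. \<bar>u x\<bar> powr p + spow p (u x))"
    by (simp add: distrib_left spow_self)
  also have "\<dots> = (LINT x|?\<mu>. \<bar>u x\<bar> powr p) + (LINT x|?\<mu>. spow p (u x))"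
    by (rule Bochner_Integration.integral_add[OF u'(5) intS])
  finally show "lam t \<noteq> 0 \<Longrightarrow> (LINT x|?\<mu>. spow p (u x)) = 0" by (simp add: spow_self distrib_left)
  have m: "(\<lambda>x. H t x * \<bar>u x\<bar> powr p) \<in> borel_measurable borel"
    "(\<lambda>x. H t x * en u t x powr (p / 2)) \<in> borel_measurable borel"
    using H_measurable[OF t] u'(1) en_powr_measurable[OF t u'(2)] by measurable
  show "Theta A p \<alpha> (g t) (h t) u = lam t * (LINT x|M0. H t x * (volr t x * \<bar>u x\<bar> powr p))
      + (\<alpha> * p - 1) * (LINT x|M0. H t x * (volr t x * en u t x powr (p / 2)))"
    unfolding Theta_def lam_def[symmetric] metric_norm_gradient_powr[OF t] integral_riem(2)[OF t m(1)] integral_riem(2)[OF t m(2)]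
    by (simp add: mult_ac)
qed

lemma integrable_volr: assumes "t \<in> {0..T}" shows "integrable M0 (volr t)"
proof -
  interpret finite_measure "riemannian_measure A (g t)" by (rule finite_riem[OF assms])
  have "integrable (riemannian_measure A (g t)) (\<lambda>_. 1 :: real)" by (rule integrable_const)
  then show ?thesis using integral_riem(1)[OF assms, of "\<lambda>_. 1"] by simp
qed

lemma volr_antimono:
  assumes "a \<in> {0..T}" "b \<in> {0..T}" "a \<le> b" shows "volr b x \<le> volr a x"
  using volr_decay[OF assms, of "\<lambda>_. 0" "\<lambda>_. 0" x] trace_nonneg assms by auto

text \<open>Zero volume would make every function vanish almost everywhere, contrary to the
  existence of admissible ones. The volume at the final time, being the smallest, bounds the gain
  from strong convexity uniformly.\<close>

lemma total_volume_pos: "0 < (LINT x|M0. volr T x)"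
proof (rule ccontr)
  have T': "T \<in> {0..T}" using T by simp
  assume "\<not> ?thesis"
  moreover have "0 \<le> (LINT x|M0. volr T x)"
    using volr_nonneg[OF T'] by (intro Bochner_Integration.integral_nonneg) auto
  ultimately have "(LINT x|M0. volr T x) = 0" by linarith
  then have "AE x in M0. volr T x = 0"
    using integral_nonneg_eq_0_iff_AE[OF integrable_volr[OF T']] volr_nonneg[OF T'] by simp
  then have "AE x in M0. False" by eventually_elim (use volr_pos[OF T'] in \<open>auto simp: less_le\<close>)
  then have "AE x in riemannian_measure A (g T). f x = 0" for f :: "'m \<Rightarrow> real"
    by (simp add: AE_riem[OF T'] eventually_mono)
  then show False using ex_admissible[OF T'] by (auto simp: admissible_def)
qed

text \<open>\<delta> is fixed before \<open>t0\<close>, \<open>t\<close> and \<open>u\<close>. This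
  uniformity comes from monotonicity in time: the eigenvalue is at most \<open>lam T\<close>, the
  volumes lie between those at \<open>T\<close> and at 0, and the bound and modulus of
  \<open>H\<close> hold on all of spacetime.\<close>

lemma lam_backward_estimate:
  assumes \<epsilon>: "0 < \<epsilon>"
  obtains \<delta> where "0 < \<delta>" "\<And>t0 t u. \<lbrakk>t0 \<in> {0..T}; t \<in> {0..T}; t < t0; t0 - t < \<delta>;
    p_eigenfunction A (g t0) p (lam t0) u; (LINT x|riemannian_measure A (g t0). \<bar>u x\<bar> powr p) = 1\<rbrakk>
    \<Longrightarrow> (t0 - t) * (Theta A p \<alpha> (g t0) (h t0) u - \<epsilon>) \<le> lam t0 - lam t"
proof -
  have T': "T \<in> {0..T}" "0 \<in> {0..T}" using T by auto
  obtain K where K: "0 < K" "\<And>t x. t \<in> {0..T} \<Longrightarrow> H t x \<le> K" by (rule H_bounded) blast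
  define q where "q = \<alpha> * p - 1"
  define \<Lambda> where "\<Lambda> = lam T"
  define V where "V = (LINT x|M0. volr T x)"
  define W where "W = (LINT x|M0. volr 0 x) + 1"
  \<comment> \<open>The summand 1 accounts for the oscillation of \<open>H\<close> in the mass term,
    p K W for the term linear in the recentring constant.\<close>
  define C where "C = 1 + p * K * W"
  define k where "k = (2::real) powr (1 - p)"
  have q: "0 \<le> q" using alpha_p by (simp add: q_def)
  have \<Lambda>: "0 \<le> \<Lambda>" using lam_nonneg T' by (simp add: \<Lambda>_def)
  have V: "0 < V" using total_volume_pos by (simp add: V_def)
  have W: "1 \<le> W" using volr_nonneg[OF T'(2)] by (simp add: W_def Bochner_Integration.integral_nonneg)
  have pKW: "0 < p * K * W" using p K W by simp
  have C: "0 \<le> C" using pKW by (simp add: C_def)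
  have k: "0 < k" by (simp add: k_def)
  \<comment> \<open>\<open>e\<close> plays two roles, as the tolerance for the oscillation of
    \<open>H\<close> and as the threshold separating small from large recentring constants.\<close>
  define e where "e = \<epsilon> / (2 * ((C + q) * \<Lambda> + 1))"
  have CqL: "0 \<le> (C + q) * \<Lambda>" using C q \<Lambda> by simp
  have e: "0 < e" "e * ((C + q) * \<Lambda>) \<le> \<epsilon> / 2"
    using \<epsilon> CqL by (auto simp: e_def field_simps)
  obtain \<delta>1 where \<delta>1: "0 < \<delta>1" "\<And>s t x. s \<in> {0..T} \<Longrightarrow> t \<in> {0..T} \<Longrightarrow> \<bar>s - t\<bar> < \<delta>1 \<Longrightarrow> \<bar>H s x - H t x\<bar> < e"
    using H_uniformly_continuous[OF e(1)] by blast
  \<comment> \<open>For steps below \<delta>2 and |c| > e, the linear term \<eta> p K W |c| is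
    dominated by the convexity gain k |c|^p V.\<close>
  define \<delta>2 where "\<delta>2 = k * e powr (p - 1) * V / (p * K * W)"
  define B where "B = q\<^sup>2 * K\<^sup>2 * \<Lambda> + (\<Lambda> * K + q * (K * \<Lambda>)) * K"
  define \<delta>3 where "\<delta>3 = \<epsilon> / (2 * (B + 1))"
  have B: "0 \<le> B" using q K \<Lambda> by (simp add: B_def)
  have \<delta>23: "0 < \<delta>2" "0 < \<delta>3" using k e V pKW \<epsilon> B by (auto simp: \<delta>2_def \<delta>3_def)
  show ?thesis
  proof (rule that[of "min \<delta>1 (min \<delta>2 \<delta>3)"])
    show "0 < min \<delta>1 (min \<delta>2 \<delta>3)" using \<delta>1 \<delta>23 by simp
    fix t0 t u assume t: "t0 \<in> {0..T}" "t \<in> {0..T}" "t < t0" and close: "t0 - t < min \<delta>1 (min \<delta>2 \<delta>3)"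
      and ef: "p_eigenfunction A (g t0) p (lam t0) u" and norm: "(LINT x|riemannian_measure A (g t0). \<bar>u x\<bar> powr p) = 1"
    note ei = eigenfunction_identities[OF t(1) ef norm]
    note u' = sobolevD[OF t(1) ei(1)]
    have ut: "u \<in> sobolev A (g t) p" using t by (intro sobolev_antimono[OF t(2,1) _ ei(1)]) auto
    note ut' = sobolevD[OF t(2) ut]
    define \<eta> where "\<eta> = t0 - t"
    have \<eta>: "0 < \<eta>" "\<eta> < \<delta>1" "\<eta> < \<delta>2" "\<eta> < \<delta>3" using t close by (auto simp: \<eta>_def)
    define w where "w = volr t0"
    define P where "P = (\<lambda>x. w x * \<bar>u x\<bar> powr p)"
    define Q where "Q = (\<lambda>x. w x * en u t0 x powr (p / 2))"
    define X where "X = (LINT x|M0. H t0 x * P x)"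
    define Y where "Y = (LINT x|M0. H t0 x * Q x)"
    have iP: "integrable M0 P" and iQ: "integrable M0 Q" using u'(3,4) by (auto simp: P_def Q_def w_def)
    have iHP: "integrable M0 (\<lambda>x. H t0 x * P x)" and iHQ: "integrable M0 (\<lambda>x. H t0 x * Q x)"
      by (rule integrable_H_mult[OF t(1) iP], rule integrable_H_mult[OF t(1) iQ])
    have w0: "0 < w x" for x using volr_pos[OF t(1)] by (simp add: w_def)
    have iw: "integrable M0 w" using integrable_volr[OF t(1)] by (simp add: w_def[symmetric])
    have P0: "0 \<le> P x" and Q0: "0 \<le> Q x" for x using w0[of x] by (auto simp: P_def Q_def)
    have H0: "0 \<le> H t0 x" "H t0 x \<le> K" for x using trace_nonneg K t by auto
    have intP: "(LINT x|M0. P x) = 1" using ei(2) by (simp add: pow_int_def P_def w_def)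
    have intQ: "(LINT x|M0. Q x) = lam t0" using ei(3) by (simp add: grad_int_def Q_def w_def)
    have \<theta>: "Theta A p \<alpha> (g t0) (h t0) u = lam t0 * X + q * Y"
      using ei(5) by (simp add: X_def Y_def P_def Q_def w_def q_def)
    have X: "0 \<le> X" "X \<le> K"
    proof -
      show "0 \<le> X" unfolding X_def using H0 P0 by (intro Bochner_Integration.integral_nonneg) auto
      have "X \<le> (LINT x|M0. K * P x)"
        unfolding X_def using iHP iP H0 P0 by (intro integral_mono mult_right_mono integrable_mult_right) auto
      then show "X \<le> K" using intP by simp
    qed
    have Y: "0 \<le> Y" "Y \<le> K * lam t0"
    proof -
      show "0 \<le> Y" unfolding Y_def using H0 Q0 by (intro Bochner_Integration.integral_nonneg) auto
      have "Y \<le> (LINT x|M0. K * Q x)"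
        unfolding Y_def using iHQ iQ H0 Q0 by (intro integral_mono mult_right_mono integrable_mult_right) auto
      then show "Y \<le> K * lam t0" using intQ by simp
    qed
    have l: "0 \<le> lam t" "lam t \<le> lam t0" "lam t0 \<le> \<Lambda>"
      using lam_nonneg[OF t(2)] mono_onD[OF lam_mono] t T' by (auto simp: \<Lambda>_def)
    show "(t0 - t) * (Theta A p \<alpha> (g t0) (h t0) u - \<epsilon>) \<le> lam t0 - lam t"
    proof (cases "lam t0 = 0")
      \<comment> \<open>This happens when \<open>M\<close> is disconnected; then \<open>spow p u\<close> need not have mean zero.\<close>
      case True
      then have "Theta A p \<alpha> (g t0) (h t0) u = 0" using Y by (simp add: \<theta>)
      moreover have "lam t = 0" using True l by simp
      ultimately show ?thesis using True \<epsilon> t by simp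
    next
      case False
      \<comment> \<open>A lower bound for \<open>H\<close> on the whole interval from
        \<open>t\<close> to \<open>t0\<close> that is constant in time, so that the barrier
        \<open>G x * s\<close> is linear; the truncation at 0 keeps it nonnegative.\<close>
      define G where "G = (\<lambda>x. max (H t0 x - e) 0)"
      have G: "0 \<le> G x" "G x \<le> K" "H t0 x - e \<le> G x" for x using H0[of x] K(1) e(1) by (auto simp: G_def)
      have GH: "G x \<le> H s x" if "s \<in> {t..t0}" for s x
      proof -
        have s: "s \<in> {0..T}" using that t by auto
        have "\<bar>s - t0\<bar> < \<delta>1" using that \<eta>(2) by (auto simp: \<eta>_def)
        then have "\<bar>H s x - H t0 x\<bar> < e" by (rule \<delta>1(2)[OF s t(1)])
        then show ?thesis using trace_nonneg[OF s, of x] by (auto simp: G_def)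
      qed
      have d\<kappa>: "((\<lambda>s. G x * s) has_real_derivative G x) (at s within {0..T})" for x s
        by (auto intro!: derivative_eq_intros)
      \<comment> \<open>Energy growth read backwards from \<open>t0\<close>, with the exponential of
        -q \<eta> G expanded to second order.\<close>
      have N: "grad_int u t \<le> lam t0 * (1 + q * \<eta> * e + (q * \<eta> * K)\<^sup>2) - q * \<eta> * Y"
      proof -
        have pt: "volr t x * en u t x powr (p / 2) \<le> (1 + q * \<eta> * e + (q * \<eta> * K)\<^sup>2) * Q x - q * \<eta> * (H t0 x * Q x)" for x
        proof -
          define y where "y = q * \<eta> * G x"
          have y0: "0 \<le> y" "q * \<eta> * (H t0 x - e) \<le> y" "y \<le> q * \<eta> * K"
            using q \<eta>(1) G[of x] by (auto simp: y_def intro!: mult_left_mono)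
          have "volr t x * en u t x powr (p / 2) * exp ((\<alpha> * p - 1) * (G x * t0 - G x * t)) \<le> volr t0 x * en u t0 x powr (p / 2)"
            by (rule energy_growth[OF t(2,1) less_imp_le[OF t(3)] d\<kappa> GH])
          also have "(\<alpha> * p - 1) * (G x * t0 - G x * t) = y" by (simp add: y_def q_def \<eta>_def algebra_simps)
          finally have "volr t x * en u t x powr (p / 2) * exp y * exp (- y) \<le> Q x * exp (- y)"
            by (intro mult_right_mono) (auto simp: Q_def w_def)
          then have "volr t x * en u t x powr (p / 2) \<le> Q x * exp (- y)" by (simp add: mult.assoc exp_add[symmetric])
          also have "\<dots> \<le> Q x * (1 - y + y\<^sup>2)" using Q0 exp_minus_le_quadratic[OF y0(1)] by (intro mult_left_mono)
          also have "\<dots> \<le> Q x * (1 - q * \<eta> * (H t0 x - e) + (q * \<eta> * K)\<^sup>2)"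
            using y0(2) power_mono[OF y0(3,1), of 2] by (intro mult_left_mono Q0) linarith
          finally show ?thesis by (simp add: algebra_simps)
        qed
        have "grad_int u t \<le> (LINT x|M0. (1 + q * \<eta> * e + (q * \<eta> * K)\<^sup>2) * Q x - q * \<eta> * (H t0 x * Q x))"
          unfolding grad_int_def using ut'(4) iQ iHQ pt
          by (intro integral_mono Bochner_Integration.integrable_diff integrable_mult_right) auto
        also have "\<dots> = lam t0 * (1 + q * \<eta> * e + (q * \<eta> * K)\<^sup>2) - q * \<eta> * Y"
          using iQ iHQ by (simp add: intQ Y_def)
        finally show ?thesis .
      qed
      \<comment> \<open>No bound on the recentring constant at time \<open>t\<close> is available,
        so the mass is estimated for every \<open>c\<close>: pointwise strong convexity, weighted by
        the part 1 + \<eta> G of the growth of the density.\<close>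
      have D: "1 + \<eta> * (X - C * e) \<le> pow_int (\<lambda>x. u x - c) t" for c
      proof -
        define S where "S = (\<lambda>x. w x * spow p (u x))"
        have intS: "integrable (riemannian_measure A (g t0)) (\<lambda>x. spow p (u x))"
          by (rule finite_measure.integrable_spow[OF finite_riem[OF t(1)] p_gt_2 borel_riem[OF t(1) u'(1)] u'(5)])
        have mS: "(\<lambda>x. spow p (u x)) \<in> borel_measurable borel"
          unfolding spow_def using u'(1) by measurable
        have iS: "integrable M0 S" and S: "(LINT x|M0. S x) = 0"
          using integral_riem[OF t(1) mS] intS ei(4)[OF False] by (auto simp: S_def w_def)
        have uc: "(\<lambda>x. u x - c) \<in> sobolev A (g t) p" by (rule sobolev_diff_const[OF t(2) ut])
        define a where "a = p * \<eta> * K * \<bar>c\<bar>"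
        define R where "R = (\<lambda>x. (1 - \<eta> * e) * P x + \<eta> * (H t0 x * P x) - p * c * S x - a * (w x + P x) + k * \<bar>c\<bar> powr p * w x)"
        have pt: "R x \<le> volr t x * \<bar>u x - c\<bar> powr p" for x
        proof -
          have "volr t0 x * (1 + \<eta> * G x) \<le> volr t0 x * exp (\<eta> * G x)"
            using volr_nonneg[OF t(1)] exp_ge_add_one_self[of "\<eta> * G x"] by (intro mult_left_mono) auto
          also have "\<eta> * G x = G x * t0 - G x * t" by (simp add: \<eta>_def algebra_simps)
          also have "volr t0 x * exp (G x * t0 - G x * t) \<le> volr t x"
            using volr_decay[OF t(2,1) less_imp_le[OF t(3)] d\<kappa> GH] .
          finally have "w x * (1 + \<eta> * G x) * \<bar>u x - c\<bar> powr p \<le> volr t x * \<bar>u x - c\<bar> powr p"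
            by (intro mult_right_mono) (auto simp: w_def \<eta>_def algebra_simps)
          moreover have wG: "0 \<le> w x * (1 + \<eta> * G x)" using w0[of x] \<eta>(1) G(1)[of x] by simp
          have "w x * (1 + \<eta> * G x) * (\<bar>u x\<bar> powr p - p * spow p (u x) * c + k * \<bar>c\<bar> powr p)
              \<le> w x * (1 + \<eta> * G x) * \<bar>u x - c\<bar> powr p"
            using wG powr_strongly_convex[OF p_gt_2] unfolding k_def by (intro mult_left_mono) auto
          moreover have "w x * (1 + \<eta> * G x) * (\<bar>u x\<bar> powr p - p * spow p (u x) * c + k * \<bar>c\<bar> powr p)
              = P x + \<eta> * (G x * P x) - p * c * S x - p * \<eta> * (G x * (c * S x)) + k * \<bar>c\<bar> powr p * w x
                + \<eta> * (G x * (k * \<bar>c\<bar> powr p * w x))"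
            by (simp add: P_def S_def algebra_simps)
          moreover have "\<eta> * ((H t0 x - e) * P x) \<le> \<eta> * (G x * P x)"
            using \<eta>(1) G(3)[of x] P0[of x] by (intro mult_left_mono mult_right_mono) auto
          moreover have "0 \<le> \<eta> * (G x * (k * \<bar>c\<bar> powr p * w x))"
            using \<eta>(1) G(1)[of x] k w0[of x] by simp
          \<comment> \<open>The integral of \<open>S\<close> is 0 by the constraint at
            \<open>t0\<close>; only its product with the correction \<eta> G survives, which is
            where the extra factor \<eta> in the linear term comes from.\<close>
          moreover have "p * \<eta> * (G x * (c * S x)) \<le> a * (w x + P x)"
          proof -
            have "\<bar>S x\<bar> \<le> w x + P x"
            proof -
              have "\<bar>S x\<bar> = w x * \<bar>u x\<bar> powr (p - 1)" using w0[of x] by (simp add: S_def abs_mult abs_spow)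
              also have "\<dots> \<le> w x * (1 + \<bar>u x\<bar> powr p)"
                using w0[of x] powr_pred_le[OF p, of "u x"] by (intro mult_left_mono) auto
              finally show ?thesis by (simp add: P_def distrib_left)
            qed
            then have "\<bar>c\<bar> * \<bar>S x\<bar> \<le> \<bar>c\<bar> * (w x + P x)" by (intro mult_left_mono) auto
            then have "c * S x \<le> \<bar>c\<bar> * (w x + P x)"
              using abs_ge_self[of "c * S x"] by (simp add: abs_mult)
            then have "G x * (c * S x) \<le> G x * (\<bar>c\<bar> * (w x + P x))"
              by (rule mult_left_mono) (rule G(1))
            also have "\<dots> \<le> K * (\<bar>c\<bar> * (w x + P x))"
              using w0[of x] P0[of x] by (intro mult_right_mono G(2)) auto
            finally have "G x * (c * S x) \<le> K * (\<bar>c\<bar> * (w x + P x))" .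
            then have "p * \<eta> * (G x * (c * S x)) \<le> p * \<eta> * (K * (\<bar>c\<bar> * (w x + P x)))"
              using p \<eta>(1) by (intro mult_left_mono) auto
            then show ?thesis by (simp add: a_def mult_ac)
          qed
          moreover have "\<eta> * ((H t0 x - e) * P x) = \<eta> * (H t0 x * P x) - \<eta> * e * P x" by (simp add: algebra_simps)
          moreover have "(1 - \<eta> * e) * P x = P x - \<eta> * e * P x" by (simp add: algebra_simps)
          ultimately show ?thesis unfolding R_def by linarith
        qed
        have iR: "integrable M0 R" unfolding R_def
          by (intro Bochner_Integration.integrable_add Bochner_Integration.integrable_diff integrable_mult_right iP iHP iS iw)
        have "(LINT x|M0. R x) \<le> pow_int (\<lambda>x. u x - c) t"
          unfolding pow_int_def using sobolevD(3)[OF t(2) uc] iR pt by (intro integral_mono) auto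
        moreover have "(LINT x|M0. R x) = (1 - \<eta> * e) + \<eta> * X - a * ((LINT x|M0. w x) + 1) + k * \<bar>c\<bar> powr p * (LINT x|M0. w x)"
          unfolding R_def using iP iHP iS iw by (simp add: intP S X_def)
        moreover have "a * ((LINT x|M0. w x) + 1) \<le> a * W"
        proof -
          have "(LINT x|M0. w x) \<le> (LINT x|M0. volr 0 x)"
            unfolding w_def using T' t by (intro integral_mono integrable_volr volr_antimono) auto
          then show ?thesis using p \<eta>(1) K(1) by (intro mult_left_mono) (auto simp: W_def a_def)
        qed
        moreover have "k * \<bar>c\<bar> powr p * V \<le> k * \<bar>c\<bar> powr p * (LINT x|M0. w x)"
        proof -
          have "V \<le> (LINT x|M0. w x)"
            unfolding w_def V_def using T' t by (intro integral_mono integrable_volr volr_antimono) auto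
          then show ?thesis using k by (intro mult_left_mono) auto
        qed
        moreover have "a * W - \<eta> * (p * K * W * e) \<le> k * \<bar>c\<bar> powr p * V"
          \<comment> \<open>The linear term in \<open>c\<close> is harmless for small \<open>c\<close> and is absorbed by strong convexity otherwise.\<close>
        proof (cases "\<bar>c\<bar> \<le> e")
          case True
          have "a * W = \<eta> * (p * K * W * \<bar>c\<bar>)" by (simp add: a_def mult_ac)
          also have "\<dots> \<le> \<eta> * (p * K * W * e)" using True \<eta>(1) pKW by (intro mult_left_mono) auto
          finally have "a * W - \<eta> * (p * K * W * e) \<le> 0" by simp
          also have "0 \<le> k * \<bar>c\<bar> powr p * V" using k V by simp
          finally show ?thesis .
        next
          case False
          have "\<eta> * (p * K * W) \<le> k * e powr (p - 1) * V"
            using \<eta>(3) pKW by (simp add: \<delta>2_def pos_less_divide_eq)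
          also have "\<dots> \<le> k * \<bar>c\<bar> powr (p - 1) * V"
            using False e(1) k V p by (intro mult_right_mono mult_left_mono powr_mono2) auto
          finally have "(\<eta> * (p * K * W)) * \<bar>c\<bar> \<le> (k * \<bar>c\<bar> powr (p - 1) * V) * \<bar>c\<bar>"
            by (rule mult_right_mono) simp
          also have "\<dots> = k * \<bar>c\<bar> powr p * V"
            using powr_mult_base[of "\<bar>c\<bar>" "p - 1"] by (simp add: mult_ac)
          finally have "a * W \<le> k * \<bar>c\<bar> powr p * V" by (simp add: a_def mult_ac)
          moreover have "0 \<le> \<eta> * (p * K * W * e)" using \<eta>(1) pKW e(1) by simp
          ultimately show ?thesis by linarith
        qed
        moreover have "\<eta> * (X - C * e) = \<eta> * X - \<eta> * e - \<eta> * (p * K * W * e)"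
          by (simp add: C_def algebra_simps)
        ultimately show ?thesis by linarith
      qed
      obtain c where c: "lam t * pow_int (\<lambda>x. u x - c) t \<le> grad_int u t" by (rule lam_centered[OF t(2) ut])
      have "lam t * (1 + \<eta> * (X - C * e)) \<le> lam t * pow_int (\<lambda>x. u x - c) t"
        using D[of c] l(1) by (intro mult_left_mono) auto
      then have main: "lam t * (1 + \<eta> * (X - C * e)) \<le> lam t0 * (1 + q * \<eta> * e + (q * \<eta> * K)\<^sup>2) - q * \<eta> * Y"
        using c N by linarith
      have "\<eta> * B \<le> \<delta>3 * B" using \<eta>(4) B by (intro mult_right_mono) auto
      also have "\<dots> \<le> \<epsilon> / 2" using B \<epsilon> by (simp add: \<delta>3_def field_simps)
      finally have "\<eta> * B \<le> \<epsilon> / 2" .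
      then show ?thesis
        using rayleigh_increment_algebra[OF l \<eta>(1) q less_imp_le[OF K(1)] C less_imp_le[OF e(1)] X Y main e(2) _ \<epsilon>]
        by (simp add: \<theta> B_def \<eta>_def)
    qed
  qed
qed

lemma lam_integral_bound:
  assumes u: "\<And>t. t \<in> {0..T} \<Longrightarrow> p_eigenfunction A (g t) p (lam t) (u t)"
    and norm: "\<And>t. t \<in> {0..T} \<Longrightarrow> (LINT x|riemannian_measure A (g t). \<bar>u t x\<bar> powr p) = 1"
    and t: "t1 \<in> {0..T}" "t2 \<in> {0..T}" "t1 < t2"
  shows "lam t1 + integral {t1..t2} (\<lambda>t. Theta A p \<alpha> (g t) (h t) (u t)) \<le> lam t2"
proof (cases "(\<lambda>t. Theta A p \<alpha> (g t) (h t) (u t)) integrable_on {t1..t2}")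
  \<comment> \<open>\<open>u\<close> is not assumed to depend measurably on time; the integral is then \<open>0\<close>.\<close>
  case False
  then show ?thesis using mono_onD[OF lam_mono, of t1 t2] t by (simp add: not_integrable_integral)
next
  case True
  show ?thesis
  proof (rule mono_on_integral_le_increment[OF lam_mono _ t(3) _ True])
    fix \<epsilon> :: real assume "0 < \<epsilon>"
    then obtain \<delta> where \<delta>: "0 < \<delta>" "\<And>t0 t u. \<lbrakk>t0 \<in> {0..T}; t \<in> {0..T}; t < t0; t0 - t < \<delta>;
        p_eigenfunction A (g t0) p (lam t0) u; (LINT x|riemannian_measure A (g t0). \<bar>u x\<bar> powr p) = 1\<rbrakk>
        \<Longrightarrow> (t0 - t) * (Theta A p \<alpha> (g t0) (h t0) u - \<epsilon>) \<le> lam t0 - lam t"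
      by (rule lam_backward_estimate) blast
    show "\<exists>\<delta>>0. \<forall>t s. t \<le> T \<and> 0 < s \<and> s < \<delta> \<and> 0 \<le> t - s \<longrightarrow>
        s * (Theta A p \<alpha> (g t) (h t) (u t) - \<epsilon>) \<le> lam t - lam (t - s)"
    proof (intro exI[of _ \<delta>] conjI \<delta>(1) allI impI)
      fix t s assume ts: "t \<le> T \<and> 0 < s \<and> s < \<delta> \<and> 0 \<le> t - s"
      then have tT: "t \<in> {0..T}" "t - s \<in> {0..T}" by auto
      show "s * (Theta A p \<alpha> (g t) (h t) (u t) - \<epsilon>) \<le> lam t - lam (t - s)"
        using \<delta>(2)[OF tT _ _ u[OF tT(1)] norm[OF tT(1)]] ts by simp
    qed
  qed (use t in auto)
qed

end

section \<open>Second-order condition at a minimum\<close>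

lemma bounded_linear_matrix_component: "bounded_linear (\<lambda>M :: real ^ 'n::finite ^ 'm::finite. M $ i $ j)"
  by (intro bounded_linear_compose[OF bounded_linear_vec_nth bounded_linear_vec_nth])

text \<open>Along the line through the minimum, \<psi> is the derivative of \<open>F\<close> and
  vanishes at 0. If the second derivative were negative, \<psi> would be negative just after 0, and
  the mean value theorem would push \<open>F\<close> below its minimum.\<close>

lemma hessian_nonneg_at_minimum:
  fixes F :: "real ^ 'n::finite \<Rightarrow> real"
  assumes V: "open V" "y0 \<in> V" and min: "\<And>y. y \<in> V \<Longrightarrow> F y0 \<le> F y"
    and F: "\<And>y. y \<in> V \<Longrightarrow> (F has_derivative (\<lambda>v. \<Sum>j\<in>UNIV. v $ j * P j y)) (at y)"
    and P: "\<And>j. (P j has_derivative DP j) (at y0)"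
  shows "0 \<le> (\<Sum>j\<in>UNIV. v $ j * DP j v)"
proof (rule ccontr)
  assume neg: "\<not> ?thesis"
  define \<psi> where "\<psi> = (\<lambda>s. \<Sum>j\<in>UNIV. v $ j * P j (y0 + s *\<^sub>R v))"
  have line: "((\<lambda>s. y0 + s *\<^sub>R v) has_derivative (\<lambda>r. r *\<^sub>R v)) (at s)" for s
    by (auto intro!: derivative_eq_intros)
  have "(\<psi> has_real_derivative (\<Sum>j\<in>UNIV. v $ j * DP j v)) (at 0)"
    unfolding \<psi>_def
  proof (intro DERIV_sum DERIV_cmult)
    fix j
    have "((\<lambda>s. P j (y0 + s *\<^sub>R v)) has_derivative (\<lambda>r. DP j (r *\<^sub>R v))) (at 0)"
      using has_derivative_compose[OF line, of "P j" "DP j" 0] P[of j] by simp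
    moreover have "(\<lambda>r. DP j (r *\<^sub>R v)) = (*) (DP j v)"
      using linear_scale[OF has_derivative_linear[OF P[of j]]] by (auto simp: mult.commute[of _ "DP j v"])
    ultimately show "((\<lambda>s. P j (y0 + s *\<^sub>R v)) has_real_derivative DP j v) (at 0)"
      by (simp add: has_field_derivative_def)
  qed
  from has_real_derivative_neg_dec_right[OF this] neg
  obtain d where d: "0 < d" "\<And>h. 0 < h \<Longrightarrow> h < d \<Longrightarrow> \<psi> h < \<psi> 0" by auto
  have "(\<lambda>v. \<Sum>j\<in>UNIV. v $ j * P j y0) = (\<lambda>v. 0)"
    by (rule differential_zero_maxmin[OF V(2,1) F[OF V(2)]]) (use min in auto)
  then have \<psi>0: "\<psi> 0 = 0" by (simp add: \<psi>_def fun_eq_iff)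
  obtain r where r: "0 < r" "ball y0 r \<subseteq> V" using V open_contains_ball by blast
  \<comment> \<open>The segment of length \<open>h\<close> must stay in the ball; the denominator 1
    + norm v also covers v = 0.\<close>
  define h where "h = min d (r / (1 + norm v)) / 2"
  have h: "0 < h" "h < d" "h * norm v < r"
  proof -
    have nv: "0 < 1 + norm v" by (rule add_pos_nonneg) auto
    show "0 < h" "h < d" using d(1) r(1) nv by (auto simp: h_def)
    have "h * norm v \<le> (r / (1 + norm v) / 2) * norm v" 
      unfolding h_def by (intro mult_right_mono divide_right_mono min.cobounded2) auto
    also have "\<dots> = (r / (1 + norm v) * norm v) / 2" by simp
    also have "\<dots> < r"
    proof -
      have "r / (1 + norm v) * norm v \<le> r" using r(1) nv by (simp add: pos_divide_le_eq distrib_left)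
      moreover have "z / 2 < r" if "z \<le> r" for z using that r(1) by linarith
      ultimately show ?thesis by blast
    qed
    finally show "h * norm v < r" .
  qed
  have inV: "y0 + s *\<^sub>R v \<in> V" if "0 \<le> s" "s \<le> h" for s
  proof -
    have "s * norm v \<le> h * norm v" using that by (intro mult_right_mono) auto
    then have "y0 + s *\<^sub>R v \<in> ball y0 r" using h(3) that by (simp add: dist_norm)
    then show ?thesis using r(2) by blast
  qed
  have "((\<lambda>s. F (y0 + s *\<^sub>R v)) has_real_derivative \<psi> s) (at s)" if "0 \<le> s" "s \<le> h" for s
  proof -
    have "((\<lambda>s. F (y0 + s *\<^sub>R v)) has_derivative (\<lambda>t. \<Sum>j\<in>UNIV. (t *\<^sub>R v) $ j * P j (y0 + s *\<^sub>R v))) (at s)"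
      by (rule has_derivative_compose[OF line F[OF inV[OF that]]])
    moreover have "(\<lambda>t. \<Sum>j\<in>UNIV. (t *\<^sub>R v) $ j * P j (y0 + s *\<^sub>R v)) = (*) (\<psi> s)"
      by (auto simp: \<psi>_def fun_eq_iff sum_distrib_left sum_distrib_right mult_ac)
    ultimately show ?thesis by (simp add: has_field_derivative_def)
  qed
  from MVT2[OF h(1) this] obtain z where z: "0 < z" "z < h"
    "F (y0 + h *\<^sub>R v) - F (y0 + 0 *\<^sub>R v) = (h - 0) * \<psi> z" by blast
  have "\<psi> z < 0" using d(2)[of z] z h \<psi>0 by simp
  then have "h * \<psi> z < 0" using h(1) by (simp add: mult_pos_neg)
  then have "F (y0 + h *\<^sub>R v) < F y0" using z(3) by simp
  then show False using min[OF inV[of h]] h(1) by simp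
qed

text \<open>All first partial derivatives vanish at the minimum, so the product rule leaves only the
  coefficient matrix contracted with the second derivatives, a positive definite matrix against a
  nonnegative form.\<close>

lemma divergence_form_nonneg_at_minimum:
  fixes F :: "real ^ 'n::finite \<Rightarrow> real" and G :: "real ^ 'n \<Rightarrow> real ^ 'n ^ 'n"
  assumes V: "open V" "y0 \<in> V" and min: "\<And>y. y \<in> V \<Longrightarrow> F y0 \<le> F y"
    and F: "Ck_on (Suc (Suc 0)) V F" and G: "\<And>i j. Ck_on (Suc 0) V (\<lambda>y. G y $ i $ j)"
    and pd: "\<And>y. y \<in> V \<Longrightarrow> posdef (G y)"
  shows "0 \<le> (\<Sum>i\<in>UNIV. partial_deriv i
    (\<lambda>y. sqrt (det (G y)) * (\<Sum>j\<in>UNIV. matrix_inv (G y) $ i $ j * partial_deriv j F y)) y0)"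
proof -
  define a where "a = (\<lambda>i j y. sqrt (det (G y)) * matrix_inv (G y) $ i $ j)"
  have "Ck_on (Suc 0) V (a i j)" for i j
    unfolding a_def using posdef_det_pos[OF pd] posdef_invertible[OF pd]
    by (intro Ck_on_mult Ck_on_sqrt Ck_on_det Ck_on_matrix_inv G V) auto
  then have "\<exists>D. (a i j has_derivative D) (at y0)" for i j
    using Ck_on_SucE[OF _ V(1)] V(2) by metis
  then obtain Da where Da: "\<And>i j. (a i j has_derivative Da i j) (at y0)" by metis
  obtain DF where DF: "\<And>y. y \<in> V \<Longrightarrow> (F has_derivative DF y) (at y)" "\<And>v. Ck_on (Suc 0) V (\<lambda>y. DF y v)"
    using Ck_on_SucE[OF F V(1)] by metis
  have DFf: "DF y = frechet_derivative F (at y)" if "y \<in> V" for y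
    using frechet_derivative_at[OF DF(1)[OF that]] .
  have pdF: "DF y (axis j 1) = partial_deriv j F y" if "y \<in> V" for y j
    by (simp add: DFf[OF that] partial_deriv_def)
  have Fder: "(F has_derivative (\<lambda>v. \<Sum>j\<in>UNIV. v $ j * partial_deriv j F y)) (at y)" if y: "y \<in> V" for y
  proof -
    have "DF y v = (\<Sum>j\<in>UNIV. v $ j * partial_deriv j F y)" for v
      using frechet_derivative_eq_gradient_inner[of F y v] DF(1)[OF y] DFf[OF y]
      by (simp add: inner_vec_def mult.commute)
    then have "DF y = (\<lambda>v. \<Sum>j\<in>UNIV. v $ j * partial_deriv j F y)" by (rule ext)
    then show ?thesis using DF(1)[OF y] by simp
  qed
  have "\<exists>D. (partial_deriv j F has_derivative D) (at y0)" for j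
  proof -
    have "Ck_on (Suc 0) V (partial_deriv j F)"
      using DF(2)[of "axis j 1"] Ck_on_cong[OF V(1), of "\<lambda>y. DF y (axis j 1)" "partial_deriv j F"] pdF by blast
    then show ?thesis using Ck_on_SucE[OF _ V(1)] V(2) by metis
  qed
  then obtain DP where DP: "\<And>j. (partial_deriv j F has_derivative DP j) (at y0)" by metis
  have crit: "partial_deriv j F y0 = 0" for j
  proof -
    have "DF y0 = (\<lambda>v. 0)"
      by (rule differential_zero_maxmin[OF V(2,1) DF(1)[OF V(2)]]) (use min in auto)
    then show ?thesis using pdF[OF V(2), of j] by simp
  qed
  define Q :: "real ^ 'n ^ 'n" where "Q = (\<chi> i j. DP j (axis i 1))"
  have "partial_deriv i (\<lambda>y. sqrt (det (G y)) * (\<Sum>j\<in>UNIV. matrix_inv (G y) $ i $ j * partial_deriv j F y)) y0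
    = (\<Sum>j\<in>UNIV. a i j y0 * Q $ i $ j)" for i
  proof -
    have "((\<lambda>y. \<Sum>j\<in>UNIV. a i j y * partial_deriv j F y) has_derivative
        (\<lambda>v. \<Sum>j\<in>UNIV. a i j y0 * DP j v + Da i j v * partial_deriv j F y0)) (at y0)"
      by (intro has_derivative_sum has_derivative_mult Da DP)
    from frechet_derivative_at[OF this, symmetric]
    have "partial_deriv i (\<lambda>y. \<Sum>j\<in>UNIV. a i j y * partial_deriv j F y) y0 = (\<Sum>j\<in>UNIV. a i j y0 * Q $ i $ j)"
      by (simp add: partial_deriv_def[of i] crit Q_def)
    then show ?thesis by (simp add: a_def sum_distrib_left mult.assoc)
  qed
  moreover have "0 \<le> (\<Sum>i\<in>UNIV. \<Sum>j\<in>UNIV. matrix_inv (G y0) $ i $ j * Q $ i $ j)"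
  proof (rule psd_contraction_nonneg)
    have "posdef (matrix_inv (G y0))" by (intro posdef_matrix_inv pd V)
    then show "transpose (matrix_inv (G y0)) = matrix_inv (G y0)" "0 \<le> v \<bullet> (matrix_inv (G y0) *v v)" for v
      using posdef_nonneg by (auto simp: posdef_def)
    show "0 \<le> v \<bullet> (Q *v v)" for v
    proof -
      have "DP j v = (\<Sum>i\<in>UNIV. v $ i * Q $ i $ j)" for j
        using frechet_derivative_eq_gradient_inner[of "partial_deriv j F" y0 v] DP[of j] frechet_derivative_at[OF DP[of j]]
        by (simp add: inner_vec_def Q_def partial_deriv_def[where F = "partial_deriv j F"] mult.commute)
      then have "(\<Sum>j\<in>UNIV. v $ j * DP j v) = (\<Sum>j\<in>UNIV. \<Sum>i\<in>UNIV. Q $ i $ j * v $ i * v $ j)"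
        by (simp add: sum_distrib_left mult_ac)
      also have "\<dots> = v \<bullet> (Q *v v)" unfolding quadratic_form_eq_inner[symmetric] by (rule sum.swap)
      finally show ?thesis using hessian_nonneg_at_minimum[OF V min Fder DP, of v] by simp
    qed
  qed
  then have "0 \<le> sqrt (det (G y0)) * (\<Sum>i\<in>UNIV. \<Sum>j\<in>UNIV. matrix_inv (G y0) $ i $ j * Q $ i $ j)"
    using posdef_det_pos[OF pd[OF V(2)]] by (intro mult_nonneg_nonneg) auto
  ultimately show ?thesis by (simp add: a_def sum_distrib_left mult.assoc)
qed

section \<open>Maximum principle for the trace\<close>

context pinched_flow
begin

lemma Ck_on_H:
  assumes t: "t \<in> {0..T}" and c: "c \<in> A" shows "Ck_on k (chart_image c) (\<lambda>y. H t (chart_inv c y))"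
proof -
  have V: "open (chart_image c)" by (rule chart(2)[OF c])
  have "Ck_on k (chart_image c) (\<lambda>y. \<Sum>i\<in>UNIV. \<Sum>j\<in>UNIV.
      matrix_inv (g t c (chart_inv c y)) $ i $ j * h t c (chart_inv c y) $ i $ j)"
    by (intro Ck_on_sum Ck_on_mult Ck_on_matrix_inv V Ck_on_bounded_linear[OF V bounded_linear_matrix_component Ck_on_metric[OF t c]]
        Ck_on_bounded_linear[OF V bounded_linear_matrix_component Ck_on_h[OF t c]] invertible_g t c chart(8)[OF c])
  then show ?thesis
    by (rule iffD1[OF Ck_on_cong[OF V], rotated]) (simp add: H_eq[OF t c chart(8)[OF c]])
qed

lemma laplace_nonneg_at_minimum:
  assumes t: "t \<in> {0..T}" and min: "\<And>x. H t x0 \<le> H t x"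
  shows "0 \<le> laplace_beltrami A (g t) (H t) x0"
proof -
  define c where "c = chart_at A x0"
  have c: "c \<in> A" "x0 \<in> fst c" by (simp_all add: c_def chart_at)
  have V: "open (chart_image c)" by (rule chart(2)[OF c(1)])
  have "0 \<le> (\<Sum>i\<in>UNIV. partial_deriv i
      (\<lambda>y. sqrt (det (g t c (chart_inv c y))) * (\<Sum>j\<in>UNIV. matrix_inv (g t c (chart_inv c y)) $ i $ j
        * partial_deriv j (\<lambda>y. H t (chart_inv c y)) y)) (snd c x0))"
  proof (rule divergence_form_nonneg_at_minimum[OF V chart(6)[OF c]])
    show "H t (chart_inv c (snd c x0)) \<le> H t (chart_inv c y)" for y using min by (simp add: chart(5)[OF c])
    show "Ck_on (Suc (Suc 0)) (chart_image c) (\<lambda>y. H t (chart_inv c y))" by (rule Ck_on_H[OF t c(1)])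
    show "Ck_on (Suc 0) (chart_image c) (\<lambda>y. g t c (chart_inv c y) $ i $ j)" for i j
      by (rule Ck_on_bounded_linear[OF V bounded_linear_matrix_component Ck_on_metric[OF t c(1)]])
    show "posdef (g t c (chart_inv c y))" if "y \<in> chart_image c" for y
      by (rule riem_metric.posdef_metric[OF riem[OF t] c(1) chart(8)[OF c(1) that]])
  qed
  moreover have "0 < sqrt (det (g t c (chart_inv c (snd c x0))))"
    using det_g_pos[OF t c] by (simp add: chart(5)[OF c])
  ultimately show ?thesis
    unfolding laplace_beltrami_def c_def[symmetric] Let_def by (intro divide_nonneg_nonneg) auto
qed

text \<open>\<open>vector_derivative\<close> is a choice, and the evolution inequality says
  something about \<open>H\<close> only once differentiability is established. As
  \<open>0 < T\<close>, the derivative within the interval is unique, also at its ends.\<close>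

lemma H_time_derivative:
  assumes t: "t \<in> {0..T}"
  shows "((\<lambda>s. H s x) has_real_derivative vector_derivative (\<lambda>s. H s x) (at t within {0..T})) (at t within {0..T})"
proof -
  define c where "c = chart_at A x"
  have c: "c \<in> A" "x \<in> fst c" by (simp_all add: c_def chart_at)
  obtain d where "((\<lambda>s. (\<lambda>(t, y). h t c (chart_inv c y)) (s, snd c x)) has_vector_derivative d) (at t within {0..T})"
    using Ck_on_time_derivative[OF smooth_h[OF c(1), of "Suc 0"] t chart(6)[OF c]] by blast
  then have d: "((\<lambda>s. h s c x) has_vector_derivative d) (at t within {0..T})" by (simp add: chart(5)[OF c])
  have hd: "((\<lambda>s. h s c x $ i $ j) has_real_derivative d $ i $ j) (at t within {0..T})" for i j
  proof -
    from bounded_linear.has_vector_derivative[OF bounded_linear_matrix_component d]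
    show ?thesis by (simp add: has_real_derivative_iff_has_vector_derivative)
  qed
  define E where "E = - (matrix_inv (g t c x) ** ((- 2) *\<^sub>R h t c x) ** matrix_inv (g t c x))"
  have gd: "((\<lambda>s. matrix_inv (g s c x) $ i $ j) has_real_derivative E $ i $ j) (at t within {0..T})" for i j
    using has_real_derivative_matrix_inv[OF metric_derivative[OF c t] invertible_g[OF _ c] t continuous_on_metric_time[OF c], of i j]
    by (simp add: E_def)
  define e where "e = (\<Sum>i\<in>UNIV. \<Sum>j\<in>UNIV. E $ i $ j * h t c x $ i $ j + d $ i $ j * matrix_inv (g t c x) $ i $ j)"
  have "((\<lambda>s. \<Sum>i\<in>UNIV. \<Sum>j\<in>UNIV. matrix_inv (g s c x) $ i $ j * h s c x $ i $ j) has_real_derivative e)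
      (at t within {0..T})"
    unfolding e_def by (intro DERIV_sum DERIV_mult gd hd)
  then have e: "((\<lambda>s. H s x) has_real_derivative e) (at t within {0..T})"
    by (rule has_field_derivative_transform_within[OF _ zero_less_one t]) (simp add: H_eq[OF _ c])
  then have "vector_derivative (\<lambda>s. H s x) (at t within cbox 0 T) = e"
    using T t by (intro vector_derivative_within_cbox) (auto simp: has_real_derivative_iff_has_vector_derivative)
  then show ?thesis using e by simp
qed

text \<open>The set of all values is a finite union of continuous images of compact coordinate
  cylinders, so it has a maximum.\<close>

lemma attains_sup_spacetime:
  assumes "\<And>c. c \<in> A \<Longrightarrow> continuous_on ({0..T} \<times> chart_image c) (\<lambda>(t, y). F t (chart_inv c y))"
  shows "\<exists>t0\<in>{0..T}. \<exists>x0. \<forall>t\<in>{0..T}. \<forall>x. F t x \<le> (F t0 x0 :: real)"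
proof -
  obtain D where D: "finite D" "\<And>c K. (c, K) \<in> D \<Longrightarrow> c \<in> A \<and> compact K \<and> K \<subseteq> chart_image c"
    "\<And>x. \<exists>c K. (c, K) \<in> D \<and> x \<in> chart_inv c ` K" by (rule compact_chart_cover) blast
  define W where "W = (\<Union>d\<in>D. (\<lambda>(t, y). F t (chart_inv (fst d) y)) ` ({0..T} \<times> snd d))"
  have W: "F t x \<in> W" if "t \<in> {0..T}" for t x
  proof -
    obtain c K y where "(c, K) \<in> D" "y \<in> K" "x = chart_inv c y" using D(3)[of x] by blast
    then show ?thesis using that unfolding W_def by force
  qed
  have "compact W" unfolding W_def
  proof (rule compact_UN[OF D(1)])
    fix d assume d: "d \<in> D"
    obtain c K where dK: "d = (c, K)" by fastforce
    with D(2) d have cK: "c \<in> A" "compact K" "K \<subseteq> chart_image c" by auto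
    have "compact ((\<lambda>(t, y). F t (chart_inv c y)) ` ({0..T} \<times> K))"
      using continuous_on_subset[OF assms[OF cK(1)], of "{0..T} \<times> K"] cK
      by (intro compact_continuous_image compact_Times) auto
    then show "compact ((\<lambda>(t, y). F t (chart_inv (fst d) y)) ` ({0..T} \<times> snd d))" by (simp add: dK)
  qed
  moreover have "W \<noteq> {}" using W[of 0] T by auto
  ultimately obtain m where m: "m \<in> W" "\<And>z. z \<in> W \<Longrightarrow> z \<le> m" using compact_attains_sup by metis
  then obtain t0 x0 where "t0 \<in> {0..T}" "m = F t0 x0" unfolding W_def by auto
  then show ?thesis using m(2) W by blast
qed

text \<open>Maximum principle for \<open>1 / H + 2 t / n\<close>, which is constant in time along solutions of
  \<open>\<phi>' = 2 \<phi>\<^sup>2 / n\<close>.\<close>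

lemma H_lower_bound:
  assumes pos: "\<And>t x. t \<in> {0..T} \<Longrightarrow> 0 < H t x" and m: "0 < m" "\<And>x. m \<le> H 0 x"
    and evol: "\<And>t x. t \<in> {0..T} \<Longrightarrow> laplace_beltrami A (g t) (H t) x + 2 / real CARD('n) * (H t x)\<^sup>2
      \<le> vector_derivative (\<lambda>s. H s x) (at t within {0..T})"
    and t: "t \<in> {0..T}"
  shows "1 / H t x + 2 / real CARD('n) * t \<le> 1 / m"
proof -
  let ?n = "real CARD('n)"
  \<comment> \<open>Lowering the coefficient of t by \<epsilon> makes the time derivative strictly
    negative at a maximum with \<open>t0 > 0\<close>, so that slightly earlier values would be
    larger.\<close>
  have bound: "1 / H t x + (2 / ?n - \<epsilon>) * t \<le> 1 / m" if \<epsilon>: "0 < \<epsilon>" for \<epsilon>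
  proof -
    define F where "F = (\<lambda>t x. 1 / H t x + (2 / ?n - \<epsilon>) * t)"
    have cont: "continuous_on ({0..T} \<times> chart_image c) (\<lambda>(t, y). F t (chart_inv c y))" if "c \<in> A" for c
    proof -
      have "continuous_on ({0..T} \<times> chart_image c) (\<lambda>z. 1 / (\<lambda>(t, y). H t (chart_inv c y)) z + (2 / ?n - \<epsilon>) * fst z)"
        by (intro continuous_intros continuous_on_H_chart that) (use pos in \<open>fastforce simp: less_le\<close>)
      then show ?thesis by (simp add: F_def case_prod_unfold)
    qed
    obtain t0 x0 where t0: "t0 \<in> {0..T}" and max: "\<And>t x. t \<in> {0..T} \<Longrightarrow> F t x \<le> F t0 x0"
      using attains_sup_spacetime[OF cont] by blast
    have "t0 = 0"
    proof (rule ccontr)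
      assume "t0 \<noteq> 0"
      then have t00: "0 < t0" using t0 by simp
      have min: "H t0 x0 \<le> H t0 y" for y
      proof -
        have "1 / H t0 y \<le> 1 / H t0 x0" using max[OF t0, of y] by (simp add: F_def)
        then show ?thesis using pos[OF t0, of y] pos[OF t0, of x0] by (simp add: field_simps)
      qed
      let ?d = "vector_derivative (\<lambda>s. H s x0) (at t0 within {0..T})"
      have d: "2 / ?n * (H t0 x0)\<^sup>2 \<le> ?d"
        using evol[OF t0, of x0] laplace_nonneg_at_minimum[OF t0 min] by linarith
      have p0: "0 < H t0 x0" by (rule pos[OF t0])
      have "((\<lambda>s. F s x0) has_real_derivative - (?d / (H t0 x0)\<^sup>2) + (2 / ?n - \<epsilon>)) (at t0 within {0..T})"
        unfolding F_def
        using p0 by (auto intro!: derivative_eq_intros H_time_derivative[OF t0] simp: power2_eq_square)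
      moreover have "- (?d / (H t0 x0)\<^sup>2) + (2 / ?n - \<epsilon>) < 0"
      proof -
        have "2 / ?n \<le> ?d / (H t0 x0)\<^sup>2" using d p0 by (simp add: pos_le_divide_eq)
        then show ?thesis using \<epsilon> by linarith
      qed
      ultimately obtain e where e: "0 < e" "\<And>k. 0 < k \<Longrightarrow> t0 - k \<in> {0..T} \<Longrightarrow> k < e \<Longrightarrow> F t0 x0 < F (t0 - k) x0"
        using has_real_derivative_neg_dec_left by blast
      define k where "k = min e t0 / 2"
      have "0 < k" "k < e" "t0 - k \<in> {0..T}" using e(1) t00 t0 by (auto simp: k_def)
      then show False using e(2)[of k] max[of "t0 - k" x0] by simp
    qed
    then have "F t x \<le> 1 / H 0 x0" using max[OF t, of x] by (simp add: F_def)
    also have "\<dots> \<le> 1 / m" using m by (intro divide_left_mono) (auto intro: mult_pos_pos less_le_trans)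
    finally show ?thesis by (simp add: F_def)
  qed
  show ?thesis
  proof (rule field_le_epsilon)
    fix e :: real assume e: "0 < e"
    have "1 / H t x + (2 / ?n - e / T) * t \<le> 1 / m" using e T by (intro bound) simp
    moreover have "e / T * t \<le> e" using e T t by (simp add: field_simps)
    ultimately show "1 / H t x + 2 / ?n * t \<le> 1 / m + e" by (simp add: left_diff_distrib)
  qed
qed

text \<open>Positivity of 1 / H in the maximum principle bound forces the denominator of \<psi> to
  be positive on the whole interval, so \<psi> has an explicit logarithmic primitive there, and this
  primitive is the barrier in \<open>lam_growth\<close>.\<close>

lemma lam_exponential_bound:
  fixes m :: real
  defines "\<psi> \<equiv> \<lambda>t. m / (1 - 2 / real CARD('n) * m * t)"
  assumes pos: "\<And>t x. t \<in> {0..T} \<Longrightarrow> 0 < H t x" and m: "0 < m" "\<And>x. m \<le> H 0 x"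
    and evol: "\<And>t x. t \<in> {0..T} \<Longrightarrow> laplace_beltrami A (g t) (H t) x + 2 / real CARD('n) * (H t x)\<^sup>2
      \<le> vector_derivative (\<lambda>s. H s x) (at t within {0..T})"
    and t: "t1 \<in> {0..T}" "t2 \<in> {0..T}" "t1 < t2"
  shows "lam t1 * exp (\<alpha> * p * integral {t1..t2} \<psi>) \<le> lam t2"
proof -
  define b where "b = 2 / real CARD('n)"
  have b: "0 < b" by (simp add: b_def)
  have lower: "1 / H t x + b * t \<le> 1 / m" if "t \<in> {0..T}" for t x
    unfolding b_def by (rule H_lower_bound[OF pos m evol that])
  have den: "0 < 1 - b * m * t" and \<psi>_le: "\<psi> t \<le> H t x" if "t \<in> {0..T}" for t x
  proof -
    have low: "1 / H t x \<le> (1 - b * m * t) / m" for x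
      using lower[OF that, of x] m(1) by (simp add: diff_divide_distrib)
    have "0 < 1 / H t x" using pos[OF that, of x] by simp
    then have "0 < (1 - b * m * t) / m" using low[of x] by linarith
    then show d: "0 < 1 - b * m * t" using m(1) by (simp add: zero_less_divide_iff)
    show "\<psi> t \<le> H t x" for x
      using low[of x] d m(1) pos[OF that, of x] by (simp add: \<psi>_def b_def[symmetric] field_simps)
  qed
  define \<kappa> where "\<kappa> = (\<lambda>t. - ln (1 - b * m * t) / b)"
  have \<kappa>: "(\<kappa> has_real_derivative \<psi> s) (at s within {0..T})" if "s \<in> {0..T}" for s
    unfolding \<kappa>_def \<psi>_def b_def[symmetric]
    using den[OF that] b by (auto intro!: derivative_eq_intros simp: field_simps)
  have "(\<psi> has_integral (\<kappa> t2 - \<kappa> t1)) {t1..t2}"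
  proof (rule fundamental_theorem_of_calculus)
    show "(\<kappa> has_vector_derivative \<psi> x) (at x within {t1..t2})" if "x \<in> {t1..t2}" for x
      using \<kappa>[of x] that t DERIV_subset[of \<kappa> "\<psi> x" x "{0..T}" "{t1..t2}"]
      by (auto simp: has_real_derivative_iff_has_vector_derivative[symmetric])
  qed (use t in auto)
  then have "integral {t1..t2} \<psi> = \<kappa> t2 - \<kappa> t1" by (rule integral_unique)
  then show ?thesis using lam_growth[OF t(1,2) less_imp_le[OF t(3)] \<kappa> \<psi>_le] by simp
qed

end

theorem corollary2p9:
  fixes A :: "('m::{t2_space, second_countable_topology}, 'n::{finite, wellorder}) chart set"
    and g h :: "real \<Rightarrow> ('m, 'n) tensor2"
    and T p \<alpha> :: real
    and H :: "real \<Rightarrow> 'm \<Rightarrow> real"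
    and H_min lam \<psi> :: "real \<Rightarrow> real"
  defines "H \<equiv> \<lambda>t. metric_trace A (g t) (h t)"
    and "H_min \<equiv> \<lambda>t. trace_min A (g t) (h t)"
    and "lam \<equiv> \<lambda>t. first_p_eigenvalue A (g t) p"
    and "\<psi> \<equiv> \<lambda>t. H_min 0 / (1 - 2 / real CARD('n) * H_min 0 * t)"
  assumes "closed_manifold A" and "1 < CARD('n)" and "0 < T"
    and "geometric_flow A T g h"
    and "1 \<le> p" and "\<alpha> \<in> {1 / p ..< 1 / real CARD('n)}"
    and "\<forall>t\<in>{0..T}. tensor2_nonneg A (\<lambda>c x. h t c x - (\<alpha> * H t x) *\<^sub>R g t c x)"
    and "\<forall>t\<in>{0..T}. \<forall>x. 0 \<le> H t x"
  shows "(\<forall>u :: real \<Rightarrow> 'm \<Rightarrow> real.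
            (\<forall>t\<in>{0..T}. p_eigenfunction A (g t) p (lam t) (u t) \<and>
               (LINT x|riemannian_measure A (g t). \<bar>u t x\<bar> powr p) = 1) \<longrightarrow>
            (\<forall>t1\<in>{0..T}. \<forall>t2\<in>{0..T}. t1 < t2 \<longrightarrow>
               lam t1 + integral {t1..t2} (\<lambda>t. Theta A p \<alpha> (g t) (h t) (u t)) \<le> lam t2))
       \<and> ((\<forall>t\<in>{0..T}. 0 < H_min t \<and> (\<forall>x. H_min t \<le> H t x)) \<and>
          (\<forall>t\<in>{0..T}. \<forall>x.
             laplace_beltrami A (g t) (H t) x + 2 / real CARD('n) * (H t x)\<^sup>2
               \<le> vector_derivative (\<lambda>s. H s x) (at t within {0..T})) \<longrightarrow>
          (\<forall>t1\<in>{0..T}. \<forall>t2\<in>{0..T}. t1 < t2 \<longrightarrow>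
             lam t1 * exp (\<alpha> * p * integral {t1..t2} \<psi>) \<le> lam t2))"
proof -
  interpret F: pinched_flow A g h T p \<alpha>
    using assms(5-12) unfolding H_def by unfold_locales auto
  have lam: "lam = F.lam" by (simp add: fun_eq_iff lam_def F.lam_def)
  have H: "H = F.H" by (simp add: fun_eq_iff H_def)
  have first: "lam t1 + integral {t1..t2} (\<lambda>t. Theta A p \<alpha> (g t) (h t) (u t)) \<le> lam t2"
    if "\<forall>t\<in>{0..T}. p_eigenfunction A (g t) p (lam t) (u t) \<and>
      (LINT x|riemannian_measure A (g t). \<bar>u t x\<bar> powr p) = 1"
      "t1 \<in> {0..T}" "t2 \<in> {0..T}" "t1 < t2" for u t1 t2
    using that unfolding lam by (intro F.lam_integral_bound) auto
  have second: "lam t1 * exp (\<alpha> * p * integral {t1..t2} \<psi>) \<le> lam t2"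
    if min: "\<forall>t\<in>{0..T}. 0 < H_min t \<and> (\<forall>x. H_min t \<le> H t x)"
      and evol: "\<forall>t\<in>{0..T}. \<forall>x. laplace_beltrami A (g t) (H t) x + 2 / real CARD('n) * (H t x)\<^sup>2
        \<le> vector_derivative (\<lambda>s. H s x) (at t within {0..T})"
      and t: "t1 \<in> {0..T}" "t2 \<in> {0..T}" "t1 < t2" for t1 t2
    unfolding lam \<psi>_def
  proof (rule F.lam_exponential_bound[OF _ _ _ _ t])
    show "0 < F.H t x" if "t \<in> {0..T}" for t x
      using min that unfolding H by (meson less_le_trans)
    show "0 < H_min 0" "H_min 0 \<le> F.H 0 x" for x
      using min F.T unfolding H by auto
    show "laplace_beltrami A (g t) (F.H t) x + 2 / real CARD('n) * (F.H t x)\<^sup>2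
        \<le> vector_derivative (\<lambda>s. F.H s x) (at t within {0..T})" if "t \<in> {0..T}" for t x
      using evol that unfolding H by blast
  qed
  show ?thesis using first second by blast
qed

end
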